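(* The graphical category $\mathbf U$, equipped with the wide subcategories $\mathbf U^+$ and $\mathbf U^-$ and the degree function $\deg(G)=|V(G)|+|E_i(G)|$, is a dualizable generalized Reedy category.
   Context: **Graphs.** A graph $G$ consists of finite sets $A$ (arcs), $V$ (vertices), a subset $D\subseteq A$, a fixed-point-free involution $i:A\to A$ and a function $t:D\to V$. Put $\mathrm{nb}(v)=t^{-1}(v)\subseteq D$ and $\eth(G)=A\setminus D$ (the boundary). An edge is an $i$-orbit $[a,ia]$; it is internal if $a,ia\in D$; $E_i$ is the set of internal edges. Graphs are viewed as diagrams of finite sets ($A$ with endomap $i$, $A\leftarrow D\to V$); let $\mathcal D$ be the category of all diagrams of finite sets of this shape, with natural transformations. A graph is connected if it is nonempty and is not a nontrivial coproduct in $\mathcal D$. A natural transformation $G\to G'$ is étale if the square formed by $t:D\to V$, $t':D'\to V'$ is a pullback. The exceptional edge $\updownarrow$ is the graph with $A=\{\natural,\natural^\dagger\}$, $D=V=\varnothing$. For a vertex $v$ of $G$, the star $\star_v$ has vertex set $\{v\}$, $D=\mathrm{nb}(v)$, $A=\mathrm{nb}(v)\amalg \mathrm{nb}(v)^\dagger$ with $i(a)=a^\dagger$. An embedding is an étale map between connected graphs that is injective on vertices. An embedding $f:H\to G$ is injective on $\eth(H)$; put $\eth(f)=f(\eth(H))\subseteq A(G)$. $\mathrm{Emb}(G)$ is the set of embeddings with target $G$ modulo $f\sim fz$ for $z$ an isomorphism; a class is called an edge if its domain is isomorphic to $\updownarrow$; $\eth$ is well defined on classes. The map $\iota_v:\star_v\to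 G$, with $a\mapsto a$, $a^\dagger\mapsto ia$, $v\mapsto v$, is an embedding. **Graphical maps.** For connected graphs $G,G'$ a graphical map $\varphi:G\to G'$ is a pair of functions $\varphi_0:A\to A'$ commuting with the involutions and $\varphi_1:V\to\mathrm{Emb}(G')$ such that, choosing representatives $\varphi_v:H_v\to G'$ of $\varphi_1(v)$: (i) each $w\in V'$ equals $\varphi_v(u)$ for at most one pair $(v,u)$ with $v\in V$, $u\in V(H_v)$; (ii) for each $v$, $a\mapsto \varphi_0(ia)$ is a bijection $\mathrm{nb}(v)\to\eth(\varphi_1(v))$; (iii) if $\eth(G)=\varnothing$ then some $\varphi_1(v)$ is not an edge. An embedding $f$ is regarded as the graphical map $(f|_A,\ v\mapsto[\iota_{f(v)}])$. For an embedding $f:H\to G$ put $\varphi|_f=(\varphi_0 f,\varphi_1 f):H\to G'$. **Image and composition.** If $G=\updownarrow$, a graphical map $\varphi:G\to G'$ is an embedding and $\mathrm{im}(\varphi)=[\varphi]$. Otherwise let $m_v:i(\mathrm{nb}(v))\to\eth(H_v)$ be the bijection with $\varphi_v m_v=\varphi_0$; order each internal edge $e=[x_e^1,x_e^2]$ of $G$, and let $G\{H_v\}$ be the coequalizer in $\mathcal D$ of the two maps $\coprod_{e\in E_i}\updownarrow\ \rightrightarrows\ \coprod_v H_v$ which on the summand $e$ land in $H_{tx_e^1}$ with $\natural\mapsto m_{tx_e^1}(ix_e^1)$, respectively in $H_{tx_e^2}$ with $\natural^\dagger\mapsto m_{tx_e^2}(ix_e^2)$. The maps $\varphi_v$ induce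 an embedding $G\{H_v\}\to G'$, whose class is $\mathrm{im}(\varphi)\in\mathrm{Emb}(G')$. The composite of $\varphi:G\to H$ and $\psi:H\to K$ is $(\psi\varphi)_0=\psi_0\varphi_0$, $(\psi\varphi)_1(v)=\mathrm{im}(\psi|_{\varphi_v})$. The graphical category $\mathbf U$ has connected graphs as objects and graphical maps as morphisms. **Subcategories.** A graphical map $\varphi:G\to G'$ is active if $\varphi_0$ restricts to a bijection $\eth(G)\to\eth(G')$. $\mathbf U^-$ consists of the active maps with $\varphi_0$ surjective. Every graphical map factors, uniquely up to unique isomorphism, as $\varphi=f\varphi'$ with $\varphi'$ active and $f$ an embedding; $\mathbf U^+$ consists of those $\varphi$ for which $\varphi'_0$ is injective. **Dualizable generalized Reedy category** (Berger–Moerdijk): a small category $\mathbf R$ with wide subcategories $\mathbf R^+,\mathbf R^-$ and a function $\deg:\mathrm{ob}(\mathbf R)\to\mathbb N$ such that: non-invertible morphisms in $\mathbf R^+$ (resp. $\mathbf R^-$) raise (resp. lower) the degree and isomorphisms preserve it; $\mathbf R^+\cap\mathbf R^-=\mathrm{Iso}(\mathbf R)$; every morphism $f$ factors as $f=gh$ with $g\in\mathbf R^+$, $h\in\mathbf R^-$, uniquely up to isomorphism; if $\theta f=f$ with $\theta$ an isomorphism and $f\in\mathbf R^-$ then $\theta$ is an identity; and (dualizability) if $f\theta=f$ with $\theta$ an isomorphism and $f\in\mathbf R^+$ then $\theta$ is an identity. *)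

theory Defs
  imports Main "HOL-Library.FuncSet" "HOL-Library.Infinite_Typeclass"
begin

section \<open>Small categories and dualizable generalized Reedy structures\<close>

text \<open>
  Categories are given by hom-sets. Hom-sets of different pairs of objects need not be disjoint,
  so identities and composition take the objects as arguments:
  \<open>Comp C X Y Z g f\<close> is the composite of \<open>f : X \<rightarrow> Y\<close> and \<open>g : Y \<rightarrow> Z\<close>.
\<close>

record ('o, 'm) category =
  Ob :: "'o set"
  Hom :: "'o \<Rightarrow> 'o \<Rightarrow> 'm set"
  Id :: "'o \<Rightarrow> 'm"
  Comp :: "'o \<Rightarrow> 'o \<Rightarrow> 'o \<Rightarrow> 'm \<Rightarrow> 'm \<Rightarrow> 'm"

definition is_category :: "('o, 'm) category \<Rightarrow> bool" where
  "is_category C \<longleftrightarrow>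
     (\<forall>X\<in>Ob C. Id C X \<in> Hom C X X) \<and>
     (\<forall>X\<in>Ob C. \<forall>Y\<in>Ob C. \<forall>Z\<in>Ob C. \<forall>f\<in>Hom C X Y. \<forall>g\<in>Hom C Y Z. Comp C X Y Z g f \<in> Hom C X Z) \<and>
     (\<forall>X\<in>Ob C. \<forall>Y\<in>Ob C. \<forall>f\<in>Hom C X Y.
        Comp C X X Y f (Id C X) = f \<and> Comp C X Y Y (Id C Y) f = f) \<and>
     (\<forall>W\<in>Ob C. \<forall>X\<in>Ob C. \<forall>Y\<in>Ob C. \<forall>Z\<in>Ob C.
        \<forall>f\<in>Hom C W X. \<forall>g\<in>Hom C X Y. \<forall>h\<in>Hom C Y Z.
          Comp C W X Z (Comp C X Y Z h g) f = Comp C W Y Z h (Comp C W X Y g f))"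

definition isos :: "('o, 'm) category \<Rightarrow> 'o \<Rightarrow> 'o \<Rightarrow> 'm set" where
  "isos C X Y = {f \<in> Hom C X Y. \<exists>g\<in>Hom C Y X.
     Comp C X Y X g f = Id C X \<and> Comp C Y X Y f g = Id C Y}"

definition wide_subcategory :: "('o, 'm) category \<Rightarrow> ('o \<Rightarrow> 'o \<Rightarrow> 'm set) \<Rightarrow> bool" where
  "wide_subcategory C S \<longleftrightarrow>
     (\<forall>X\<in>Ob C. \<forall>Y\<in>Ob C. S X Y \<subseteq> Hom C X Y) \<and>
     (\<forall>X\<in>Ob C. Id C X \<in> S X X) \<and>
     (\<forall>X\<in>Ob C. \<forall>Y\<in>Ob C. \<forall>Z\<in>Ob C. \<forall>f\<in>S X Y. \<forall>g\<in>S Y Z. Comp C X Y Z g f \<in> S X Z)"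

definition dualizable_generalized_Reedy ::
  "('o, 'm) category \<Rightarrow> ('o \<Rightarrow> 'o \<Rightarrow> 'm set) \<Rightarrow> ('o \<Rightarrow> 'o \<Rightarrow> 'm set) \<Rightarrow> ('o \<Rightarrow> nat) \<Rightarrow> bool" where
  "dualizable_generalized_Reedy R Rplus Rminus degree \<longleftrightarrow>
     is_category R \<and> wide_subcategory R Rplus \<and> wide_subcategory R Rminus \<and>
     (\<forall>X\<in>Ob R. \<forall>Y\<in>Ob R. \<forall>f\<in>Rplus X Y. f \<notin> isos R X Y \<longrightarrow> degree X < degree Y) \<and>
     (\<forall>X\<in>Ob R. \<forall>Y\<in>Ob R. \<forall>f\<in>Rminus X Y. f \<notin> isos R X Y \<longrightarrow> degree Y < degree X) \<and>
     (\<forall>X\<in>Ob R. \<forall>Y\<in>Ob R. \<forall>f\<in>isos R X Y. degree X = degree Y) \<and>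
     (\<forall>X\<in>Ob R. \<forall>Y\<in>Ob R. Rplus X Y \<inter> Rminus X Y = isos R X Y) \<and>
     (\<forall>X\<in>Ob R. \<forall>Y\<in>Ob R. \<forall>f\<in>Hom R X Y.
        (\<exists>Z\<in>Ob R. \<exists>h\<in>Rminus X Z. \<exists>g\<in>Rplus Z Y. f = Comp R X Z Y g h) \<and>
        (\<forall>Z\<in>Ob R. \<forall>h\<in>Rminus X Z. \<forall>g\<in>Rplus Z Y.
         \<forall>Z'\<in>Ob R. \<forall>h'\<in>Rminus X Z'. \<forall>g'\<in>Rplus Z' Y.
           f = Comp R X Z Y g h \<and> f = Comp R X Z' Y g' h' \<longrightarrow>
           (\<exists>\<theta>\<in>isos R Z Z'. Comp R X Z Z' \<theta> h = h' \<and> Comp R Z Z' Y g' \<theta> = g))) \<and>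
     (\<forall>X\<in>Ob R. \<forall>Y\<in>Ob R. \<forall>f\<in>Rminus X Y. \<forall>\<theta>\<in>isos R Y Y.
        Comp R X Y Y \<theta> f = f \<longrightarrow> \<theta> = Id R Y) \<and>
     (\<forall>X\<in>Ob R. \<forall>Y\<in>Ob R. \<forall>f\<in>Rplus X Y. \<forall>\<theta>\<in>isos R X X.
        Comp R X X Y f \<theta> = f \<longrightarrow> \<theta> = Id R X)"


section \<open>The category of diagrams\<close>

text \<open>
  Diagrams of finite sets: an endomap \<open>dag\<close> of \<open>arcs\<close>, and \<open>arcs \<leftarrow> darcs \<rightarrow> verts\<close>.
  All functions are extensional (\<open>undefined\<close> off their domain), so that equality in HOL is
  equality of diagrams, resp. of natural transformations.
\<close>

record ('a, 'd, 'v) diagram =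
  arcs :: "'a set"
  darcs :: "'d set"
  verts :: "'v set"
  dag :: "'a \<Rightarrow> 'a"
  incl :: "'d \<Rightarrow> 'a"
  tgt :: "'d \<Rightarrow> 'v"

definition diagram :: "('a, 'd, 'v) diagram \<Rightarrow> bool" where
  "diagram X \<longleftrightarrow> finite (arcs X) \<and> finite (darcs X) \<and> finite (verts X) \<and>
     dag X \<in> arcs X \<rightarrow>\<^sub>E arcs X \<and> incl X \<in> darcs X \<rightarrow>\<^sub>E arcs X \<and> tgt X \<in> darcs X \<rightarrow>\<^sub>E verts X"

record ('a, 'd, 'v, 'b, 'e, 'w) ntrans =
  onA :: "'a \<Rightarrow> 'b"
  onD :: "'d \<Rightarrow> 'e"
  onV :: "'v \<Rightarrow> 'w"

definition nat_trans ::
  "('a, 'd, 'v) diagram \<Rightarrow> ('b, 'e, 'w) diagram \<Rightarrow> ('a, 'd, 'v, 'b, 'e, 'w) ntrans \<Rightarrow> bool" where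
  "nat_trans X Y f \<longleftrightarrow>
     onA f \<in> arcs X \<rightarrow>\<^sub>E arcs Y \<and> onD f \<in> darcs X \<rightarrow>\<^sub>E darcs Y \<and> onV f \<in> verts X \<rightarrow>\<^sub>E verts Y \<and>
     (\<forall>a\<in>arcs X. onA f (dag X a) = dag Y (onA f a)) \<and>
     (\<forall>d\<in>darcs X. onA f (incl X d) = incl Y (onD f d)) \<and>
     (\<forall>d\<in>darcs X. onV f (tgt X d) = tgt Y (onD f d))"

definition nt_id :: "('a, 'd, 'v) diagram \<Rightarrow> ('a, 'd, 'v, 'a, 'd, 'v) ntrans" where
  "nt_id X = \<lparr>onA = (\<lambda>a\<in>arcs X. a), onD = (\<lambda>d\<in>darcs X. d), onV = (\<lambda>v\<in>verts X. v)\<rparr>"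

definition nt_comp ::
  "('a, 'd, 'v) diagram \<Rightarrow> ('b, 'e, 'w, 'c, 'f, 'x) ntrans \<Rightarrow> ('a, 'd, 'v, 'b, 'e, 'w) ntrans
     \<Rightarrow> ('a, 'd, 'v, 'c, 'f, 'x) ntrans" where
  "nt_comp X g f = \<lparr>onA = compose (arcs X) (onA g) (onA f),
                    onD = compose (darcs X) (onD g) (onD f),
                    onV = compose (verts X) (onV g) (onV f)\<rparr>"

definition nt_iso ::
  "('a, 'd, 'v) diagram \<Rightarrow> ('b, 'e, 'w) diagram \<Rightarrow> ('a, 'd, 'v, 'b, 'e, 'w) ntrans \<Rightarrow> bool" where
  "nt_iso X Y f \<longleftrightarrow> nat_trans X Y f \<and>
     (\<exists>g. nat_trans Y X g \<and> nt_comp X g f = nt_id X \<and> nt_comp Y f g = nt_id Y)"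

definition nonempty :: "('a, 'd, 'v) diagram \<Rightarrow> bool" where
  "nonempty X \<longleftrightarrow> arcs X \<noteq> {} \<or> darcs X \<noteq> {} \<or> verts X \<noteq> {}"


subsection \<open>Coproducts\<close>

definition coprod ::
  "'i set \<Rightarrow> ('i \<Rightarrow> ('a, 'd, 'v) diagram) \<Rightarrow> ('i \<times> 'a, 'i \<times> 'd, 'i \<times> 'v) diagram" where
  "coprod I X =
     \<lparr>arcs = (SIGMA i:I. arcs (X i)),
      darcs = (SIGMA i:I. darcs (X i)),
      verts = (SIGMA i:I. verts (X i)),
      dag = (\<lambda>(i, a)\<in>(SIGMA i:I. arcs (X i)). (i, dag (X i) a)),
      incl = (\<lambda>(i, d)\<in>(SIGMA i:I. darcs (X i)). (i, incl (X i) d)),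
      tgt = (\<lambda>(i, d)\<in>(SIGMA i:I. darcs (X i)). (i, tgt (X i) d))\<rparr>"

definition coprod_in ::
  "('i \<Rightarrow> ('a, 'd, 'v) diagram) \<Rightarrow> 'i \<Rightarrow> ('a, 'd, 'v, 'i \<times> 'a, 'i \<times> 'd, 'i \<times> 'v) ntrans" where
  "coprod_in X i = \<lparr>onA = (\<lambda>a\<in>arcs (X i). (i, a)),
                    onD = (\<lambda>d\<in>darcs (X i). (i, d)),
                    onV = (\<lambda>v\<in>verts (X i). (i, v))\<rparr>"

definition copair ::
  "'i set \<Rightarrow> ('i \<Rightarrow> ('a, 'd, 'v) diagram) \<Rightarrow> ('i \<Rightarrow> ('a, 'd, 'v, 'b, 'e, 'w) ntrans)
     \<Rightarrow> ('i \<times> 'a, 'i \<times> 'd, 'i \<times> 'v, 'b, 'e, 'w) ntrans" where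
  "copair I X g = \<lparr>onA = (\<lambda>(i, a)\<in>(SIGMA i:I. arcs (X i)). onA (g i) a),
                   onD = (\<lambda>(i, d)\<in>(SIGMA i:I. darcs (X i)). onD (g i) d),
                   onV = (\<lambda>(i, v)\<in>(SIGMA i:I. verts (X i)). onV (g i) v)\<rparr>"

lemma diagram_coprod:
  assumes "finite I" "\<And>i. i \<in> I \<Longrightarrow> diagram (X i)"
  shows "diagram (coprod I X)"
  using assms unfolding diagram_def coprod_def
  by (auto simp: PiE_iff extensional_def split: prod.splits)

lemma nat_trans_coprod_in:
  assumes "i \<in> I" "diagram (X i)"
  shows "nat_trans (X i) (coprod I X) (coprod_in X i)"
  using assms unfolding diagram_def coprod_def coprod_in_def nat_trans_def
  by (auto simp: PiE_iff)

lemma coprod_universal: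
  assumes X: "\<And>i. i \<in> I \<Longrightarrow> diagram (X i)"
    and g: "\<And>i. i \<in> I \<Longrightarrow> nat_trans (X i) Z (g i)"
  shows "nat_trans (coprod I X) Z u \<and> (\<forall>i\<in>I. nt_comp (X i) u (coprod_in X i) = g i)
           \<longleftrightarrow> u = copair I X g"
proof
  assume "u = copair I X g"
  then show "nat_trans (coprod I X) Z u \<and> (\<forall>i\<in>I. nt_comp (X i) u (coprod_in X i) = g i)"
    using X g unfolding nat_trans_def diagram_def coprod_def coprod_in_def copair_def nt_comp_def
    by (fastforce simp: PiE_iff compose_def extensional_def restrict_def
        intro!: ntrans.equality ext split: prod.splits)
next
  assume u: "nat_trans (coprod I X) Z u \<and> (\<forall>i\<in>I. nt_comp (X i) u (coprod_in X i) = g i)"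
  then have g_eq: "g i = nt_comp (X i) u (coprod_in X i)" if "i \<in> I" for i
    using that by simp
  show "u = copair I X g"
  proof (rule ntrans.equality)
    show "onA u = onA (copair I X g)"
      using u by (auto simp: nat_trans_def coprod_def copair_def g_eq nt_comp_def coprod_in_def
          compose_def PiE_iff extensional_def fun_eq_iff)
    show "onD u = onD (copair I X g)"
      using u by (auto simp: nat_trans_def coprod_def copair_def g_eq nt_comp_def coprod_in_def
          compose_def PiE_iff extensional_def fun_eq_iff)
    show "onV u = onV (copair I X g)"
      using u by (auto simp: nat_trans_def coprod_def copair_def g_eq nt_comp_def coprod_in_def
          compose_def PiE_iff extensional_def fun_eq_iff)
  qed simp
qed


subsection \<open>Coequalizers\<close>

text \<open>The equivalence relation on \<open>S\<close> generated by \<open>r \<subseteq> S \<times> S\<close>.\<close>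

definition gen_equiv :: "'s set \<Rightarrow> ('s \<times> 's) set \<Rightarrow> ('s \<times> 's) set" where
  "gen_equiv S r = (r \<union> r\<inverse>)\<^sup>* \<inter> S \<times> S"

definition relA ::
  "('a, 'd, 'v) diagram \<Rightarrow> ('b, 'e, 'w) diagram \<Rightarrow> ('a, 'd, 'v, 'b, 'e, 'w) ntrans
     \<Rightarrow> ('a, 'd, 'v, 'b, 'e, 'w) ntrans \<Rightarrow> ('b \<times> 'b) set" where
  "relA X Y l r = gen_equiv (arcs Y) ((\<lambda>a. (onA l a, onA r a)) ` arcs X)"

definition relD ::
  "('a, 'd, 'v) diagram \<Rightarrow> ('b, 'e, 'w) diagram \<Rightarrow> ('a, 'd, 'v, 'b, 'e, 'w) ntrans
     \<Rightarrow> ('a, 'd, 'v, 'b, 'e, 'w) ntrans \<Rightarrow> ('e \<times> 'e) set" where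
  "relD X Y l r = gen_equiv (darcs Y) ((\<lambda>d. (onD l d, onD r d)) ` darcs X)"

definition relV ::
  "('a, 'd, 'v) diagram \<Rightarrow> ('b, 'e, 'w) diagram \<Rightarrow> ('a, 'd, 'v, 'b, 'e, 'w) ntrans
     \<Rightarrow> ('a, 'd, 'v, 'b, 'e, 'w) ntrans \<Rightarrow> ('w \<times> 'w) set" where
  "relV X Y l r = gen_equiv (verts Y) ((\<lambda>v. (onV l v, onV r v)) ` verts X)"

text \<open>
  The coequalizer of \<open>l, r : X \<rightarrow> Y\<close>, computed pointwise. The structure maps send a class
  \<open>c\<close> to the class containing the image of \<open>c\<close>.
\<close>

definition coeq ::
  "('a, 'd, 'v) diagram \<Rightarrow> ('b, 'e, 'w) diagram \<Rightarrow> ('a, 'd, 'v, 'b, 'e, 'w) ntrans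
     \<Rightarrow> ('a, 'd, 'v, 'b, 'e, 'w) ntrans \<Rightarrow> ('b set, 'e set, 'w set) diagram" where
  "coeq X Y l r =
     \<lparr>arcs = arcs Y // relA X Y l r,
      darcs = darcs Y // relD X Y l r,
      verts = verts Y // relV X Y l r,
      dag = (\<lambda>c\<in>arcs Y // relA X Y l r. relA X Y l r `` (dag Y ` c)),
      incl = (\<lambda>c\<in>darcs Y // relD X Y l r. relA X Y l r `` (incl Y ` c)),
      tgt = (\<lambda>c\<in>darcs Y // relD X Y l r. relV X Y l r `` (tgt Y ` c))\<rparr>"

definition coeq_proj ::
  "('a, 'd, 'v) diagram \<Rightarrow> ('b, 'e, 'w) diagram \<Rightarrow> ('a, 'd, 'v, 'b, 'e, 'w) ntrans
     \<Rightarrow> ('a, 'd, 'v, 'b, 'e, 'w) ntrans \<Rightarrow> ('b, 'e, 'w, 'b set, 'e set, 'w set) ntrans" where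
  "coeq_proj X Y l r = \<lparr>onA = (\<lambda>b\<in>arcs Y. relA X Y l r `` {b}),
                        onD = (\<lambda>e\<in>darcs Y. relD X Y l r `` {e}),
                        onV = (\<lambda>w\<in>verts Y. relV X Y l r `` {w})\<rparr>"

text \<open>The map out of the coequalizer induced by \<open>h : Y \<rightarrow> Z\<close> with \<open>h l = h r\<close>.\<close>

definition coeq_desc ::
  "('b set, 'e set, 'w set) diagram \<Rightarrow> ('b, 'e, 'w, 'c, 'f, 'x) ntrans
     \<Rightarrow> ('b set, 'e set, 'w set, 'c, 'f, 'x) ntrans" where
  "coeq_desc Q h = \<lparr>onA = (\<lambda>c\<in>arcs Q. the_elem (onA h ` c)),
                    onD = (\<lambda>c\<in>darcs Q. the_elem (onD h ` c)),
                    onV = (\<lambda>c\<in>verts Q. the_elem (onV h ` c))\<rparr>"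

lemma equiv_gen_equiv: "equiv S (gen_equiv S r)"
proof (rule equivI)
  have "sym ((r \<union> r\<inverse>)\<^sup>*)"
    by (intro sym_rtrancl sym_Un_converse)
  then show "sym (gen_equiv S r)"
    unfolding gen_equiv_def sym_def by blast
  show "trans (gen_equiv S r)"
    unfolding gen_equiv_def trans_def by (blast intro: rtrancl_trans)
qed (auto simp: gen_equiv_def refl_on_def)

lemma gen_equiv_map:
  assumes "(x, y) \<in> gen_equiv S r" "r \<subseteq> S \<times> S" "equiv T E"
    and "\<And>x. x \<in> S \<Longrightarrow> f x \<in> T" "\<And>x y. (x, y) \<in> r \<Longrightarrow> (f x, f y) \<in> E"
  shows "(f x, f y) \<in> E"
proof -
  have x: "x \<in> S" and xy: "(x, y) \<in> (r \<union> r\<inverse>)\<^sup>*"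
    using assms(1) by (auto simp: gen_equiv_def)
  from xy show ?thesis
  proof (induction rule: rtrancl_induct)
    case base
    show ?case using assms(3,4) x by (auto simp: equiv_def refl_on_def)
  next
    case (step y z)
    have "(f y, f z) \<in> E"
      using step(2) assms(3,5) by (auto simp: equiv_def sym_def)
    with step(3) show ?case using assms(3) by (meson equivE transD)
  qed
qed

lemma gen_equiv_eq:
  assumes "(x, y) \<in> gen_equiv S r" "r \<subseteq> S \<times> S" "\<And>x y. (x, y) \<in> r \<Longrightarrow> f x = f y"
  shows "f x = f y"
  using gen_equiv_map[of x y S r UNIV "{(a, b). a = b}" f] assms
  by (auto simp: equiv_def refl_on_def sym_def trans_def)

lemma quotient_image_class:
  assumes "equiv S R" "equiv T E" "x \<in> S"
    and "\<And>x y. (x, y) \<in> R \<Longrightarrow> (f x, f y) \<in> E"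
  shows "E `` (f ` (R `` {x})) = E `` {f x}"
proof -
  have "E `` {f y} = E `` {f x}" if "(x, y) \<in> R" for y
    using that assms(2,4) by (metis equiv_class_eq)
  moreover have "(x, x) \<in> R"
    using assms(1,3) by (auto simp: equiv_def refl_on_def)
  ultimately show ?thesis by blast
qed

lemma the_elem_image_class:
  assumes "equiv S R" "x \<in> S" "\<And>x y. (x, y) \<in> R \<Longrightarrow> f x = f y"
  shows "the_elem (f ` (R `` {x})) = f x"
proof -
  have "f ` (R `` {x}) = {f x}"
    using assms by (fastforce simp: equiv_def refl_on_def)
  then show ?thesis by simp
qed

context
  fixes X :: "('a, 'd, 'v) diagram" and Y :: "('b, 'e, 'w) diagram" and l r
  assumes Y: "diagram Y" and l: "nat_trans X Y l" and r: "nat_trans X Y r"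
begin

lemma rel_equiv:
  "equiv (arcs Y) (relA X Y l r)" "equiv (darcs Y) (relD X Y l r)" "equiv (verts Y) (relV X Y l r)"
  by (simp_all add: relA_def relD_def relV_def equiv_gen_equiv)

lemma rel_gen_subset:
  "(\<lambda>a. (onA l a, onA r a)) ` arcs X \<subseteq> arcs Y \<times> arcs Y"
  "(\<lambda>d. (onD l d, onD r d)) ` darcs X \<subseteq> darcs Y \<times> darcs Y"
  "(\<lambda>v. (onV l v, onV r v)) ` verts X \<subseteq> verts Y \<times> verts Y"
  using l r by (auto simp: nat_trans_def PiE_iff)

lemma rel_gen:
  "a \<in> arcs X \<Longrightarrow> (onA l a, onA r a) \<in> relA X Y l r"
  "d \<in> darcs X \<Longrightarrow> (onD l d, onD r d) \<in> relD X Y l r"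
  "v \<in> verts X \<Longrightarrow> (onV l v, onV r v) \<in> relV X Y l r"
  using rel_gen_subset unfolding relA_def relD_def relV_def gen_equiv_def by blast+

lemma diagram_maps:
  "b \<in> arcs Y \<Longrightarrow> dag Y b \<in> arcs Y" "e \<in> darcs Y \<Longrightarrow> incl Y e \<in> arcs Y"
  "e \<in> darcs Y \<Longrightarrow> tgt Y e \<in> verts Y"
  using Y by (auto simp: diagram_def PiE_iff)

lemma rel_dag:
  assumes X: "diagram X" and "(x, y) \<in> relA X Y l r"
  shows "(dag Y x, dag Y y) \<in> relA X Y l r"
proof (rule gen_equiv_map[OF assms(2)[unfolded relA_def] rel_gen_subset(1) rel_equiv(1)])
  fix x y assume "(x, y) \<in> (\<lambda>a. (onA l a, onA r a)) ` arcs X"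
  then obtain a where a: "a \<in> arcs X" "x = onA l a" "y = onA r a" by auto
  then have "dag X a \<in> arcs X" "dag Y x = onA l (dag X a)" "dag Y y = onA r (dag X a)"
    using X l r by (auto simp: diagram_def nat_trans_def PiE_iff)
  then show "(dag Y x, dag Y y) \<in> relA X Y l r" using rel_gen(1) by simp
qed (use diagram_maps in auto)

lemma rel_incl:
  assumes X: "diagram X" and "(x, y) \<in> relD X Y l r"
  shows "(incl Y x, incl Y y) \<in> relA X Y l r"
proof (rule gen_equiv_map[OF assms(2)[unfolded relD_def] rel_gen_subset(2) rel_equiv(1)])
  fix x y assume "(x, y) \<in> (\<lambda>a. (onD l a, onD r a)) ` darcs X"
  then obtain a where a: "a \<in> darcs X" "x = onD l a" "y = onD r a" by auto
  then have "incl X a \<in> arcs X" "incl Y x = onA l (incl X a)" "incl Y y = onA r (incl X a)"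
    using X l r by (auto simp: diagram_def nat_trans_def PiE_iff)
  then show "(incl Y x, incl Y y) \<in> relA X Y l r" using rel_gen(1) by simp
qed (use diagram_maps in auto)

lemma rel_tgt:
  assumes X: "diagram X" and "(x, y) \<in> relD X Y l r"
  shows "(tgt Y x, tgt Y y) \<in> relV X Y l r"
proof (rule gen_equiv_map[OF assms(2)[unfolded relD_def] rel_gen_subset(2) rel_equiv(3)])
  fix x y assume "(x, y) \<in> (\<lambda>a. (onD l a, onD r a)) ` darcs X"
  then obtain a where a: "a \<in> darcs X" "x = onD l a" "y = onD r a" by auto
  then have "tgt X a \<in> verts X" "tgt Y x = onV l (tgt X a)" "tgt Y y = onV r (tgt X a)"
    using X l r by (auto simp: diagram_def nat_trans_def PiE_iff)
  then show "(tgt Y x, tgt Y y) \<in> relV X Y l r" using rel_gen(3) by simp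
qed (use diagram_maps in auto)

lemma coeq_class:
  assumes X: "diagram X"
  shows "b \<in> arcs Y \<Longrightarrow> dag (coeq X Y l r) (relA X Y l r `` {b}) = relA X Y l r `` {dag Y b}"
    and "e \<in> darcs Y \<Longrightarrow> incl (coeq X Y l r) (relD X Y l r `` {e}) = relA X Y l r `` {incl Y e}"
    and "e \<in> darcs Y \<Longrightarrow> tgt (coeq X Y l r) (relD X Y l r `` {e}) = relV X Y l r `` {tgt Y e}"
  using quotient_image_class[OF rel_equiv(1) rel_equiv(1) _ rel_dag[OF X], of b]
    quotient_image_class[OF rel_equiv(2) rel_equiv(1) _ rel_incl[OF X], of e]
    quotient_image_class[OF rel_equiv(2) rel_equiv(3) _ rel_tgt[OF X], of e]
  by (simp_all add: coeq_def quotientI)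

lemma coeq_carriers:
  "arcs (coeq X Y l r) = (\<lambda>b. relA X Y l r `` {b}) ` arcs Y"
  "darcs (coeq X Y l r) = (\<lambda>e. relD X Y l r `` {e}) ` darcs Y"
  "verts (coeq X Y l r) = (\<lambda>w. relV X Y l r `` {w}) ` verts Y"
  by (auto simp: coeq_def quotient_def)

lemma coeq_extensional:
  "dag (coeq X Y l r) \<in> extensional (arcs (coeq X Y l r))"
  "incl (coeq X Y l r) \<in> extensional (darcs (coeq X Y l r))"
  "tgt (coeq X Y l r) \<in> extensional (darcs (coeq X Y l r))"
  by (simp_all add: coeq_def)

lemma diagram_coeq:
  assumes X: "diagram X"
  shows "diagram (coeq X Y l r)"
  using coeq_extensional Y diagram_maps
  by (auto simp: diagram_def PiE_iff coeq_carriers coeq_class[OF X])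

lemma nat_trans_coeq_proj:
  assumes X: "diagram X"
  shows "nat_trans Y (coeq X Y l r) (coeq_proj X Y l r)"
  using diagram_maps
  by (auto simp: nat_trans_def coeq_proj_def coeq_carriers coeq_class[OF X])

lemma coeq_proj_equalizes:
  "nt_comp X (coeq_proj X Y l r) l = nt_comp X (coeq_proj X Y l r) r"
proof -
  have "relA X Y l r `` {onA l a} = relA X Y l r `` {onA r a}" if "a \<in> arcs X" for a
    using equiv_class_eq[OF rel_equiv(1) rel_gen(1)[OF that]] .
  moreover have "relD X Y l r `` {onD l a} = relD X Y l r `` {onD r a}" if "a \<in> darcs X" for a
    using equiv_class_eq[OF rel_equiv(2) rel_gen(2)[OF that]] .
  moreover have "relV X Y l r `` {onV l a} = relV X Y l r `` {onV r a}" if "a \<in> verts X" for a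
    using equiv_class_eq[OF rel_equiv(3) rel_gen(3)[OF that]] .
  ultimately show ?thesis
    using rel_gen_subset
    by (auto simp: nt_comp_def coeq_proj_def compose_def restrict_def fun_eq_iff)
qed

lemma coeq_universal:
  fixes h :: "('b, 'e, 'w, 'c, 'f, 'x) ntrans"
  assumes X: "diagram X" and h: "nat_trans Y Z h" and eq: "nt_comp X h l = nt_comp X h r"
  shows "nat_trans (coeq X Y l r) Z u \<and> nt_comp Y u (coeq_proj X Y l r) = h
           \<longleftrightarrow> u = coeq_desc (coeq X Y l r) h"
proof -
  have hA: "onA h (onA l a) = onA h (onA r a)" if "a \<in> arcs X" for a
    using that arg_cong[OF eq, of "\<lambda>g. onA g a"] by (simp add: nt_comp_def compose_def)
  have hD: "onD h (onD l a) = onD h (onD r a)" if "a \<in> darcs X" for a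
    using that arg_cong[OF eq, of "\<lambda>g. onD g a"] by (simp add: nt_comp_def compose_def)
  have hV: "onV h (onV l a) = onV h (onV r a)" if "a \<in> verts X" for a
    using that arg_cong[OF eq, of "\<lambda>g. onV g a"] by (simp add: nt_comp_def compose_def)
  have A: "onA h x = onA h y" if "(x, y) \<in> relA X Y l r" for x y
    by (rule gen_equiv_eq[OF that[unfolded relA_def] rel_gen_subset(1)]) (use hA in auto)
  have D: "onD h x = onD h y" if "(x, y) \<in> relD X Y l r" for x y
    by (rule gen_equiv_eq[OF that[unfolded relD_def] rel_gen_subset(2)]) (use hD in auto)
  have V: "onV h x = onV h y" if "(x, y) \<in> relV X Y l r" for x y
    by (rule gen_equiv_eq[OF that[unfolded relV_def] rel_gen_subset(3)]) (use hV in auto)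
  let ?Q = "coeq X Y l r"
  have dA: "onA (coeq_desc ?Q h) (relA X Y l r `` {b}) = onA h b" if "b \<in> arcs Y" for b
    using the_elem_image_class[OF rel_equiv(1) that A] that
    by (simp add: coeq_desc_def coeq_carriers)
  have dD: "onD (coeq_desc ?Q h) (relD X Y l r `` {b}) = onD h b" if "b \<in> darcs Y" for b
    using the_elem_image_class[OF rel_equiv(2) that D] that
    by (simp add: coeq_desc_def coeq_carriers)
  have dV: "onV (coeq_desc ?Q h) (relV X Y l r `` {b}) = onV h b" if "b \<in> verts Y" for b
    using the_elem_image_class[OF rel_equiv(3) that V] that
    by (simp add: coeq_desc_def coeq_carriers)
  have ext: "onA (coeq_desc ?Q h) \<in> extensional (arcs ?Q)"
    "onD (coeq_desc ?Q h) \<in> extensional (darcs ?Q)"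
    "onV (coeq_desc ?Q h) \<in> extensional (verts ?Q)"
    by (simp_all add: coeq_desc_def)
  show ?thesis
  proof
    assume u: "u = coeq_desc ?Q h"
    have "nat_trans ?Q Z u"
      using ext h diagram_maps unfolding u
      by (auto simp: nat_trans_def PiE_iff coeq_carriers coeq_class[OF X] dA dD dV)
    moreover have "nt_comp Y u (coeq_proj X Y l r) = h"
    proof (rule ntrans.equality)
      show "onA (nt_comp Y u (coeq_proj X Y l r)) = onA h"
        using h unfolding u by (auto simp: fun_eq_iff nt_comp_def compose_def coeq_proj_def
            restrict_def dA nat_trans_def PiE_iff extensional_def)
      show "onD (nt_comp Y u (coeq_proj X Y l r)) = onD h"
        using h unfolding u by (auto simp: fun_eq_iff nt_comp_def compose_def coeq_proj_def
            restrict_def dD nat_trans_def PiE_iff extensional_def)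
      show "onV (nt_comp Y u (coeq_proj X Y l r)) = onV h"
        using h unfolding u by (auto simp: fun_eq_iff nt_comp_def compose_def coeq_proj_def
            restrict_def dV nat_trans_def PiE_iff extensional_def)
    qed simp
    ultimately show "nat_trans ?Q Z u \<and> nt_comp Y u (coeq_proj X Y l r) = h" ..
  next
    assume *: "nat_trans ?Q Z u \<and> nt_comp Y u (coeq_proj X Y l r) = h"
    have uA: "onA u (relA X Y l r `` {b}) = onA h b" if "b \<in> arcs Y" for b
      using that arg_cong[OF conjunct2[OF *], of "\<lambda>g. onA g b"]
      by (simp add: nt_comp_def compose_def coeq_proj_def)
    have uD: "onD u (relD X Y l r `` {b}) = onD h b" if "b \<in> darcs Y" for b
      using that arg_cong[OF conjunct2[OF *], of "\<lambda>g. onD g b"]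
      by (simp add: nt_comp_def compose_def coeq_proj_def)
    have uV: "onV u (relV X Y l r `` {b}) = onV h b" if "b \<in> verts Y" for b
      using that arg_cong[OF conjunct2[OF *], of "\<lambda>g. onV g b"]
      by (simp add: nt_comp_def compose_def coeq_proj_def)
    have uext: "onA u \<in> extensional (arcs ?Q)" "onD u \<in> extensional (darcs ?Q)"
      "onV u \<in> extensional (verts ?Q)"
      using * by (auto simp: nat_trans_def PiE_iff)
    show "u = coeq_desc ?Q h"
    proof (rule ntrans.equality)
      show "onA u = onA (coeq_desc ?Q h)"
        by (rule extensionalityI[OF uext(1) ext(1)]) (auto simp: coeq_carriers uA dA)
      show "onD u = onD (coeq_desc ?Q h)"
        by (rule extensionalityI[OF uext(2) ext(2)]) (auto simp: coeq_carriers uD dD)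
      show "onV u = onV (coeq_desc ?Q h)"
        by (rule extensionalityI[OF uext(3) ext(3)]) (auto simp: coeq_carriers uV dV)
    qed simp
  qed
qed

end


section \<open>Graphs and embeddings\<close>

text \<open>A graph is a diagram in which \<open>darcs\<close> is an actual subset of \<open>arcs\<close>.\<close>

type_synonym ('a, 'v) graph = "('a, 'a, 'v) diagram"

definition graph :: "('a, 'v) graph \<Rightarrow> bool" where
  "graph G \<longleftrightarrow> diagram G \<and> darcs G \<subseteq> arcs G \<and> incl G = (\<lambda>d\<in>darcs G. d) \<and>
     (\<forall>a\<in>arcs G. dag G a \<noteq> a \<and> dag G (dag G a) = a)"

definition nb :: "('a, 'v) graph \<Rightarrow> 'v \<Rightarrow> 'a set" where
  "nb G v = {d \<in> darcs G. tgt G d = v}"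

definition boundary :: "('a, 'v) graph \<Rightarrow> 'a set" where
  "boundary G = arcs G - darcs G"

definition internal_edges :: "('a, 'v) graph \<Rightarrow> 'a set set" where
  "internal_edges G = {{a, dag G a} | a. a \<in> darcs G \<and> dag G a \<in> darcs G}"

text \<open>
  The summands of any coproduct decomposition of \<open>G\<close> are isomorphic to subdiagrams of \<open>G\<close>, so
  it is no restriction that they range over diagrams of the same type as \<open>G\<close>.
\<close>

definition connected :: "('a, 'd, 'v) diagram \<Rightarrow> bool" where
  "connected G \<longleftrightarrow> nonempty G \<and>
     \<not> (\<exists>(X :: bool \<Rightarrow> ('a, 'd, 'v) diagram) f.
          (\<forall>b. diagram (X b) \<and> nonempty (X b)) \<and> nt_iso (coprod UNIV X) G f)"

definition etale ::
  "('a, 'd, 'v) diagram \<Rightarrow> ('b, 'e, 'w) diagram \<Rightarrow> ('a, 'd, 'v, 'b, 'e, 'w) ntrans \<Rightarrow> bool" where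
  "etale G G' f \<longleftrightarrow> nat_trans G G' f \<and>
     (\<forall>v\<in>verts G. \<forall>d'\<in>darcs G'. onV f v = tgt G' d' \<longrightarrow>
        (\<exists>!d. d \<in> darcs G \<and> tgt G d = v \<and> onD f d = d'))"

definition embedding ::
  "('a, 'v) graph \<Rightarrow> ('b, 'w) graph \<Rightarrow> ('a, 'a, 'v, 'b, 'b, 'w) ntrans \<Rightarrow> bool" where
  "embedding H G f \<longleftrightarrow> graph H \<and> connected H \<and> graph G \<and> connected G \<and>
     etale H G f \<and> inj_on (onV f) (verts H)"

text \<open>The exceptional edge; \<open>True\<close> is \<open>\<natural>\<close> and \<open>False\<close> is its involute.\<close>

definition exc_edge :: "(bool, 'd, 'v) diagram" where
  "exc_edge = \<lparr>arcs = UNIV, darcs = {}, verts = {},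
               dag = Not, incl = (\<lambda>_. undefined), tgt = (\<lambda>_. undefined)\<rparr>"

definition is_exc :: "('a, 'v) graph \<Rightarrow> bool" where
  "is_exc G \<longleftrightarrow> (\<exists>z :: ('a, 'a, 'v, bool, bool, 'v) ntrans. nt_iso G exc_edge z)"

text \<open>In \<open>star G v\<close>, \<open>Inl a\<close> is the arc \<open>a\<close> of \<open>nb G v\<close> and \<open>Inr a\<close> is its formal involute.\<close>

definition star :: "('a, 'v) graph \<Rightarrow> 'v \<Rightarrow> ('a + 'a, 'v) graph" where
  "star G v =
     \<lparr>arcs = nb G v <+> nb G v, darcs = Inl ` nb G v, verts = {v},
      dag = (\<lambda>x\<in>nb G v <+> nb G v. case x of Inl a \<Rightarrow> Inr a | Inr a \<Rightarrow> Inl a),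
      incl = (\<lambda>x\<in>Inl ` nb G v. x),
      tgt = (\<lambda>x\<in>Inl ` nb G v. v)\<rparr>"

definition star_emb ::
  "('a, 'v) graph \<Rightarrow> 'v \<Rightarrow> ('a + 'a, 'a + 'a, 'v, 'a, 'a, 'v) ntrans" where
  "star_emb G v =
     \<lparr>onA = (\<lambda>x\<in>nb G v <+> nb G v. case x of Inl a \<Rightarrow> a | Inr a \<Rightarrow> dag G a),
      onD = (\<lambda>x\<in>Inl ` nb G v. case x of Inl a \<Rightarrow> a | Inr a \<Rightarrow> dag G a),
      onV = (\<lambda>w\<in>{v}. w)\<rparr>"

text \<open>
  The types of arcs and of vertices of a graph serve as universes, from which finite sets are
  taken; the types have to be infinite for every finite graph to occur up to isomorphism. \<open>Emb G\<close> consists of classes of embeddings whose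
  domains are graphs in the universe of \<open>G\<close>. The diagram \<open>H\<close> in \<open>emb_class G H f\<close> may have any
  type, and it only has to be isomorphic to a graph, not equal to one: this allows it to be a
  star or a coequalizer.
\<close>

type_synonym ('a, 'v) emb = "('a, 'v) graph \<times> ('a, 'a, 'v, 'a, 'a, 'v) ntrans"

definition emb_class ::
  "('a, 'v) graph \<Rightarrow> ('b, 'd, 'w) diagram \<Rightarrow> ('b, 'd, 'w, 'a, 'a, 'v) ntrans
     \<Rightarrow> ('a, 'v) emb set" where
  "emb_class G H f = {(K, g). embedding K G g \<and> (\<exists>z. nt_iso K H z \<and> g = nt_comp K f z)}"

definition Emb :: "('a, 'v) graph \<Rightarrow> ('a, 'v) emb set set" where
  "Emb G = {emb_class G H f | (H :: ('a, 'v) graph) f. embedding H G f}"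

definition rep :: "('a, 'v) emb set \<Rightarrow> ('a, 'v) emb" where
  "rep c = (SOME p. p \<in> c)"

definition rep_graph :: "('a, 'v) emb set \<Rightarrow> ('a, 'v) graph" where
  "rep_graph c = fst (rep c)"

definition rep_map :: "('a, 'v) emb set \<Rightarrow> ('a, 'a, 'v, 'a, 'a, 'v) ntrans" where
  "rep_map c = snd (rep c)"

definition is_edge_class :: "('a, 'v) emb set \<Rightarrow> bool" where
  "is_edge_class c \<longleftrightarrow> is_exc (rep_graph c)"

definition class_boundary :: "('a, 'v) emb set \<Rightarrow> 'a set" where
  "class_boundary c = onA (rep_map c) ` boundary (rep_graph c)"


section \<open>Graphical maps\<close>

record ('a, 'v) gmap =
  gm0 :: "'a \<Rightarrow> 'a"
  gm1 :: "'v \<Rightarrow> ('a, 'v) emb set"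

definition graphical_map :: "('a, 'v) graph \<Rightarrow> ('a, 'v) graph \<Rightarrow> ('a, 'v) gmap \<Rightarrow> bool" where
  "graphical_map G G' \<phi> \<longleftrightarrow>
     graph G \<and> connected G \<and> graph G' \<and> connected G' \<and>
     gm0 \<phi> \<in> arcs G \<rightarrow>\<^sub>E arcs G' \<and>
     (\<forall>a\<in>arcs G. gm0 \<phi> (dag G a) = dag G' (gm0 \<phi> a)) \<and>
     gm1 \<phi> \<in> verts G \<rightarrow>\<^sub>E Emb G' \<and>
     inj_on (\<lambda>(v, u). onV (rep_map (gm1 \<phi> v)) u)
       (SIGMA v:verts G. verts (rep_graph (gm1 \<phi> v))) \<and>
     (\<forall>v\<in>verts G. bij_betw (\<lambda>a. gm0 \<phi> (dag G a)) (nb G v) (class_boundary (gm1 \<phi> v))) \<and>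
     (boundary G = {} \<longrightarrow> (\<exists>v\<in>verts G. \<not> is_edge_class (gm1 \<phi> v)))"

definition emb_gmap ::
  "('a, 'v) graph \<Rightarrow> ('a, 'v) graph \<Rightarrow> ('a, 'a, 'v, 'a, 'a, 'v) ntrans \<Rightarrow> ('a, 'v) gmap" where
  "emb_gmap H G f =
     \<lparr>gm0 = onA f, gm1 = (\<lambda>v\<in>verts H. emb_class G (star G (onV f v)) (star_emb G (onV f v)))\<rparr>"

definition gmap_restrict ::
  "('a, 'v) gmap \<Rightarrow> ('a, 'v) graph \<Rightarrow> ('a, 'a, 'v, 'a, 'a, 'v) ntrans \<Rightarrow> ('a, 'v) gmap" where
  "gmap_restrict \<phi> H f =
     \<lparr>gm0 = compose (arcs H) (gm0 \<phi>) (onA f), gm1 = compose (verts H) (gm1 \<phi>) (onV f)\<rparr>"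


subsection \<open>Images\<close>

text \<open>
  \<open>port \<phi> v b\<close> is the arc of the representative of \<open>gm1 \<phi> v\<close> which is written \<open>m\<^sub>v(b)\<close> on paper;
  it is meant for \<open>b\<close> in the image of \<open>nb G v\<close> under the involution.
\<close>

definition port :: "('a, 'v) gmap \<Rightarrow> 'v \<Rightarrow> 'a \<Rightarrow> 'a" where
  "port \<phi> v b = inv_into (boundary (rep_graph (gm1 \<phi> v))) (onA (rep_map (gm1 \<phi> v))) (gm0 \<phi> b)"

text \<open>The map from the exceptional edge to \<open>X\<close> with \<open>\<natural> \<mapsto> a\<close>.\<close>

definition pick_arc ::
  "('a, 'd, 'v) diagram \<Rightarrow> 'a \<Rightarrow> (bool, 'e, 'w, 'a, 'd, 'v) ntrans" where
  "pick_arc X a = \<lparr>onA = (\<lambda>b. if b then a else dag X a),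
                   onD = (\<lambda>_. undefined), onV = (\<lambda>_. undefined)\<rparr>"

text \<open>A choice of ordering \<open>e = [fst_arc e, snd_arc G e]\<close> of each internal edge.\<close>

definition fst_arc :: "'a set \<Rightarrow> 'a" where
  "fst_arc e = (SOME x. x \<in> e)"

definition snd_arc :: "('a, 'v) graph \<Rightarrow> 'a set \<Rightarrow> 'a" where
  "snd_arc G e = dag G (fst_arc e)"

abbreviation edge_coprod :: "('a, 'v) graph \<Rightarrow> ('a set \<times> bool, 'a set \<times> bool, 'a set \<times> 'v) diagram" where
  "edge_coprod G \<equiv> coprod (internal_edges G) (\<lambda>_. exc_edge)"

abbreviation rep_coprod ::
  "('a, 'v) graph \<Rightarrow> ('a, 'v) gmap \<Rightarrow> ('v \<times> 'a, 'v \<times> 'a, 'v \<times> 'v) diagram" where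
  "rep_coprod G \<phi> \<equiv> coprod (verts G) (\<lambda>v. rep_graph (gm1 \<phi> v))"

definition glue1 ::
  "('a, 'v) graph \<Rightarrow> ('a, 'v) gmap
     \<Rightarrow> ('a set \<times> bool, 'a set \<times> bool, 'a set \<times> 'v, 'v \<times> 'a, 'v \<times> 'a, 'v \<times> 'v) ntrans" where
  "glue1 G \<phi> = copair (internal_edges G) (\<lambda>_. exc_edge)
     (\<lambda>e. let x = fst_arc e; v = tgt G x
          in pick_arc (rep_coprod G \<phi>) (v, port \<phi> v (dag G x)))"

text \<open>The second map sends the involute of \<open>\<natural>\<close>, and not \<open>\<natural>\<close> itself, to the chosen boundary arc.\<close>

definition glue2 ::
  "('a, 'v) graph \<Rightarrow> ('a, 'v) gmap
     \<Rightarrow> ('a set \<times> bool, 'a set \<times> bool, 'a set \<times> 'v, 'v \<times> 'a, 'v \<times> 'a, 'v \<times> 'v) ntrans" where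
  "glue2 G \<phi> = copair (internal_edges G) (\<lambda>_. exc_edge)
     (\<lambda>e. let x = snd_arc G e; v = tgt G x
          in pick_arc (rep_coprod G \<phi>) (dag (rep_coprod G \<phi>) (v, port \<phi> v (dag G x))))"

definition subst ::
  "('a, 'v) graph \<Rightarrow> ('a, 'v) gmap \<Rightarrow> (('v \<times> 'a) set, ('v \<times> 'a) set, ('v \<times> 'v) set) diagram" where
  "subst G \<phi> = coeq (edge_coprod G) (rep_coprod G \<phi>) (glue1 G \<phi>) (glue2 G \<phi>)"

definition subst_map ::
  "('a, 'v) graph \<Rightarrow> ('a, 'v) gmap
     \<Rightarrow> (('v \<times> 'a) set, ('v \<times> 'a) set, ('v \<times> 'v) set, 'a, 'a, 'v) ntrans" where
  "subst_map G \<phi> = coeq_desc (subst G \<phi>)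
     (copair (verts G) (\<lambda>v. rep_graph (gm1 \<phi> v)) (\<lambda>v. rep_map (gm1 \<phi> v)))"

text \<open>
  If \<open>G\<close> is an exceptional edge, it has no vertices and the embedding underlying \<open>\<phi>\<close> is given by
  \<open>gm0 \<phi>\<close> and empty functions.
\<close>

definition im :: "('a, 'v) graph \<Rightarrow> ('a, 'v) graph \<Rightarrow> ('a, 'v) gmap \<Rightarrow> ('a, 'v) emb set" where
  "im G G' \<phi> =
     (if is_exc G
      then emb_class G' G \<lparr>onA = gm0 \<phi>, onD = (\<lambda>_. undefined), onV = (\<lambda>_. undefined)\<rparr>
      else emb_class G' (subst G \<phi>) (subst_map G \<phi>))"


section \<open>The graphical category\<close>

definition gmap_comp ::
  "('a, 'v) graph \<Rightarrow> ('a, 'v) graph \<Rightarrow> ('a, 'v) graph \<Rightarrow> ('a, 'v) gmap \<Rightarrow> ('a, 'v) gmap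
     \<Rightarrow> ('a, 'v) gmap" where
  "gmap_comp G H K \<psi> \<phi> =
     \<lparr>gm0 = compose (arcs G) (gm0 \<psi>) (gm0 \<phi>),
      gm1 = (\<lambda>v\<in>verts G. im (rep_graph (gm1 \<phi> v)) K
               (gmap_restrict \<psi> (rep_graph (gm1 \<phi> v)) (rep_map (gm1 \<phi> v))))\<rparr>"

definition graphical_category :: "(('a, 'v) graph, ('a, 'v) gmap) category" where
  "graphical_category =
     \<lparr>Ob = {G. graph G \<and> connected G},
      Hom = (\<lambda>G G'. {\<phi>. graphical_map G G' \<phi>}),
      Id = (\<lambda>G. emb_gmap G G (nt_id G)),
      Comp = gmap_comp\<rparr>"

definition active :: "('a, 'v) graph \<Rightarrow> ('a, 'v) graph \<Rightarrow> ('a, 'v) gmap \<Rightarrow> bool" where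
  "active G G' \<phi> \<longleftrightarrow> graphical_map G G' \<phi> \<and> bij_betw (gm0 \<phi>) (boundary G) (boundary G')"

definition U_minus :: "('a, 'v) graph \<Rightarrow> ('a, 'v) graph \<Rightarrow> ('a, 'v) gmap set" where
  "U_minus G G' = {\<phi>. active G G' \<phi> \<and> gm0 \<phi> ` arcs G = arcs G'}"

definition U_plus :: "('a, 'v) graph \<Rightarrow> ('a, 'v) graph \<Rightarrow> ('a, 'v) gmap set" where
  "U_plus G G' = {\<phi>. graphical_map G G' \<phi> \<and>
     (\<exists>K \<phi>' f. active G K \<phi>' \<and> embedding K G' f \<and>
        \<phi> = gmap_comp G K G' (emb_gmap K G' f) \<phi>' \<and> inj_on (gm0 \<phi>') (arcs G))}"

definition deg :: "('a, 'v) graph \<Rightarrow> nat" where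
  "deg G = card (verts G) + card (internal_edges G)"

end

theory Submission
  imports Defs
begin

text \<open>
  An embedding \<open>f : H \<rightarrow> G\<close> is determined up to isomorphism by the vertex set \<open>f(V(H))\<close> and the set
  \<open>f(\<eth>(H))\<close>. Hence a graphical map \<open>\<phi>\<close> amounts to the function \<open>gm0 \<phi>\<close> on arcs together with the
  vertex sets \<open>gm_verts \<phi> v\<close> of the subgraphs \<open>gm1 \<phi> v\<close>, and composition becomes composition of
  functions together with \<open>gm_verts (\<psi> \<phi>) v = (\<Union>w \<in> gm_verts \<phi> v. gm_verts \<psi> w)\<close>. The one thing to
  check about coequalizers is that the induced map to \<open>G'\<close> is an embedding with the expected vertices
  and boundary.

  A map lies in \<open>U_plus\<close> iff it collapses no vertex, that is, sends no vertex to an edge. A collapsed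
  vertex is bivalent, and smoothing it is a map in \<open>U_minus\<close> through which every map collapsing that
  vertex factors uniquely. Induction on the number of collapsed vertices therefore reduces the
  factorization, its uniqueness and the statements about \<open>U_minus\<close> to maps without collapsed
  vertices, and such maps in \<open>U_minus\<close> are invertible.
\<close>

section \<open>Connected diagrams\<close>

text \<open>A star has its arcs in another type than \<open>G\<close>, and in a coequalizer the
  attached arcs are classes of their own, in general not a subset of the arcs. Embeddings are
  therefore studied for pregraphs, where \<open>incl\<close> is only injective. The infinite arc
  type provides an isomorphic copy of each of them in the universe of the target, so that
  \<open>rep\<close> picks a genuine member of a class.

  An embedding need not be injective on arcs: for the star at a vertex with a loop, a boundary arc
  and an attached arc have the same image. So the vertices alone do not determine an embedding; the
  boundary records which edges have been cut.

  The obstacle with coequalizers is that gluing does not happen one edge at a time. At a vertex sent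
  to an edge, the two glued ends are joined by that edge, so the classes of arcs are chains of any
  length, and a chain might close up to a circle without end. The last condition on graphical maps
  rules this out. The same condition shows that a collapsed vertex carries no loop, which is what
  allows it to be smoothed.\<close>

lemma diagram_simps:
  assumes "diagram X"
  shows "a \<in> arcs X \<Longrightarrow> dag X a \<in> arcs X" "d \<in> darcs X \<Longrightarrow> incl X d \<in> arcs X"
    "d \<in> darcs X \<Longrightarrow> tgt X d \<in> verts X"
  using assms by (auto simp: diagram_def PiE_iff)

lemma nat_trans_simps:
  assumes "nat_trans X Y f"
  shows "a \<in> arcs X \<Longrightarrow> onA f a \<in> arcs Y" "d \<in> darcs X \<Longrightarrow> onD f d \<in> darcs Y"
    "v \<in> verts X \<Longrightarrow> onV f v \<in> verts Y"
    "a \<in> arcs X \<Longrightarrow> onA f (dag X a) = dag Y (onA f a)"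
    "d \<in> darcs X \<Longrightarrow> onA f (incl X d) = incl Y (onD f d)"
    "d \<in> darcs X \<Longrightarrow> onV f (tgt X d) = tgt Y (onD f d)"
  using assms by (auto simp: nat_trans_def PiE_iff)

text \<open>The naturality equations of \<open>f\<close> can be read backwards through its pointwise
  inverses, so these form a natural transformation. Isomorphisms are handled below through
  bijectivity.\<close>

lemma nt_iso_iff:
  assumes X: "diagram X" and Y: "diagram Y"
  shows "nt_iso X Y f \<longleftrightarrow> nat_trans X Y f \<and> bij_betw (onA f) (arcs X) (arcs Y) \<and>
    bij_betw (onD f) (darcs X) (darcs Y) \<and> bij_betw (onV f) (verts X) (verts Y)"
proof
  assume "nt_iso X Y f"
  then obtain g where f: "nat_trans X Y f" and g: "nat_trans Y X g"
    and gf: "nt_comp X g f = nt_id X" and fg: "nt_comp Y f g = nt_id Y"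
    by (auto simp: nt_iso_def)
  have A: "onA g (onA f a) = a" if "a \<in> arcs X" for a
    using that arg_cong[OF gf, of "\<lambda>h. onA h a"] by (simp add: nt_comp_def nt_id_def compose_def)
  have D: "onD g (onD f a) = a" if "a \<in> darcs X" for a
    using that arg_cong[OF gf, of "\<lambda>h. onD h a"] by (simp add: nt_comp_def nt_id_def compose_def)
  have V: "onV g (onV f a) = a" if "a \<in> verts X" for a
    using that arg_cong[OF gf, of "\<lambda>h. onV h a"] by (simp add: nt_comp_def nt_id_def compose_def)
  have A': "onA f (onA g a) = a" if "a \<in> arcs Y" for a
    using that arg_cong[OF fg, of "\<lambda>h. onA h a"] by (simp add: nt_comp_def nt_id_def compose_def)
  have D': "onD f (onD g a) = a" if "a \<in> darcs Y" for a
    using that arg_cong[OF fg, of "\<lambda>h. onD h a"] by (simp add: nt_comp_def nt_id_def compose_def)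
  have V': "onV f (onV g a) = a" if "a \<in> verts Y" for a
    using that arg_cong[OF fg, of "\<lambda>h. onV h a"] by (simp add: nt_comp_def nt_id_def compose_def)
  have "bij_betw (onA f) (arcs X) (arcs Y)"
    by (rule bij_betw_byWitness[of _ "onA g"])
      (use A A' nat_trans_simps[OF f] nat_trans_simps[OF g] in auto)
  moreover have "bij_betw (onD f) (darcs X) (darcs Y)"
    by (rule bij_betw_byWitness[of _ "onD g"])
      (use D D' nat_trans_simps[OF f] nat_trans_simps[OF g] in auto)
  moreover have "bij_betw (onV f) (verts X) (verts Y)"
    by (rule bij_betw_byWitness[of _ "onV g"])
      (use V V' nat_trans_simps[OF f] nat_trans_simps[OF g] in auto)
  ultimately show "nat_trans X Y f \<and> bij_betw (onA f) (arcs X) (arcs Y) \<and>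
    bij_betw (onD f) (darcs X) (darcs Y) \<and> bij_betw (onV f) (verts X) (verts Y)"
    using f by blast
next
  assume *: "nat_trans X Y f \<and> bij_betw (onA f) (arcs X) (arcs Y) \<and>
    bij_betw (onD f) (darcs X) (darcs Y) \<and> bij_betw (onV f) (verts X) (verts Y)"
  then have f: "nat_trans X Y f" and bA: "bij_betw (onA f) (arcs X) (arcs Y)"
    and bD: "bij_betw (onD f) (darcs X) (darcs Y)" and bV: "bij_betw (onV f) (verts X) (verts Y)"
    by auto
  note fs = nat_trans_simps[OF f]
  define gA where "gA = inv_into (arcs X) (onA f)"
  define gD where "gD = inv_into (darcs X) (onD f)"
  define gV where "gV = inv_into (verts X) (onV f)"
  have A: "\<And>a. a \<in> arcs X \<Longrightarrow> gA (onA f a) = a" "\<And>b. b \<in> arcs Y \<Longrightarrow> onA f (gA b) = b"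
    "\<And>b. b \<in> arcs Y \<Longrightarrow> gA b \<in> arcs X"
    using bA bij_betwE[OF bij_betw_inv_into[OF bA]]
    by (auto simp: gA_def bij_betw_inv_into_left bij_betw_inv_into_right)
  have D: "\<And>a. a \<in> darcs X \<Longrightarrow> gD (onD f a) = a" "\<And>b. b \<in> darcs Y \<Longrightarrow> onD f (gD b) = b"
    "\<And>b. b \<in> darcs Y \<Longrightarrow> gD b \<in> darcs X"
    using bD bij_betwE[OF bij_betw_inv_into[OF bD]]
    by (auto simp: gD_def bij_betw_inv_into_left bij_betw_inv_into_right)
  have V: "\<And>a. a \<in> verts X \<Longrightarrow> gV (onV f a) = a" "\<And>b. b \<in> verts Y \<Longrightarrow> onV f (gV b) = b"
    "\<And>b. b \<in> verts Y \<Longrightarrow> gV b \<in> verts X"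
    using bV bij_betwE[OF bij_betw_inv_into[OF bV]]
    by (auto simp: gV_def bij_betw_inv_into_left bij_betw_inv_into_right)
  define g where "g = \<lparr>onA = restrict gA (arcs Y), onD = restrict gD (darcs Y), onV = restrict gV (verts Y)\<rparr>"
  have 1: "gA (dag Y b) = dag X (gA b)" if "b \<in> arcs Y" for b
    using that A fs(4)[of "gA b"] diagram_simps(1)[OF X, of "gA b"] by metis
  have 2: "gA (incl Y b) = incl X (gD b)" if "b \<in> darcs Y" for b
    using that A(1)[of "incl X (gD b)"] D(2,3) fs(5)[of "gD b"] diagram_simps(2)[OF X, of "gD b"] by metis
  have 3: "gV (tgt Y b) = tgt X (gD b)" if "b \<in> darcs Y" for b
    using that V(1)[of "tgt X (gD b)"] D(2,3) fs(6)[of "gD b"] diagram_simps(3)[OF X, of "gD b"] by metis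
  have "nat_trans Y X g"
    using A D V 1 2 3 diagram_simps[OF Y] by (auto simp: nat_trans_def g_def)
  moreover have "nt_comp X g f = nt_id X" "nt_comp Y f g = nt_id Y"
    using A D V fs by (auto simp: nt_comp_def nt_id_def g_def compose_def fun_eq_iff)
  ultimately show "nt_iso X Y f" using f by (auto simp: nt_iso_def)
qed

text \<open>The arcs and vertices of a direct summand of \<open>X\<close>. The attached arcs of the
  summand are determined by \<open>P\<close>; since both conditions are equivalences, the complement
  is closed as well.\<close>

definition closed_part :: "('a, 'd, 'v) diagram \<Rightarrow> 'a set \<Rightarrow> 'v set \<Rightarrow> bool" where
  "closed_part X P Q \<longleftrightarrow> P \<subseteq> arcs X \<and> Q \<subseteq> verts X \<and>
     (\<forall>a\<in>arcs X. dag X a \<in> P \<longleftrightarrow> a \<in> P) \<and> (\<forall>d\<in>darcs X. incl X d \<in> P \<longleftrightarrow> tgt X d \<in> Q)"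

definition restrict_part :: "('a, 'd, 'v) diagram \<Rightarrow> 'a set \<Rightarrow> 'v set \<Rightarrow> ('a, 'd, 'v) diagram" where
  "restrict_part X P Q = \<lparr>arcs = P, darcs = {d \<in> darcs X. incl X d \<in> P}, verts = Q,
     dag = restrict (dag X) P, incl = restrict (incl X) {d \<in> darcs X. incl X d \<in> P},
     tgt = restrict (tgt X) {d \<in> darcs X. incl X d \<in> P}\<rparr>"

text \<open>A closed part and its complement split \<open>X\<close> as a coproduct, and conversely
  the image of a summand is a closed part. Later connectedness arguments exhibit a closed part and
  conclude that it is everything.\<close>

lemma connected_iff:
  fixes X :: "('a, 'd, 'v) diagram"
  assumes X: "diagram X"
  shows "connected X \<longleftrightarrow> nonempty X \<and>
    (\<forall>P Q. closed_part X P Q \<longrightarrow> P \<noteq> {} \<or> Q \<noteq> {} \<longrightarrow> P = arcs X \<and> Q = verts X)"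
proof (intro iffI conjI allI impI)
  assume "connected X"
  then show "nonempty X" by (simp add: connected_def)
next
  fix P Q assume conn: "connected X" and cl: "closed_part X P Q" and ne: "P \<noteq> {} \<or> Q \<noteq> {}"
  \<comment> \<open>The index \<open>True\<close> carries the given part and \<open>False\<close>
    its complement; the splitting is witnessed by forgetting the index.\<close>
  define Y where "Y b = (if b then restrict_part X P Q else restrict_part X (arcs X - P) (verts X - Q))" for b
  have cl': "closed_part X (arcs X - P) (verts X - Q)"
    using cl diagram_simps[OF X] by (auto simp: closed_part_def)
  have dg: "diagram (restrict_part X P' Q')" if "closed_part X P' Q'" for P' Q'
    using that X diagram_simps[OF X] finite_subset[of P' "arcs X"] finite_subset[of Q' "verts X"]
    by (auto simp: closed_part_def diagram_def restrict_part_def)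
  have Y: "diagram (Y b)" for b using dg[OF cl] dg[OF cl'] by (simp add: Y_def)
  define f :: "(bool \<times> 'a, bool \<times> 'd, bool \<times> 'v, 'a, 'd, 'v) ntrans" where
    "f = \<lparr>onA = restrict snd (arcs (coprod UNIV Y)), onD = restrict snd (darcs (coprod UNIV Y)),
          onV = restrict snd (verts (coprod UNIV Y))\<rparr>"
  have Ys: "arcs (Y b) = {a \<in> arcs X. (a \<in> P) = b}" "verts (Y b) = {v \<in> verts X. (v \<in> Q) = b}"
    "darcs (Y b) = {d \<in> darcs X. (incl X d \<in> P) = b}" for b
    using cl diagram_simps[OF X] by (auto simp: Y_def restrict_part_def closed_part_def)
  have "nat_trans (coprod UNIV Y) X f"
    using cl diagram_simps[OF X]
    by (auto simp: nat_trans_def f_def coprod_def Y_def restrict_part_def closed_part_def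
        split: if_splits)
  moreover have "bij_betw (onA f) (arcs (coprod UNIV Y)) (arcs X)"
    by (rule bij_betw_byWitness[of _ "\<lambda>a. (a \<in> P, a)"]) (auto simp: f_def coprod_def Ys)
  moreover have "bij_betw (onD f) (darcs (coprod UNIV Y)) (darcs X)"
    by (rule bij_betw_byWitness[of _ "\<lambda>d. (incl X d \<in> P, d)"]) (auto simp: f_def coprod_def Ys)
  moreover have "bij_betw (onV f) (verts (coprod UNIV Y)) (verts X)"
    by (rule bij_betw_byWitness[of _ "\<lambda>v. (v \<in> Q, v)"]) (auto simp: f_def coprod_def Ys)
  ultimately have "nt_iso (coprod UNIV Y) X f"
    using nt_iso_iff[OF diagram_coprod[of UNIV Y] X] Y by simp
  then obtain b where "\<not> nonempty (Y b)" using conn Y unfolding connected_def by blast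
  then have "\<not> nonempty (Y False)"
    using ne by (cases b) (auto simp: Y_def restrict_part_def nonempty_def)
  then show "P = arcs X" "Q = verts X"
    using cl by (auto simp: Y_def restrict_part_def nonempty_def closed_part_def)
next
  assume *: "nonempty X \<and> (\<forall>P Q. closed_part X P Q \<longrightarrow> P \<noteq> {} \<or> Q \<noteq> {} \<longrightarrow> P = arcs X \<and> Q = verts X)"
  show "connected X"
    unfolding connected_def
  proof (intro conjI notI)
    show "nonempty X" using * by simp
    assume "\<exists>(Y :: bool \<Rightarrow> ('a, 'd, 'v) diagram) f.
      (\<forall>b. diagram (Y b) \<and> nonempty (Y b)) \<and> nt_iso (coprod UNIV Y) X f"
    then obtain Y :: "bool \<Rightarrow> ('a, 'd, 'v) diagram" and f
      where Y: "\<And>b. diagram (Y b)" "\<And>b. nonempty (Y b)" and iso: "nt_iso (coprod UNIV Y) X f"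
      by auto
    let ?C = "coprod UNIV Y"
    have C: "diagram ?C" by (rule diagram_coprod) (use Y in auto)
    from iso have f: "nat_trans ?C X f" and bA: "bij_betw (onA f) (arcs ?C) (arcs X)"
      and bD: "bij_betw (onD f) (darcs ?C) (darcs X)" and bV: "bij_betw (onV f) (verts ?C) (verts X)"
      by (auto simp: nt_iso_iff[OF C X])
    note fs = nat_trans_simps[OF f]
    have ne: "arcs (Y b) \<noteq> {} \<or> verts (Y b) \<noteq> {}" for b
      using Y(2)[of b] diagram_simps[OF Y(1)[of b]] by (auto simp: nonempty_def)
    define P where "P b = onA f ` ({b} \<times> arcs (Y b))" for b
    define Q where "Q b = onV f ` ({b} \<times> verts (Y b))" for b
    have sA: "\<And>b. {b} \<times> arcs (Y b) \<subseteq> arcs ?C" and sV: "\<And>b. {b} \<times> verts (Y b) \<subseteq> verts ?C"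
      by (auto simp: coprod_def)
    have inA: "onA f (b, a) \<in> P b' \<longleftrightarrow> b = b'" if "a \<in> arcs (Y b)" for a b b'
    proof
      assume "onA f (b, a) \<in> P b'"
      then obtain a' where "a' \<in> arcs (Y b')" "onA f (b, a) = onA f (b', a')" by (auto simp: P_def)
      then have "(b, a) = (b', a')"
        using that bA by (intro inj_onD[OF bij_betw_imp_inj_on[OF bA]]) (auto simp: coprod_def)
      then show "b = b'" by simp
    qed (use that in \<open>auto simp: P_def\<close>)
    have inV: "onV f (b, a) \<in> Q b' \<longleftrightarrow> b = b'" if "a \<in> verts (Y b)" for a b b'
    proof
      assume "onV f (b, a) \<in> Q b'"
      then obtain a' where "a' \<in> verts (Y b')" "onV f (b, a) = onV f (b', a')" by (auto simp: Q_def)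
      then have "(b, a) = (b', a')"
        using that bV by (intro inj_onD[OF bij_betw_imp_inj_on[OF bV]]) (auto simp: coprod_def)
      then show "b = b'" by simp
    qed (use that in \<open>auto simp: Q_def\<close>)
    have "closed_part X (P True) (Q True)"
      unfolding closed_part_def
    proof (intro conjI ballI)
      show "P True \<subseteq> arcs X" "Q True \<subseteq> verts X"
        by (auto simp: P_def Q_def coprod_def intro!: fs(1,3))
    next
      fix x assume "x \<in> arcs X"
      then obtain b a where a: "a \<in> arcs (Y b)" "x = onA f (b, a)"
        using bij_betw_imp_surj_on[OF bA] by (force simp: coprod_def)
      then have "dag X x = onA f (b, dag (Y b) a)"
        using fs(4)[of "(b, a)"] by (simp add: coprod_def)
      then show "dag X x \<in> P True \<longleftrightarrow> x \<in> P True"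
        using inA a diagram_simps(1)[OF Y(1)] by simp
    next
      fix x assume "x \<in> darcs X"
      then obtain b d where d: "d \<in> darcs (Y b)" "x = onD f (b, d)"
        using bij_betw_imp_surj_on[OF bD] by (force simp: coprod_def)
      then have "incl X x = onA f (b, incl (Y b) d)" "tgt X x = onV f (b, tgt (Y b) d)"
        using fs(5,6)[of "(b, d)"] by (simp_all add: coprod_def)
      then show "incl X x \<in> P True \<longleftrightarrow> tgt X x \<in> Q True"
        using inA inV d diagram_simps(2,3)[OF Y(1)] by simp
    qed
    then have "P True = arcs X" "Q True = verts X"
      using * ne[of True] by (auto simp: P_def Q_def)
    \<comment> \<open>A nonempty summand \<open>False\<close> would have an arc or a vertex whose
      image lies in that of the summand \<open>True\<close>, which \<open>inA\<close> and
      \<open>inV\<close> exclude.\<close>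
    then show False
      using ne[of False] inA[of _ False True] inV[of _ False True] fs(1)[of "(False, _)"]
        fs(3)[of "(False, _)"]
      by (auto simp: coprod_def)
  qed
qed

section \<open>Pregraphs and their boundary\<close>

definition pregraph :: "('a, 'd, 'v) diagram \<Rightarrow> bool" where
  "pregraph X \<longleftrightarrow> diagram X \<and> inj_on (incl X) (darcs X) \<and>
     (\<forall>a\<in>arcs X. dag X a \<noteq> a \<and> dag X (dag X a) = a)"

definition pre_boundary :: "('a, 'd, 'v) diagram \<Rightarrow> 'a set" where
  "pre_boundary X = arcs X - incl X ` darcs X"

lemma graph_pregraph: "graph G \<Longrightarrow> pregraph G"
  by (auto simp: graph_def pregraph_def inj_on_def)

lemma graph_incl_image: "graph G \<Longrightarrow> incl G ` darcs G = darcs G"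
  by (auto simp: graph_def)

lemma graph_pre_boundary: "graph G \<Longrightarrow> pre_boundary G = boundary G"
  by (simp add: pre_boundary_def boundary_def graph_incl_image)

lemma connectedD:
  assumes "connected X" "diagram X" "closed_part X P Q" "P \<noteq> {} \<or> Q \<noteq> {}"
  shows "P = arcs X" "Q = verts X"
  using assms connected_iff[of X] by blast+

lemma connected_arcs_verts:
  assumes "connected X" "diagram X"
  shows "arcs X \<noteq> {} \<or> verts X \<noteq> {}"
  using assms diagram_simps[OF assms(2)] connected_iff[of X] by (auto simp: nonempty_def)

text \<open>Two boundary arcs forming an edge are a closed part without vertices, hence the whole
  diagram. This is why graphs with and without vertices are treated separately below.\<close>

lemma connected_boundary_pair:
  assumes "connected X" "pregraph X" "a \<in> pre_boundary X" "dag X a \<in> pre_boundary X"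
  shows "arcs X = {a, dag X a}" "darcs X = {}" "verts X = {}"
proof -
  have "diagram X" "a \<in> arcs X" using assms by (auto simp: pregraph_def pre_boundary_def)
  moreover have "closed_part X {a, dag X a} {}"
    unfolding closed_part_def
  proof (intro conjI ballI)
    show "dag X b \<in> {a, dag X a} \<longleftrightarrow> b \<in> {a, dag X a}" if "b \<in> arcs X" for b
      using that assms(2) \<open>a \<in> arcs X\<close> unfolding pregraph_def by (metis insert_iff singletonD)
    show "incl X d \<in> {a, dag X a} \<longleftrightarrow> tgt X d \<in> {}" if "d \<in> darcs X" for d
      using that assms(3,4) unfolding pre_boundary_def by (metis DiffD2 empty_iff imageI insert_iff)
  qed (use assms(3,4) in \<open>auto simp: pre_boundary_def\<close>)
  ultimately show "arcs X = {a, dag X a}" "verts X = {}"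
    using connectedD[OF assms(1), of "{a, dag X a}" "{}"] by auto
  then show "darcs X = {}" using diagram_simps(3)[OF \<open>diagram X\<close>] by auto
qed

lemma connected_no_verts:
  assumes "connected X" "pregraph X" "verts X = {}"
  obtains a where "a \<in> arcs X" "arcs X = {a, dag X a}" "darcs X = {}" "dag X a \<noteq> a"
proof -
  have X: "diagram X" using assms by (simp add: pregraph_def)
  obtain a where a: "a \<in> arcs X" using connected_arcs_verts[OF assms(1) X] assms(3) by auto
  have d: "darcs X = {}" using diagram_simps(3)[OF X] assms(3) by auto
  have "arcs X = {a, dag X a}"
    by (rule connected_boundary_pair[OF assms(1,2)])
      (use a d diagram_simps[OF X] in \<open>auto simp: pre_boundary_def\<close>)
  then show ?thesis using that a d assms(2) by (auto simp: pregraph_def)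
qed

text \<open>An edge with two boundary arcs would leave no room for a vertex. So in the presence of a
  vertex every arc is attached or the involute of an attached arc, and maps are controlled by their
  values on attached arcs.\<close>

lemma connected_dag_boundary:
  assumes "connected X" "pregraph X" "verts X \<noteq> {}" "a \<in> pre_boundary X"
  obtains d where "d \<in> darcs X" "dag X a = incl X d"
proof -
  have "dag X a \<in> arcs X" "dag X a \<notin> pre_boundary X"
    using connected_boundary_pair(3)[OF assms(1,2,4)] assms(2-4)
    by (auto simp: pregraph_def pre_boundary_def diagram_simps(1))
  then show ?thesis using that by (auto simp: pre_boundary_def)
qed

section \<open>Embeddings and their images\<close>

text \<open>An embedding whose domain is a pregraph of any type, so that \<open>star_emb\<close> and
  \<open>subst_map\<close> qualify.\<close>

definition pre_embedding ::
  "('a, 'd, 'v) diagram \<Rightarrow> ('b, 'w) graph \<Rightarrow> ('a, 'd, 'v, 'b, 'b, 'w) ntrans \<Rightarrow> bool" where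
  "pre_embedding H G f \<longleftrightarrow> pregraph H \<and> connected H \<and> graph G \<and> connected G \<and>
     etale H G f \<and> inj_on (onV f) (verts H)"

lemma embedding_pre: "embedding H G f \<longleftrightarrow> graph H \<and> pre_embedding H G f"
  by (auto simp: embedding_def pre_embedding_def graph_pregraph)

lemma pregraph_diagram: "pregraph X \<Longrightarrow> diagram X"
  by (simp add: pregraph_def)

lemma graph_diagram: "graph X \<Longrightarrow> diagram X"
  by (simp add: graph_def)

lemma pregraph_simps:
  assumes "pregraph X"
  shows "a \<in> arcs X \<Longrightarrow> dag X a \<in> arcs X" "d \<in> darcs X \<Longrightarrow> incl X d \<in> arcs X"
    "d \<in> darcs X \<Longrightarrow> tgt X d \<in> verts X" "a \<in> arcs X \<Longrightarrow> dag X a \<noteq> a"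
    "a \<in> arcs X \<Longrightarrow> dag X (dag X a) = a"
    "d \<in> darcs X \<Longrightarrow> d' \<in> darcs X \<Longrightarrow> incl X d = incl X d' \<longleftrightarrow> d = d'"
  using assms diagram_simps[of X] by (auto simp: pregraph_def inj_on_def)

lemma graph_simps:
  assumes "graph G"
  shows "a \<in> arcs G \<Longrightarrow> dag G a \<in> arcs G" "d \<in> darcs G \<Longrightarrow> d \<in> arcs G"
    "d \<in> darcs G \<Longrightarrow> tgt G d \<in> verts G" "a \<in> arcs G \<Longrightarrow> dag G a \<noteq> a"
    "a \<in> arcs G \<Longrightarrow> dag G (dag G a) = a" "d \<in> darcs G \<Longrightarrow> incl G d = d"
  using assms diagram_simps[of G] by (auto simp: graph_def)

lemma graph_dag_boundary:
  assumes G: "graph G" "connected G" and "verts G \<noteq> {}" "a \<in> boundary G"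
  shows "dag G a \<in> darcs G" "a \<in> arcs G"
proof -
  obtain d where "d \<in> darcs G" "dag G a = incl G d"
    using connected_dag_boundary[OF G(2) graph_pregraph[OF G(1)] assms(3), of a] assms(4)
      graph_pre_boundary[OF G(1)] by metis
  then show "dag G a \<in> darcs G" using graph_simps(6)[OF G(1)] by simp
  show "a \<in> arcs G" using assms(4) by (simp add: boundary_def)
qed

lemma boundary_cases:
  "a \<in> arcs X \<Longrightarrow> (\<exists>d\<in>darcs X. a = incl X d) \<or> a \<in> pre_boundary X"
  by (auto simp: pre_boundary_def)

context
  fixes H :: "('a, 'd, 'v) diagram" and G :: "('b, 'w) graph" and f
  assumes f: "pre_embedding H G f"
begin

lemma pre_embedding_graphs: "pregraph H" "connected H" "graph G" "connected G" "nat_trans H G f"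
  using f by (auto simp: pre_embedding_def etale_def)

lemma pre_embedding_inj_V: "v \<in> verts H \<Longrightarrow> v' \<in> verts H \<Longrightarrow> onV f v = onV f v' \<longleftrightarrow> v = v'"
  using f by (auto simp: pre_embedding_def inj_on_def)

lemma pre_embedding_lift_D:
  assumes "v \<in> verts H" "d' \<in> darcs G" "tgt G d' = onV f v"
  obtains d where "d \<in> darcs H" "tgt H d = v" "onD f d = d'"
  using f assms by (metis pre_embedding_def etale_def)

text \<open>Injectivity on vertices puts both arcs at the same vertex, where the uniqueness half of
  the pullback condition identifies them.\<close>

lemma pre_embedding_inj_D:
  assumes "d \<in> darcs H" "d' \<in> darcs H" shows "onD f d = onD f d' \<longleftrightarrow> d = d'"
proof
  assume eq: "onD f d = onD f d'"
  note fs = nat_trans_simps[OF pre_embedding_graphs(5)]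
  have "tgt H d = tgt H d'"
    using pre_embedding_inj_V fs(6) eq assms pregraph_simps(3)[OF pre_embedding_graphs(1)] by metis
  moreover have "\<exists>!e. e \<in> darcs H \<and> tgt H e = tgt H d \<and> onD f e = onD f d"
    using f assms fs(2,6) pregraph_simps(3)[OF pre_embedding_graphs(1)]
    by (simp add: pre_embedding_def etale_def)
  ultimately show "d = d'" using eq assms by metis
qed simp

lemma pre_embedding_simps:
  shows "a \<in> arcs H \<Longrightarrow> onA f a \<in> arcs G" "d \<in> darcs H \<Longrightarrow> onD f d \<in> darcs G"
    "v \<in> verts H \<Longrightarrow> onV f v \<in> verts G"
    "a \<in> arcs H \<Longrightarrow> onA f (dag H a) = dag G (onA f a)"
    "d \<in> darcs H \<Longrightarrow> onA f (incl H d) = onD f d"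
    "d \<in> darcs H \<Longrightarrow> onV f (tgt H d) = tgt G (onD f d)"
  using nat_trans_simps[OF pre_embedding_graphs(5)] graph_simps(6)[OF pre_embedding_graphs(3)]
  by auto

lemma pre_embedding_onD_image:
  "onD f ` darcs H = {d \<in> darcs G. tgt G d \<in> onV f ` verts H}"
proof (intro subset_antisym subsetI)
  fix d assume "d \<in> {d \<in> darcs G. tgt G d \<in> onV f ` verts H}"
  then obtain v where "d \<in> darcs G" "v \<in> verts H" "tgt G d = onV f v" by auto
  then show "d \<in> onD f ` darcs H" using pre_embedding_lift_D by blast
next
  fix d assume "d \<in> onD f ` darcs H"
  then obtain e where "e \<in> darcs H" "d = onD f e" by auto
  then show "d \<in> {d \<in> darcs G. tgt G d \<in> onV f ` verts H}"
    using pre_embedding_simps(2,6)[of e] pregraph_simps(3)[OF pre_embedding_graphs(1), of e]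
    by (metis (mono_tags, lifting) imageI mem_Collect_eq)
qed

lemma pre_embedding_no_verts_inj:
  assumes "verts H = {}" shows "inj_on (onA f) (arcs H)"
proof -
  obtain a where a: "a \<in> arcs H" "arcs H = {a, dag H a}"
    using connected_no_verts[OF pre_embedding_graphs(2,1) assms] by metis
  moreover have "dag G (onA f a) \<noteq> onA f a"
    using a(1) graph_simps(4)[OF pre_embedding_graphs(3)] pre_embedding_simps(1) by simp
  ultimately show ?thesis using pre_embedding_simps(4) by (auto simp: inj_on_def)
qed

text \<open>If there is a vertex, the involutes of boundary arcs are attached arcs, on which
  \<open>f\<close> is injective. Injectivity on all arcs may fail, as a boundary arc and an attached
  arc can have the same image.\<close>

lemma pre_embedding_inj_boundary: "inj_on (onA f) (pre_boundary H)"
proof (cases "verts H = {}")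
  case True
  then show ?thesis using pre_embedding_no_verts_inj
    by (rule_tac inj_on_subset[of _ "arcs H"]) (auto simp: pre_boundary_def)
next
  case False
  note H = pre_embedding_graphs(1)
  show ?thesis
  proof (rule inj_onI)
    fix a b assume ab: "a \<in> pre_boundary H" "b \<in> pre_boundary H" "onA f a = onA f b"
    obtain d where d: "d \<in> darcs H" "dag H a = incl H d"
      using connected_dag_boundary[OF pre_embedding_graphs(2) H False ab(1)] .
    obtain e where e: "e \<in> darcs H" "dag H b = incl H e"
      using connected_dag_boundary[OF pre_embedding_graphs(2) H False ab(2)] .
    have A: "a \<in> arcs H" "b \<in> arcs H" using ab by (auto simp: pre_boundary_def)
    have "onD f d = onD f e"
      using pre_embedding_simps(4)[of a] pre_embedding_simps(4)[of b] pre_embedding_simps(5) d e ab A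
      by simp
    then have "dag H a = dag H b" using d e pre_embedding_inj_D by simp
    then show "a = b" using A pregraph_simps(5)[OF H] by metis
  qed
qed

end

text \<open>Attached arcs and vertices have forced lifts because \<open>f\<close> is injective on
  them, and every other arc of \<open>K\<close> is the involute of an attached one since
  \<open>K\<close> has a vertex. Only compatibility with the involution on an internal edge of
  \<open>K\<close> is at stake: that edge may have been cut in \<open>H\<close>, and the last
  hypothesis says that it has not.\<close>

lemma pre_embedding_lift:
  fixes f :: "('a, 'd, 'v, 'b, 'b, 'w) ntrans" and g :: "('c, 'e, 'u, 'b, 'b, 'w) ntrans"
  assumes f: "pre_embedding H G f" and g: "pre_embedding K G g" and ne: "verts K \<noteq> {}"
    and sub: "onV g ` verts K \<subseteq> onV f ` verts H"
    and glue: "\<And>d e. d \<in> darcs K \<Longrightarrow> e \<in> darcs K \<Longrightarrow> dag K (incl K d) = incl K e \<Longrightarrow>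
      onD g e \<notin> onA f ` pre_boundary H"
  obtains z where "etale K H z" "inj_on (onV z) (verts K)" "nt_comp K f z = g"
proof -
  note H = pre_embedding_graphs[OF f] and K = pre_embedding_graphs[OF g]
  note Hs = pregraph_simps[OF H(1)] and Ks = pregraph_simps[OF K(1)]
  note fs = pre_embedding_simps[OF f] and gs = pre_embedding_simps[OF g]
  define zV where "zV v = inv_into (verts H) (onV f) (onV g v)" for v
  define zD where "zD d = inv_into (darcs H) (onD f) (onD g d)" for d
  define q where "q a = incl H (zD (inv_into (darcs K) (incl K) a))" for a
  \<comment> \<open>\<open>q\<close> lifts an attached arc; any other arc is lifted as the involute
    of the lift of its involute.\<close>
  define zA where "zA a = (if a \<in> incl K ` darcs K then q a else dag H (q (dag K a)))" for a
  have V: "zV v \<in> verts H" "onV f (zV v) = onV g v" if "v \<in> verts K" for v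
    using that sub by (auto simp: zV_def inv_into_into f_inv_into_f subset_iff)
  have D: "zD d \<in> darcs H" "onD f (zD d) = onD g d" if "d \<in> darcs K" for d
  proof -
    have "onD g d \<in> onD f ` darcs H"
      using imageI[OF that, of "onD g"] sub
      unfolding pre_embedding_onD_image[OF f] pre_embedding_onD_image[OF g] by auto
    then show "zD d \<in> darcs H" "onD f (zD d) = onD g d"
      by (auto simp: zD_def inv_into_into f_inv_into_f)
  qed
  have q: "q (incl K d) = incl H (zD d)" if "d \<in> darcs K" for d
    using that K(1) by (simp add: q_def pregraph_def)
  have zA: "zA (incl K d) = incl H (zD d)" if "d \<in> darcs K" for d
    using that q by (simp add: zA_def)
  have zA': "zA a = dag H (incl H (zD d))"
    if "d \<in> darcs K" "a \<in> pre_boundary K" "dag K a = incl K d" for a d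
    using that q by (auto simp: zA_def pre_boundary_def)
  have cases: "(\<exists>d\<in>darcs K. a = incl K d) \<or> (a \<in> pre_boundary K \<and> (\<exists>d\<in>darcs K. dag K a = incl K d))"
    if "a \<in> arcs K" for a
    using boundary_cases[OF that]
  proof
    assume "a \<in> pre_boundary K"
    then show ?thesis using connected_dag_boundary[OF K(2,1) ne] by metis
  qed blast
  have arc: "zA a \<in> arcs H \<and> onA f (zA a) = onA g a" if a: "a \<in> arcs K" for a
    using cases[OF a]
  proof (elim disjE conjE bexE)
    fix d assume "d \<in> darcs K" "a = incl K d"
    then show ?thesis using zA D Hs fs gs by simp
  next
    fix d assume d: "a \<in> pre_boundary K" "d \<in> darcs K" "dag K a = incl K d"
    have "onA f (zA a) = dag G (onD g d)" using d zA' D Hs fs by simp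
    also have "\<dots> = dag G (dag G (onA g a))" using d gs(4)[OF a] gs(5) by simp
    finally have "onA f (zA a) = onA g a" using graph_simps(5)[OF H(3)] gs a by simp
    then show ?thesis using d zA' D Hs by simp
  qed
  have dag: "zA (dag K a) = dag H (zA a)" if a: "a \<in> arcs K" for a
    using cases[OF a]
  proof (elim disjE conjE bexE)
    fix d assume d: "a \<in> pre_boundary K" "d \<in> darcs K" "dag K a = incl K d"
    then show ?thesis using zA zA' D Hs by simp
  next
    fix d assume d: "d \<in> darcs K" "a = incl K d"
    show ?thesis
      using cases[OF Ks(1)[OF a]]
    proof (elim disjE conjE bexE)
      fix e assume "dag K a \<in> pre_boundary K" "e \<in> darcs K" "dag K (dag K a) = incl K e"
      then show ?thesis using d zA zA' a Ks by simp
    next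
      fix e assume e: "e \<in> darcs K" "dag K a = incl K e"
      have *: "onA f (dag H (incl H (zD d))) = onD g e"
        using d e D Hs fs gs(4)[OF a] gs(5) by simp
      have "dag H (incl H (zD d)) \<in> arcs H" using D d Hs by simp
      from boundary_cases[OF this] show ?thesis
      proof (elim disjE bexE)
        fix d' assume d': "d' \<in> darcs H" "dag H (incl H (zD d)) = incl H d'"
        then have "d' = zD e"
          using * D[OF e(1)] fs(5)[of d'] pre_embedding_inj_D[OF f d'(1) D(1)[OF e(1)]] by simp
        then show ?thesis using d' d e zA by simp
      next
        \<comment> \<open>Here the edge would be cut in \<open>H\<close>, with its loose end over
          \<open>onD g e\<close>; this is what \<open>glue\<close> excludes.\<close>
        assume "dag H (incl H (zD d)) \<in> pre_boundary H"
        then show ?thesis using glue[of d e] * d e by (metis imageI)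
      qed
    qed
  qed
  have tgt: "zV (tgt K d) = tgt H (zD d)" if "d \<in> darcs K" for d
  proof -
    have "onV f (zV (tgt K d)) = onV f (tgt H (zD d))" using that V D Ks fs gs by simp
    then show ?thesis using that V(1) D(1) Ks(3) Hs(3) pre_embedding_inj_V[OF f] by metis
  qed
  define z where "z = \<lparr>onA = restrict zA (arcs K), onD = restrict zD (darcs K), onV = restrict zV (verts K)\<rparr>"
  have nt: "nat_trans K H z"
    using V D arc dag tgt zA Ks by (auto simp: nat_trans_def z_def)
  have inj: "inj_on (onV z) (verts K)"
  proof (rule inj_onI)
    fix v w assume vw: "v \<in> verts K" "w \<in> verts K" "onV z v = onV z w"
    then have "onV g v = onV g w" using V(2) by (metis restrict_apply' z_def ntrans.select_convs(3))
    then show "v = w" using vw pre_embedding_inj_V[OF g] by simp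
  qed
  have "\<exists>!d. d \<in> darcs K \<and> tgt K d = v \<and> onD z d = d'"
    if v: "v \<in> verts K" "d' \<in> darcs H" "onV z v = tgt H d'" for v d'
  proof -
    have "tgt G (onD f d') = onV g v" using v V(2)[of v] fs(6)[of d'] by (simp add: z_def)
    then obtain d where d: "d \<in> darcs K" "tgt K d = v" "onD g d = onD f d'"
      using pre_embedding_lift_D[OF g v(1), of "onD f d'"] fs v by metis
    then have "onD z d = d'"
      using D[OF d(1)] pre_embedding_inj_D[OF f D(1)[OF d(1)] v(2)] by (simp add: z_def)
    moreover have "d1 = d" if "d1 \<in> darcs K" "onD z d1 = d'" for d1
      using that d D(2)[of d1] pre_embedding_inj_D[OF g that(1) d(1)] by (simp add: z_def)
    ultimately show ?thesis using d by blast
  qed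
  then have "etale K H z" using nt by (auto simp: etale_def)
  moreover have "nt_comp K f z = g"
  proof (rule ntrans.equality)
    show "onA (nt_comp K f z) = onA g"
      using K(5) arc by (auto simp: nt_comp_def compose_def z_def nat_trans_def PiE_iff
          extensional_def fun_eq_iff)
    show "onD (nt_comp K f z) = onD g"
      using K(5) D by (auto simp: nt_comp_def compose_def z_def nat_trans_def PiE_iff
          extensional_def fun_eq_iff)
    show "onV (nt_comp K f z) = onV g"
      using K(5) V by (auto simp: nt_comp_def compose_def z_def nat_trans_def PiE_iff
          extensional_def fun_eq_iff)
  qed simp
  ultimately show ?thesis using that inj by blast
qed

section \<open>Uniqueness of embeddings with given vertices and boundary\<close>

lemma nt_comp_apply:
  "a \<in> arcs K \<Longrightarrow> onA (nt_comp K f z) a = onA f (onA z a)"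
  "d \<in> darcs K \<Longrightarrow> onD (nt_comp K f z) d = onD f (onD z d)"
  "v \<in> verts K \<Longrightarrow> onV (nt_comp K f z) v = onV f (onV z v)"
  by (simp_all add: nt_comp_def compose_def)

lemma nat_trans_nt_comp:
  assumes "diagram K" "nat_trans K H z" "nat_trans H G f"
  shows "nat_trans K G (nt_comp K f z)"
  using nat_trans_simps[OF assms(2)] nat_trans_simps[OF assms(3)] diagram_simps[OF assms(1)]
  by (auto simp: nat_trans_def nt_comp_def compose_def)

text \<open>The lift of \<open>g\<close> through \<open>f\<close> is invertible: it is bijective on
  vertices and attached arcs because the vertex sets agree, and on boundary arcs because the
  boundaries agree.\<close>

lemma pre_embedding_unique:
  fixes f :: "('a, 'd, 'v, 'b, 'b, 'w) ntrans" and g :: "('c, 'e, 'u, 'b, 'b, 'w) ntrans"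
  assumes f: "pre_embedding H G f" and g: "pre_embedding K G g"
    and verts: "onV g ` verts K = onV f ` verts H"
    and bd: "onA g ` pre_boundary K = onA f ` pre_boundary H"
  obtains z where "nt_iso K H z" "g = nt_comp K f z"
proof (cases "verts K = {}")
  \<comment> \<open>Without a vertex the lifting lemma does not apply, but both maps are then
    injective on all arcs and the isomorphism can be read off from their common image.\<close>
  case True
  note H = pre_embedding_graphs[OF f] and K = pre_embedding_graphs[OF g]
  note Hs = pregraph_simps[OF H(1)] and Ks = pregraph_simps[OF K(1)]
  note fs = pre_embedding_simps[OF f] and gs = pre_embedding_simps[OF g]
  have "verts H = {}" using True verts by simp
  then have e: "darcs H = {}" "darcs K = {}" using True Hs(3) Ks(3) by auto
  have injf: "inj_on (onA f) (arcs H)" and injg: "inj_on (onA g) (arcs K)"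
    using pre_embedding_no_verts_inj f g True \<open>verts H = {}\<close> by auto
  have im: "onA g ` arcs K = onA f ` arcs H"
    using bd e by (simp add: pre_boundary_def)
  define zA where "zA = restrict (\<lambda>a. inv_into (arcs H) (onA f) (onA g a)) (arcs K)"
  have zA: "zA a \<in> arcs H" "onA f (zA a) = onA g a" if "a \<in> arcs K" for a
  proof -
    have "onA g a \<in> onA f ` arcs H" using that im by blast
    then show "zA a \<in> arcs H" "onA f (zA a) = onA g a"
      using that by (simp_all add: zA_def inv_into_into f_inv_into_f)
  qed
  have dag: "zA (dag K a) = dag H (zA a)" if "a \<in> arcs K" for a
    using that zA Ks(1) Hs(1) fs gs by (intro inj_onD[OF injf]) auto
  define z :: "('c, 'e, 'u, 'a, 'd, 'v) ntrans"
    where "z = \<lparr>onA = zA, onD = (\<lambda>_. undefined), onV = (\<lambda>_. undefined)\<rparr>"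
  have nt: "nat_trans K H z"
    using zA dag e True by (auto simp: nat_trans_def z_def zA_def)
  have "bij_betw zA (arcs K) (arcs H)"
    unfolding bij_betw_def
  proof
    show "inj_on zA (arcs K)" using zA injg by (metis inj_onD inj_onI)
    show "zA ` arcs K = arcs H"
    proof (intro subset_antisym subsetI)
      fix b assume b: "b \<in> arcs H"
      then obtain a where a: "a \<in> arcs K" "onA f b = onA g a" using im by (metis imageE imageI)
      then have "b = zA a" using zA b inj_onD[OF injf] by metis
      then show "b \<in> zA ` arcs K" using a by simp
    qed (use zA in auto)
  qed
  then have "nt_iso K H z"
    using nt_iso_iff[OF pregraph_diagram[OF K(1)] pregraph_diagram[OF H(1)]] nt e True \<open>verts H = {}\<close>
    by (simp add: z_def bij_betw_def)
  moreover have "g = nt_comp K f z"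
    using K(5) zA e True by (auto simp: nt_comp_def compose_def z_def nat_trans_def PiE_iff
          extensional_def fun_eq_iff intro!: ntrans.equality)
  ultimately show ?thesis using that by blast
next
  case False
  note H = pre_embedding_graphs[OF f] and K = pre_embedding_graphs[OF g]
  note Hs = pregraph_simps[OF H(1)] and Ks = pregraph_simps[OF K(1)]
  note fs = pre_embedding_simps[OF f] and gs = pre_embedding_simps[OF g]
  have ne: "verts H \<noteq> {}" using False verts by auto
  \<comment> \<open>A loose end in \<open>H\<close> over this arc would give, by equality of
    boundaries, a boundary arc \<open>b\<close> of \<open>K\<close> over it. The involutes of
    \<open>b\<close> and of \<open>incl K e\<close> are attached and have the same image, so they
    agree, and \<open>b\<close> would be attached.\<close>
  have glue: "onD g e \<notin> onA f ` pre_boundary H"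
    if de: "d \<in> darcs K" "e \<in> darcs K" "dag K (incl K d) = incl K e" for d e
  proof
    assume "onD g e \<in> onA f ` pre_boundary H"
    then obtain b where b: "b \<in> pre_boundary K" "onA g b = onD g e" using bd by (metis imageE)
    then obtain c where c: "c \<in> darcs K" "dag K b = incl K c"
      using connected_dag_boundary[OF K(2,1) False] by metis
    have bK: "b \<in> arcs K" using b by (simp add: pre_boundary_def)
    have "onD g c = dag G (onA g b)" using gs(4)[OF bK] gs(5) c by simp
    also have "\<dots> = onA g (dag K (incl K e))" using b de gs Ks by simp
    also have "\<dots> = onD g d" using de gs Ks by (metis (no_types))
    finally have "c = d" using pre_embedding_inj_D[OF g] c de by simp
    then have "b = incl K e" using c de bK Ks by metis
    then show False using b de by (simp add: pre_boundary_def)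
  qed
  obtain z where z: "etale K H z" "inj_on (onV z) (verts K)" "nt_comp K f z = g"
  proof (rule pre_embedding_lift[OF f g False])
    show "onV g ` verts K \<subseteq> onV f ` verts H" using verts by simp
  qed (use glue in blast)+
  then have nt: "nat_trans K H z" by (simp add: etale_def)
  note zs = nat_trans_simps[OF nt]
  have gA: "onA g a = onA f (onA z a)" if "a \<in> arcs K" for a
    using z(3) that nt_comp_apply(1) by metis
  have gD: "onD g a = onD f (onD z a)" if "a \<in> darcs K" for a
    using z(3) that nt_comp_apply(2) by metis
  have gV: "onV g a = onV f (onV z a)" if "a \<in> verts K" for a
    using z(3) that nt_comp_apply(3) by metis
  have bV: "bij_betw (onV z) (verts K) (verts H)"
    unfolding bij_betw_def
  proof (intro conjI subset_antisym subsetI)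
    fix v assume v: "v \<in> verts H"
    then obtain w where w: "w \<in> verts K" "onV f v = onV g w" using verts by (metis imageE imageI)
    then have "v = onV z w" using v zs(3) gV pre_embedding_inj_V[OF f] by simp
    then show "v \<in> onV z ` verts K" using w by simp
  qed (use z zs in auto)
  have bD: "bij_betw (onD z) (darcs K) (darcs H)"
    unfolding bij_betw_def
  proof (intro conjI subset_antisym subsetI)
    show "inj_on (onD z) (darcs K)" using gD pre_embedding_inj_D[OF g] by (metis inj_onI)
    fix d assume d: "d \<in> darcs H"
    then obtain w where "w \<in> verts K" "tgt H d = onV z w"
      using bij_betw_imp_surj_on[OF bV] Hs(3) by (metis imageE)
    then show "d \<in> onD z ` darcs K" using z(1) d unfolding etale_def by (metis imageI)
  qed (use zs in auto)
  \<comment> \<open>A priori \<open>onA z b\<close> could be an attached arc of \<open>H\<close>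
    with the same image as a boundary arc. Comparing involutes, which are attached and so separated
    by \<open>f\<close>, shows that it is that boundary arc.\<close>
  have zb: "onA z b \<in> pre_boundary H" if b: "b \<in> pre_boundary K" for b
  proof -
    have bK: "b \<in> arcs K" using b by (simp add: pre_boundary_def)
    obtain b' where b': "b' \<in> pre_boundary H" "onA f b' = onA g b" using bd b by (metis imageE imageI)
    have b'H: "b' \<in> arcs H" using b' by (simp add: pre_boundary_def)
    obtain d' where d': "d' \<in> darcs H" "dag H b' = incl H d'"
      using connected_dag_boundary[OF H(2,1) ne b'(1)] .
    obtain d where d: "d \<in> darcs K" "dag K b = incl K d"
      using connected_dag_boundary[OF K(2,1) False b] .
    have "onD f d' = dag G (onA f b')" using d' fs(4)[OF b'H] fs(5) by simp
    also have "\<dots> = onD g d" using gs(4)[OF bK] gs(5) d b' by simp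
    finally have "onD f d' = onD f (onD z d)" using gD d by simp
    then have "d' = onD z d" using d' d zs pre_embedding_inj_D[OF f] by simp
    then have "dag H b' = dag H (onA z b)" using d' d zs(5)[of d] zs(4)[OF bK] by simp
    then have "b' = onA z b" using Hs(5) b'H zs(1)[OF bK] by metis
    then show ?thesis using b' by simp
  qed
  have split: "arcs X = incl X ` darcs X \<union> pre_boundary X" if "pregraph X" for X :: "('x, 'y, 'z) diagram"
    using pregraph_simps(2)[OF that] by (auto simp: pre_boundary_def)
  have "bij_betw (onA z) (incl K ` darcs K \<union> pre_boundary K) (incl H ` darcs H \<union> pre_boundary H)"
  proof (rule bij_betw_combine)
    show "bij_betw (onA z) (incl K ` darcs K) (incl H ` darcs H)"
      unfolding bij_betw_def
    proof
      show "onA z ` incl K ` darcs K = incl H ` darcs H"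
        using zs(5) bij_betw_imp_surj_on[OF bD] by (force simp: image_image)
      show "inj_on (onA z) (incl K ` darcs K)"
        using zs(2,5) Hs(6) bij_betw_imp_inj_on[OF bD] by (auto simp: inj_on_def)
    qed
    show "bij_betw (onA z) (pre_boundary K) (pre_boundary H)"
      unfolding bij_betw_def
    proof (intro conjI subset_antisym subsetI)
      show "inj_on (onA z) (pre_boundary K)"
        using pre_embedding_inj_boundary[OF g] gA
        by (auto simp: inj_on_def pre_boundary_def)
      fix b' assume b': "b' \<in> pre_boundary H"
      then obtain b where b: "b \<in> pre_boundary K" "onA f b' = onA g b" using bd by (metis imageE imageI)
      then have "b' = onA z b"
        using inj_onD[OF pre_embedding_inj_boundary[OF f]] b' zb gA by (auto simp: pre_boundary_def)
      then show "b' \<in> onA z ` pre_boundary K" using b by simp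
    qed (use zb in auto)
  qed (auto simp: pre_boundary_def)
  then have "bij_betw (onA z) (arcs K) (arcs H)" using split[OF K(1)] split[OF H(1)] by simp
  then have "nt_iso K H z"
    using nt_iso_iff[OF pregraph_diagram[OF K(1)] pregraph_diagram[OF H(1)]] nt bD bV by blast
  then show ?thesis using that z(3) by blast
qed

section \<open>Transport along isomorphisms\<close>

lemma connected_nt_iso:
  assumes iso: "nt_iso K H z" and K: "diagram K" and H: "diagram H" and conn: "connected H"
  shows "connected K"
proof -
  have z: "nat_trans K H z" and bA: "bij_betw (onA z) (arcs K) (arcs H)"
    and bD: "bij_betw (onD z) (darcs K) (darcs H)" and bV: "bij_betw (onV z) (verts K) (verts H)"
    using iso nt_iso_iff[OF K H] by auto
  note zs = nat_trans_simps[OF z] and Ks = diagram_simps[OF K]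
  have "nonempty K"
    using conn bij_betw_imp_surj_on[OF bA] bij_betw_imp_surj_on[OF bD] bij_betw_imp_surj_on[OF bV]
    by (auto simp: connected_def nonempty_def)
  moreover have "P = arcs K \<and> Q = verts K" if cl: "closed_part K P Q" and ne: "P \<noteq> {} \<or> Q \<noteq> {}" for P Q
  proof -
    have P: "P \<subseteq> arcs K" and Q: "Q \<subseteq> verts K" using cl by (auto simp: closed_part_def)
    have inA: "onA z a \<in> onA z ` P \<longleftrightarrow> a \<in> P" if "a \<in> arcs K" for a
      using inj_on_image_mem_iff[OF bij_betw_imp_inj_on[OF bA] that P] .
    have inV: "onV z a \<in> onV z ` Q \<longleftrightarrow> a \<in> Q" if "a \<in> verts K" for a
      using inj_on_image_mem_iff[OF bij_betw_imp_inj_on[OF bV] that Q] .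
    have "closed_part H (onA z ` P) (onV z ` Q)"
      unfolding closed_part_def
    proof (intro conjI ballI)
      show "onA z ` P \<subseteq> arcs H" "onV z ` Q \<subseteq> verts H" using P Q zs by auto
      fix b assume "b \<in> arcs H"
      then obtain a where a: "a \<in> arcs K" "b = onA z a"
        using bij_betw_imp_surj_on[OF bA] by blast
      then have "dag H b = onA z (dag K a)" using zs by simp
      then show "dag H b \<in> onA z ` P \<longleftrightarrow> b \<in> onA z ` P"
        using inA a Ks cl by (simp add: closed_part_def)
    next
      fix b assume "b \<in> darcs H"
      then obtain a where a: "a \<in> darcs K" "b = onD z a"
        using bij_betw_imp_surj_on[OF bD] by blast
      then have "incl H b = onA z (incl K a)" "tgt H b = onV z (tgt K a)" using zs by simp_all
      then show "incl H b \<in> onA z ` P \<longleftrightarrow> tgt H b \<in> onV z ` Q"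
        using inA inV a Ks cl by (simp add: closed_part_def)
    qed
    then have eq: "onA z ` P = onA z ` arcs K" "onV z ` Q = onV z ` verts K"
      using connectedD[OF conn H, of "onA z ` P" "onV z ` Q"] ne
        bij_betw_imp_surj_on[OF bA] bij_betw_imp_surj_on[OF bV] by auto
    then have "onA z a \<in> onA z ` P" "onV z v \<in> onV z ` Q" if "a \<in> arcs K" "v \<in> verts K" for a v
      using that by simp_all
    have "onA z a \<in> onA z ` P" if "a \<in> arcs K" for a
      using that eq by simp
    then have "arcs K \<subseteq> P" using inA by blast
    moreover have "onV z v \<in> onV z ` Q" if "v \<in> verts K" for v
      using that eq by simp
    then have "verts K \<subseteq> Q" using inV by blast
    ultimately show ?thesis using P Q by auto
  qed
  ultimately show ?thesis using connected_iff[OF K] by blast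
qed

lemma nt_iso_boundary:
  assumes iso: "nt_iso K H z" and K: "diagram K" and H: "diagram H"
  shows "onA z ` pre_boundary K = pre_boundary H"
proof -
  have z: "nat_trans K H z" and bA: "bij_betw (onA z) (arcs K) (arcs H)"
    and bD: "bij_betw (onD z) (darcs K) (darcs H)"
    using iso nt_iso_iff[OF K H] by auto
  have "onA z ` incl K ` darcs K = incl H ` darcs H"
    using nat_trans_simps(5)[OF z] bij_betw_imp_surj_on[OF bD] by (force simp: image_image)
  moreover have "incl K ` darcs K \<subseteq> arcs K" using diagram_simps[OF K] by auto
  ultimately show ?thesis
    using inj_on_image_set_diff[OF bij_betw_imp_inj_on[OF bA], of "arcs K" "incl K ` darcs K"]
      bij_betw_imp_surj_on[OF bA] by (simp add: pre_boundary_def)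
qed

lemma pre_embedding_nt_iso:
  assumes f: "pre_embedding H G f" and iso: "nt_iso K H z" and K: "pregraph K"
  shows "pre_embedding K G (nt_comp K f z)"
proof -
  note H = pre_embedding_graphs[OF f]
  note Kd = pregraph_diagram[OF K] and Hd = pregraph_diagram[OF H(1)]
  note fs = pre_embedding_simps[OF f] and Ks = diagram_simps[OF Kd]
  have z: "nat_trans K H z" and bD: "bij_betw (onD z) (darcs K) (darcs H)"
    and bV: "bij_betw (onV z) (verts K) (verts H)"
    using iso nt_iso_iff[OF Kd Hd] by auto
  note zs = nat_trans_simps[OF z]
  have "inj_on (onV (nt_comp K f z)) (verts K)"
    using bij_betw_imp_inj_on[OF bV] zs(3) pre_embedding_inj_V[OF f]
    by (auto simp: inj_on_def nt_comp_apply)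
  moreover have "\<exists>!d. d \<in> darcs K \<and> tgt K d = v \<and> onD (nt_comp K f z) d = d'"
    if v: "v \<in> verts K" "d' \<in> darcs G" "onV (nt_comp K f z) v = tgt G d'" for v d'
  proof -
    have "tgt G d' = onV f (onV z v)" using v by (simp add: nt_comp_apply)
    then obtain e where e: "e \<in> darcs H" "tgt H e = onV z v" "onD f e = d'"
      using pre_embedding_lift_D[OF f, of "onV z v"] v zs by metis
    then obtain d where d: "d \<in> darcs K" "e = onD z d" using bij_betw_imp_surj_on[OF bD] by auto
    then have "onV z (tgt K d) = onV z v" using zs e by simp
    then have "tgt K d = v" using inj_onD[OF bij_betw_imp_inj_on[OF bV]] d v Ks by simp
    moreover have "d1 = d" if "d1 \<in> darcs K" "onD f (onD z d1) = d'" for d1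
      using that d e zs pre_embedding_inj_D[OF f] inj_onD[OF bij_betw_imp_inj_on[OF bD]] by metis
    ultimately show ?thesis using d e by (metis nt_comp_apply(2))
  qed
  ultimately show ?thesis
    using connected_nt_iso[OF iso Kd Hd H(2)] nat_trans_nt_comp[OF Kd z H(5)] K H
    by (auto simp: pre_embedding_def etale_def)
qed

lemma finite_inj_into_infinite:
  assumes "finite A" obtains j :: "'a \<Rightarrow> 'b :: infinite" where "inj_on j A"
proof -
  obtain B :: "'b set" where "finite B" "card B = card A"
    using infinite_arbitrarily_large[OF infinite_UNIV] by blast
  then show ?thesis
    using that finite_same_card_bij[OF assms] by (metis bij_betw_imp_inj_on)
qed

text \<open>The arcs are renamed along an injection into the infinite arc type, and the vertices
  along \<open>f\<close> itself, which is injective on them. This makes the classes of stars and of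
  glued diagrams nonempty.\<close>

lemma pre_embedding_transport:
  fixes G :: "('b :: infinite, 'w) graph" and H :: "('a, 'd, 'v) diagram"
  assumes f: "pre_embedding H G f"
  obtains K :: "('b, 'w) graph" and g z where "embedding K G g" "nt_iso K H z" "g = nt_comp K f z"
proof -
  note H = pre_embedding_graphs[OF f]
  note Hs = pregraph_simps[OF H(1)] and Hd = pregraph_diagram[OF H(1)]
  obtain j :: "'a \<Rightarrow> 'b" where j: "inj_on j (arcs H)"
    using finite_inj_into_infinite Hd by (metis diagram_def)
  define k where "k = inv_into (arcs H) j"
  define kD where "kD = inv_into (darcs H) (j \<circ> incl H)"
  define kV where "kV = inv_into (verts H) (onV f)"
  have k: "k (j a) = a" if "a \<in> arcs H" for a using that j by (simp add: k_def)
  have "inj_on (j \<circ> incl H) (darcs H)"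
    using inj_on_subset[OF j, of "incl H ` darcs H"] H(1) Hs(2)
    by (intro comp_inj_on) (auto simp: pregraph_def)
  then have kD: "kD (j (incl H d)) = d" if "d \<in> darcs H" for d
    using that inv_into_f_f[of "j \<circ> incl H" "darcs H" d] by (simp add: kD_def)
  have kV: "kV (onV f v) = v" if "v \<in> verts H" for v
    using that f by (simp add: kV_def pre_embedding_def)
  define K :: "('b, 'w) graph" where "K = \<lparr>arcs = j ` arcs H, darcs = j ` incl H ` darcs H,
    verts = onV f ` verts H, dag = restrict (j \<circ> dag H \<circ> k) (j ` arcs H),
    incl = (\<lambda>d\<in>j ` incl H ` darcs H. d), tgt = restrict (onV f \<circ> tgt H \<circ> kD) (j ` incl H ` darcs H)\<rparr>"
  define z where "z = \<lparr>onA = restrict k (arcs K), onD = restrict kD (darcs K), onV = restrict kV (verts K)\<rparr>"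
  have "diagram K"
    using Hd Hs k kD by (auto simp: diagram_def K_def)
  moreover have "j (dag H a) \<noteq> j a" if "a \<in> arcs H" for a
    using that j Hs(1,4) by (metis inj_onD)
  ultimately have K: "graph K"
    using Hs k by (auto simp: graph_def K_def)
  have nt: "nat_trans K H z"
    using Hs k kD kV by (auto simp: nat_trans_def z_def K_def)
  have "bij_betw (onA z) (arcs K) (arcs H)"
    by (rule bij_betw_byWitness[of _ j]) (use k in \<open>auto simp: z_def K_def\<close>)
  moreover have "bij_betw (onD z) (darcs K) (darcs H)"
    by (rule bij_betw_byWitness[of _ "j \<circ> incl H"]) (use kD in \<open>auto simp: z_def K_def\<close>)
  moreover have "bij_betw (onV z) (verts K) (verts H)"
    by (rule bij_betw_byWitness[of _ "onV f"]) (use kV in \<open>auto simp: z_def K_def\<close>)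
  ultimately have "nt_iso K H z" using nt_iso_iff[OF graph_diagram[OF K] Hd] nt by blast
  moreover from this have "embedding K G (nt_comp K f z)"
    using pre_embedding_nt_iso[OF f _ graph_pregraph[OF K]] K by (simp add: embedding_pre)
  ultimately show ?thesis using that by blast
qed

section \<open>Classes of embeddings and their two invariants\<close>

definition embeddings_with :: "('a, 'v) graph \<Rightarrow> 'v set \<Rightarrow> 'a set \<Rightarrow> ('a, 'v) emb set" where
  "embeddings_with G W B = {(K, g). embedding K G g \<and> onV g ` verts K = W \<and> onA g ` boundary K = B}"

definition emb_verts :: "('a, 'v) emb set \<Rightarrow> 'v set" where
  "emb_verts c = onV (rep_map c) ` verts (rep_graph c)"

text \<open>An isomorphism of domains over \<open>G\<close> preserves both sets; the converse is the
  uniqueness of embeddings.\<close>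

lemma emb_class_eq:
  fixes H :: "('b, 'd, 'w) diagram" and G :: "('a, 'v) graph"
  assumes f: "pre_embedding H G f"
  shows "emb_class G H f = embeddings_with G (onV f ` verts H) (onA f ` pre_boundary H)"
proof (intro subset_antisym subsetI)
  fix p assume "p \<in> emb_class G H f"
  then obtain K g z where p: "p = (K, g)" and g: "embedding K G g" and z: "nt_iso K H z"
    and eq: "g = nt_comp K f z"
    by (auto simp: emb_class_def)
  have K: "graph K" using g by (simp add: embedding_pre)
  note d = graph_diagram[OF K] pregraph_diagram[OF pre_embedding_graphs(1)[OF f]]
  have zV: "onV z ` verts K = verts H"
    using z nt_iso_iff[OF d] by (auto simp: bij_betw_def)
  have "onA g ` boundary K = onA f ` onA z ` pre_boundary K"
    unfolding eq image_image graph_pre_boundary[OF K, symmetric]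
    by (rule image_cong) (auto simp: nt_comp_apply pre_boundary_def)
  moreover have "onV g ` verts K = onV f ` onV z ` verts K"
    unfolding eq image_image by (rule image_cong) (auto simp: nt_comp_apply)
  ultimately show "p \<in> embeddings_with G (onV f ` verts H) (onA f ` pre_boundary H)"
    using p g zV nt_iso_boundary[OF z d] by (simp add: embeddings_with_def)
next
  fix p assume "p \<in> embeddings_with G (onV f ` verts H) (onA f ` pre_boundary H)"
  then obtain K g where p: "p = (K, g)" and g: "embedding K G g"
    and eq: "onV g ` verts K = onV f ` verts H" "onA g ` boundary K = onA f ` pre_boundary H"
    by (auto simp: embeddings_with_def)
  have g': "pre_embedding K G g" and K: "graph K" using g by (auto simp: embedding_pre)
  obtain z where "nt_iso K H z" "g = nt_comp K f z"
    using pre_embedding_unique[OF f g'] eq graph_pre_boundary[OF K] by metis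
  then show "p \<in> emb_class G H f" using p g by (auto simp: emb_class_def)
qed

lemma emb_class_nonempty:
  fixes H :: "('b, 'd, 'w) diagram" and G :: "('a :: infinite, 'v) graph"
  assumes f: "pre_embedding H G f"
  shows "emb_class G H f \<noteq> {}"
proof -
  obtain K :: "('a, 'v) graph" and g z where "embedding K G g" "nt_iso K H z" "g = nt_comp K f z"
    using pre_embedding_transport[OF f] .
  then have "(K, g) \<in> emb_class G H f" by (auto simp: emb_class_def)
  then show ?thesis by blast
qed

text \<open>The representative chosen by \<open>rep\<close> lies in the class, hence has the
  invariants of \<open>f\<close>; neither of them depends on the choice.\<close>

lemma emb_class_data:
  fixes H :: "('b, 'd, 'w) diagram" and G :: "('a :: infinite, 'v) graph"
  assumes f: "pre_embedding H G f"
  shows "emb_class G H f \<in> Emb G" "emb_verts (emb_class G H f) = onV f ` verts H"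
    "class_boundary (emb_class G H f) = onA f ` pre_boundary H"
proof -
  let ?c = "emb_class G H f"
  have "rep ?c \<in> ?c" using emb_class_nonempty[OF f] by (simp add: rep_def some_in_eq)
  then have r: "(rep_graph ?c, rep_map ?c) \<in> ?c" by (simp add: rep_graph_def rep_map_def)
  then have e: "embedding (rep_graph ?c) G (rep_map ?c)"
    and V: "onV (rep_map ?c) ` verts (rep_graph ?c) = onV f ` verts H"
    and A: "onA (rep_map ?c) ` boundary (rep_graph ?c) = onA f ` pre_boundary H"
    unfolding emb_class_eq[OF f] by (auto simp: embeddings_with_def)
  show "emb_verts ?c = onV f ` verts H" "class_boundary ?c = onA f ` pre_boundary H"
    using V A by (simp_all add: emb_verts_def class_boundary_def)
  have "emb_class G (rep_graph ?c) (rep_map ?c) = ?c"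
    using emb_class_eq[of "rep_graph ?c" G "rep_map ?c"] emb_class_eq[OF f] e V A
    by (simp add: embedding_pre graph_pre_boundary)
  then show "?c \<in> Emb G" using e unfolding Emb_def by blast
qed

lemma Emb_rep:
  fixes G :: "('a :: infinite, 'v) graph"
  assumes "c \<in> Emb G"
  shows "embedding (rep_graph c) G (rep_map c)" "c = embeddings_with G (emb_verts c) (class_boundary c)"
proof -
  obtain H :: "('a, 'v) graph" and f where f: "embedding H G f" and c: "c = emb_class G H f"
    using assms unfolding Emb_def by blast
  then have f': "pre_embedding H G f" by (simp add: embedding_pre)
  have "rep c \<in> c" using emb_class_nonempty[OF f'] c by (simp add: rep_def some_in_eq)
  then have "(rep_graph c, rep_map c) \<in> c" by (simp add: rep_graph_def rep_map_def)
  then show "embedding (rep_graph c) G (rep_map c)"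
    by (auto simp: c emb_class_def)
  show "c = embeddings_with G (emb_verts c) (class_boundary c)"
    using emb_class_data[OF f'] emb_class_eq[OF f'] c by simp
qed

lemma Emb_eqI:
  fixes G :: "('a :: infinite, 'v) graph"
  assumes "c \<in> Emb G" "c' \<in> Emb G" "emb_verts c = emb_verts c'" "class_boundary c = class_boundary c'"
  shows "c = c'"
  using assms Emb_rep(2) by metis

section \<open>The exceptional edge and stars as embedded graphs\<close>

lemma pregraph_exc_edge: "pregraph exc_edge"
  by (auto simp: pregraph_def diagram_def exc_edge_def PiE_def extensional_def)

lemma connected_exc_edge: "connected exc_edge"
proof -
  have d: "diagram exc_edge" by (rule pregraph_diagram[OF pregraph_exc_edge])
  have "P = UNIV" if "\<forall>a. (\<not> a) \<in> P \<longleftrightarrow> a \<in> P" "P \<noteq> {}" for P :: "bool set"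
  proof -
    have "True \<in> P \<longleftrightarrow> False \<in> P" using spec[OF that(1), of True] by simp
    moreover have "True \<in> P \<or> False \<in> P" using that(2) by (metis (full_types) ex_in_conv)
    ultimately show ?thesis by (metis (full_types) UNIV_eq_I)
  qed
  then show ?thesis
    unfolding connected_iff[OF d] by (auto simp: exc_edge_def nonempty_def closed_part_def)
qed

text \<open>Without vertices nothing is attached, and connectedness leaves a single edge. The case
  distinctions in \<open>im\<close> and \<open>is_edge_class\<close> thus become tests for the
  presence of vertices.\<close>

lemma is_exc_iff:
  fixes K :: "('a, 'v) graph"
  assumes K: "graph K" and conn: "connected K"
  shows "is_exc K \<longleftrightarrow> verts K = {}"
proof
  assume "is_exc K"
  then obtain z :: "('a, 'a, 'v, bool, bool, 'v) ntrans" where "nt_iso K exc_edge z"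
    by (auto simp: is_exc_def)
  then have "bij_betw (onV z) (verts K) (verts (exc_edge :: (bool, bool, 'v) diagram))"
    using nt_iso_iff[OF graph_diagram[OF K] pregraph_diagram[OF pregraph_exc_edge]] by blast
  then show "verts K = {}" by (auto simp: exc_edge_def bij_betw_def)
next
  assume ne: "verts K = {}"
  obtain a where a: "a \<in> arcs K" "arcs K = {a, dag K a}" "darcs K = {}" "dag K a \<noteq> a"
    using connected_no_verts[OF conn graph_pregraph[OF K] ne] .
  define z :: "('a, 'a, 'v, bool, bool, 'v) ntrans" where
    "z = \<lparr>onA = (\<lambda>b\<in>arcs K. b = a), onD = (\<lambda>_. undefined), onV = (\<lambda>_. undefined)\<rparr>"
  have "nat_trans K exc_edge z"
    using a ne graph_simps(5)[OF K] by (auto simp: nat_trans_def z_def exc_edge_def)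
  moreover have "bij_betw (onA z) (arcs K) (arcs (exc_edge :: (bool, bool, 'v) diagram))"
    by (rule bij_betw_byWitness[of _ "\<lambda>b. if b then a else dag K a"])
      (use a in \<open>auto simp: z_def exc_edge_def\<close>)
  ultimately have "nt_iso K exc_edge z"
    unfolding nt_iso_iff[OF graph_diagram[OF K] pregraph_diagram[OF pregraph_exc_edge]]
    using a(3) ne by (simp add: exc_edge_def bij_betw_def)
  then show "is_exc K" by (auto simp: is_exc_def)
qed

lemma is_edge_class_iff:
  fixes G :: "('a :: infinite, 'v) graph"
  assumes "c \<in> Emb G"
  shows "is_edge_class c \<longleftrightarrow> emb_verts c = {}"
  using Emb_rep(1)[OF assms] is_exc_iff[of "rep_graph c"]
  by (simp add: embedding_def is_edge_class_def emb_verts_def)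

lemma pre_embedding_pick_arc:
  fixes G :: "('a, 'v) graph"
  assumes G: "graph G" "connected G" and a: "a \<in> arcs G"
  shows "pre_embedding (exc_edge :: (bool, 'd, 'w) diagram) G (pick_arc G a)"
proof -
  have "nat_trans (exc_edge :: (bool, 'd, 'w) diagram) G (pick_arc G a)"
    using a graph_simps[OF G(1)] by (auto simp: nat_trans_def exc_edge_def pick_arc_def)
  then show ?thesis
    using G pregraph_exc_edge connected_exc_edge
    by (auto simp: pre_embedding_def etale_def exc_edge_def)
qed

lemma pre_embedding_star:
  fixes G :: "('a, 'v) graph"
  assumes G: "graph G" "connected G" and v: "v \<in> verts G"
  shows "pre_embedding (star G v) G (star_emb G v)"
proof -
  have fin: "finite (nb G v)" using graph_diagram[OF G(1)] by (simp add: nb_def diagram_def)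
  have S: "pregraph (star G v)"
    using fin by (auto simp: pregraph_def diagram_def star_def inj_on_def)
  have "P = nb G v <+> nb G v \<and> Q = {v}"
    if cl: "closed_part (star G v) P Q" and ne: "P \<noteq> {} \<or> Q \<noteq> {}" for P Q
  proof -
    have P: "P \<subseteq> nb G v <+> nb G v" and Q: "Q \<subseteq> {v}"
      using cl by (auto simp: closed_part_def star_def)
    have 1: "Inl a \<in> P \<longleftrightarrow> v \<in> Q" "Inr a \<in> P \<longleftrightarrow> v \<in> Q" if "a \<in> nb G v" for a
      using cl that by (auto simp: closed_part_def star_def)
    have "v \<in> Q"
    proof (rule ccontr)
      assume "v \<notin> Q"
      then obtain p where "p \<in> P" using ne Q by auto
      then show False using P 1 \<open>v \<notin> Q\<close> by auto
    qed
    then show ?thesis using P Q 1 by auto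
  qed
  then have conn: "connected (star G v)"
    unfolding connected_iff[OF pregraph_diagram[OF S]]
    by (auto simp: star_def nonempty_def)
  have "nat_trans (star G v) G (star_emb G v)"
    using v graph_simps[OF G(1)] by (auto simp: nat_trans_def star_def star_emb_def nb_def)
  moreover have "\<exists>!d. d \<in> darcs (star G v) \<and> tgt (star G v) d = w \<and> onD (star_emb G v) d = d'"
    if "w \<in> verts (star G v)" "d' \<in> darcs G" "onV (star_emb G v) w = tgt G d'" for w d'
    using that by (intro ex1I[of _ "Inl d'"]) (auto simp: star_def star_emb_def nb_def)
  ultimately have "etale (star G v) G (star_emb G v)" by (auto simp: etale_def)
  then show ?thesis using S conn G by (auto simp: pre_embedding_def star_def star_emb_def)
qed

lemma star_class_data:
  fixes G :: "('a :: infinite, 'v) graph"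
  assumes G: "graph G" "connected G" and v: "v \<in> verts G"
  shows "emb_class G (star G v) (star_emb G v) \<in> Emb G"
    "emb_verts (emb_class G (star G v) (star_emb G v)) = {v}"
    "class_boundary (emb_class G (star G v) (star_emb G v)) = dag G ` nb G v"
proof -
  note d = emb_class_data[OF pre_embedding_star[OF assms]]
  show "emb_class G (star G v) (star_emb G v) \<in> Emb G" by (rule d(1))
  show "emb_verts (emb_class G (star G v) (star_emb G v)) = {v}"
    unfolding d(2) by (simp add: star_def star_emb_def)
  have "pre_boundary (star G v) = Inr ` nb G v"
    by (auto simp: pre_boundary_def star_def)
  then show "class_boundary (emb_class G (star G v) (star_emb G v)) = dag G ` nb G v"
    unfolding d(3) by (simp add: image_image) (rule image_cong, auto simp: star_emb_def)
qed

text \<open>The image is a closed part of \<open>G\<close>: an attached arc of \<open>G\<close> in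
  the image cannot come from the boundary of \<open>H\<close>, so its vertex is hit as well. For
  images of graphical maps this yields all vertices of the target when the map is active or its
  source has no boundary.\<close>

lemma pre_embedding_full_boundary:
  assumes f: "pre_embedding H G f" and sub: "onA f ` pre_boundary H \<subseteq> boundary G"
  shows "onV f ` verts H = verts G" "onA f ` pre_boundary H = boundary G"
proof -
  note H = pre_embedding_graphs[OF f]
  note Hs = pregraph_simps[OF H(1)] and Gs = graph_simps[OF H(3)] and fs = pre_embedding_simps[OF f]
  have "closed_part G (onA f ` arcs H) (onV f ` verts H)"
    unfolding closed_part_def
  proof (intro conjI ballI)
    show "onA f ` arcs H \<subseteq> arcs G" "onV f ` verts H \<subseteq> verts G" using fs(1,3) by auto
    have *: "dag G b \<in> onA f ` arcs H" if "b \<in> onA f ` arcs H" for b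
    proof -
      obtain a where "a \<in> arcs H" "b = onA f a" using \<open>b \<in> onA f ` arcs H\<close> by blast
      then show ?thesis using fs(4)[of a] Hs(1)[of a] by (metis imageI)
    qed
    then show "dag G b \<in> onA f ` arcs H \<longleftrightarrow> b \<in> onA f ` arcs H" if "b \<in> arcs G" for b
      using Gs(5)[OF that] by metis
    fix d assume d: "d \<in> darcs G"
    show "incl G d \<in> onA f ` arcs H \<longleftrightarrow> tgt G d \<in> onV f ` verts H"
    proof
      assume "incl G d \<in> onA f ` arcs H"
      then obtain a where a: "a \<in> arcs H" "d = onA f a" using Gs d by auto
      moreover have "a \<notin> pre_boundary H" using a sub d by (auto simp: boundary_def)
      ultimately obtain e where e: "e \<in> darcs H" "a = incl H e" using boundary_cases[of a H] by blast
      then have "tgt G d = onV f (tgt H e)" using a fs(5,6) by simp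
      then show "tgt G d \<in> onV f ` verts H" using Hs(3) e by simp
    next
      assume "tgt G d \<in> onV f ` verts H"
      then have "d \<in> onD f ` darcs H" using pre_embedding_onD_image[OF f] d by simp
      then obtain e where "e \<in> darcs H" "d = onD f e" by blast
      then show "incl G d \<in> onA f ` arcs H" using Gs(6)[OF d] fs(5)[of e] Hs(2)[of e] by (metis imageI)
    qed
  qed
  moreover have "onA f ` arcs H \<noteq> {} \<or> onV f ` verts H \<noteq> {}"
    using connected_arcs_verts[OF H(2) pregraph_diagram[OF H(1)]] by auto
  ultimately have A: "onA f ` arcs H = arcs G" and V: "onV f ` verts H = verts G"
    using connectedD[OF H(4) graph_diagram[OF H(3)]] by auto
  show "onV f ` verts H = verts G" by (rule V)
  have "a \<in> onA f ` pre_boundary H" if a: "a \<in> boundary G" for a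
  proof -
    obtain b where b: "b \<in> arcs H" "a = onA f b" using a A by (auto simp: boundary_def)
    from boundary_cases[OF b(1)] show ?thesis
    proof (elim disjE bexE)
      fix e assume "e \<in> darcs H" "b = incl H e"
      then show ?thesis using fs(2,5) a b by (simp add: boundary_def)
    qed (use b in simp)
  qed
  then show "onA f ` pre_boundary H = boundary G" using sub by auto
qed

section \<open>Images of graphical maps\<close>

definition gm_verts :: "('a, 'v) gmap \<Rightarrow> 'v \<Rightarrow> 'v set" where
  "gm_verts \<phi> v = emb_verts (gm1 \<phi> v)"

text \<open>Injectivity over all representatives becomes disjointness of vertex sets, because each
  representative is injective on vertices. In the bijection onto the class boundary, injectivity can
  be tested without the involutions, which are themselves injective.\<close>

lemma graphical_map_iff:
  fixes G G' :: "('a :: infinite, 'v) graph"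
  shows "graphical_map G G' \<phi> \<longleftrightarrow>
     graph G \<and> connected G \<and> graph G' \<and> connected G' \<and>
     gm0 \<phi> \<in> arcs G \<rightarrow>\<^sub>E arcs G' \<and> (\<forall>a\<in>arcs G. gm0 \<phi> (dag G a) = dag G' (gm0 \<phi> a)) \<and>
     gm1 \<phi> \<in> verts G \<rightarrow>\<^sub>E Emb G' \<and>
     (\<forall>v\<in>verts G. \<forall>u\<in>verts G. gm_verts \<phi> v \<inter> gm_verts \<phi> u \<noteq> {} \<longrightarrow> v = u) \<and>
     (\<forall>v\<in>verts G. inj_on (gm0 \<phi>) (nb G v) \<and> class_boundary (gm1 \<phi> v) = (\<lambda>a. gm0 \<phi> (dag G a)) ` nb G v) \<and>
     (boundary G = {} \<longrightarrow> (\<exists>v\<in>verts G. gm_verts \<phi> v \<noteq> {}))"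
    (is "_ \<longleftrightarrow> ?R")
proof -
  have nbA: "nb G v \<subseteq> arcs G" if "graph G" for v
    using graph_simps(2)[OF that] by (auto simp: nb_def)
  have inj: "inj_on (\<lambda>a. gm0 \<phi> (dag G a)) (nb G v) \<longleftrightarrow> inj_on (gm0 \<phi>) (nb G v)"
    if "graph G" "graph G'" "gm0 \<phi> \<in> arcs G \<rightarrow>\<^sub>E arcs G'" "\<forall>a\<in>arcs G. gm0 \<phi> (dag G a) = dag G' (gm0 \<phi> a)" for v
    unfolding inj_on_def
  proof (intro ball_cong refl)
    fix a b assume "a \<in> nb G v" "b \<in> nb G v"
    then have "a \<in> arcs G" "b \<in> arcs G" using nbA[OF that(1)] by auto
    then have "gm0 \<phi> a \<in> arcs G'" "gm0 \<phi> b \<in> arcs G'"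
      "gm0 \<phi> (dag G a) = dag G' (gm0 \<phi> a)" "gm0 \<phi> (dag G b) = dag G' (gm0 \<phi> b)"
      using that(3,4) by auto
    then show "(gm0 \<phi> (dag G a) = gm0 \<phi> (dag G b) \<longrightarrow> a = b) \<longleftrightarrow> (gm0 \<phi> a = gm0 \<phi> b \<longrightarrow> a = b)"
      using graph_simps(5)[OF that(2)] by metis
  qed
  have disj: "inj_on (\<lambda>(v, u). onV (rep_map (gm1 \<phi> v)) u) (SIGMA v:verts G. verts (rep_graph (gm1 \<phi> v))) \<longleftrightarrow>
    (\<forall>v\<in>verts G. \<forall>u\<in>verts G. gm_verts \<phi> v \<inter> gm_verts \<phi> u \<noteq> {} \<longrightarrow> v = u)" (is "?I \<longleftrightarrow> ?D")
    if E: "gm1 \<phi> \<in> verts G \<rightarrow>\<^sub>E Emb G'"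
  proof
    assume ?I
    show ?D
    proof (intro ballI impI)
      fix v u assume vu: "v \<in> verts G" "u \<in> verts G" "gm_verts \<phi> v \<inter> gm_verts \<phi> u \<noteq> {}"
      then obtain a b where "a \<in> verts (rep_graph (gm1 \<phi> v))" "b \<in> verts (rep_graph (gm1 \<phi> u))"
        "onV (rep_map (gm1 \<phi> v)) a = onV (rep_map (gm1 \<phi> u)) b"
        unfolding gm_verts_def emb_verts_def by blast
      then have "(v, a) = (u, b)" using vu by (intro inj_onD[OF \<open>?I\<close>]) auto
      then show "v = u" by simp
    qed
  next
    assume ?D
    show ?I
    proof (rule inj_onI, clarsimp)
      fix v a u b assume *: "v \<in> verts G" "a \<in> verts (rep_graph (gm1 \<phi> v))"
        "u \<in> verts G" "b \<in> verts (rep_graph (gm1 \<phi> u))"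
        "onV (rep_map (gm1 \<phi> v)) a = onV (rep_map (gm1 \<phi> u)) b"
      then have "onV (rep_map (gm1 \<phi> v)) a \<in> gm_verts \<phi> v \<inter> gm_verts \<phi> u"
        unfolding gm_verts_def emb_verts_def by (metis IntI imageI)
      then have "v = u" using \<open>?D\<close> * by blast
      moreover have "embedding (rep_graph (gm1 \<phi> v)) G' (rep_map (gm1 \<phi> v))"
        using * E by (auto intro: Emb_rep)
      ultimately show "v = u \<and> a = b"
        using * by (auto simp: embedding_def inj_on_def)
    qed
  qed
  have edge: "(\<exists>v\<in>verts G. \<not> is_edge_class (gm1 \<phi> v)) \<longleftrightarrow> (\<exists>v\<in>verts G. gm_verts \<phi> v \<noteq> {})"
    if E: "gm1 \<phi> \<in> verts G \<rightarrow>\<^sub>E Emb G'"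
    using E is_edge_class_iff by (intro bex_cong refl) (auto simp: gm_verts_def)
  show ?thesis
    unfolding graphical_map_def using disj edge inj by (simp add: bij_betw_def eq_commute cong: conj_cong)
qed

text \<open>A backward step followed by a forward path is undone by the first step of that path, so
  a zigzag ending where \<open>s\<close> stops can be straightened. This is used to show that a
  class of glued arcs has at most one end.\<close>

lemma single_valued_terminal_rtrancl:
  assumes sv: "single_valued s" and b: "b \<notin> Domain s" and ab: "(a, b) \<in> (s \<union> s\<inverse>)\<^sup>*"
  shows "(a, b) \<in> s\<^sup>*"
  using ab
proof (induction rule: converse_rtrancl_induct)
  case (step a c)
  then consider "(a, c) \<in> s" | "(c, a) \<in> s" by blast
  then show ?case
  proof cases
    case 2
    then obtain c' where "(c, c') \<in> s" "(c', b) \<in> s\<^sup>*"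
      using step b by (metis DomainI converse_rtranclE)
    then show ?thesis using 2 sv by (metis single_valuedD)
  qed (use step in \<open>simp add: converse_rtrancl_into_rtrancl\<close>)
qed simp

lemma single_valued_terminal_unique:
  assumes "single_valued s" "a \<notin> Domain s" "b \<notin> Domain s" "(a, b) \<in> (s \<union> s\<inverse>)\<^sup>*"
  shows "a = b"
  using single_valued_terminal_rtrancl[OF assms(1,3,4)] assms(2) by (metis DomainI converse_rtranclE)

lemma pregraph_coprod:
  assumes "finite I" "\<And>i. i \<in> I \<Longrightarrow> pregraph (X i)"
  shows "pregraph (coprod I X)"
proof -
  have "diagram (coprod I X)" using assms by (intro diagram_coprod) (auto simp: pregraph_def)
  moreover have "inj_on (incl (coprod I X)) (darcs (coprod I X))"
    using assms(2) by (auto simp: pregraph_def coprod_def inj_on_def)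
  moreover have "dag (coprod I X) p \<noteq> p \<and> dag (coprod I X) (dag (coprod I X) p) = p"
    if pA: "p \<in> arcs (coprod I X)" for p
  proof -
    obtain i a where p: "p = (i, a)" "i \<in> I" "a \<in> arcs (X i)"
      using pA by (auto simp: coprod_def)
    then show ?thesis using pregraph_simps(1,4,5)[OF assms(2)[OF p(2)] p(3)] by (simp add: coprod_def)
  qed
  ultimately show ?thesis by (auto simp: pregraph_def)
qed

lemma nat_trans_pick_arc:
  assumes "pregraph X" "a \<in> arcs X"
  shows "nat_trans exc_edge X (pick_arc X a)"
  using pregraph_simps[OF assms(1)] assms(2) by (auto simp: nat_trans_def exc_edge_def pick_arc_def)

lemma nat_trans_copair:
  assumes "\<And>i. i \<in> I \<Longrightarrow> diagram (X i)" "\<And>i. i \<in> I \<Longrightarrow> nat_trans (X i) Z (g i)"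
  shows "nat_trans (coprod I X) Z (copair I X g)"
  using coprod_universal[of I X Z g "copair I X g"] assms by blast

lemma gen_equiv_empty: "gen_equiv S {} = Id_on S"
  by (auto simp: gen_equiv_def)

section \<open>Ports and the glued diagram of a graphical map\<close>

locale graphical =
  fixes G G' :: "('a :: infinite, 'v) graph" and \<phi> :: "('a, 'v) gmap"
  assumes \<phi>: "graphical_map G G' \<phi>"
begin

lemma gm_graphs: "graph G" "connected G" "graph G'" "connected G'"
  using \<phi> by (auto simp: graphical_map_def)

lemma gm0_simps:
  "a \<in> arcs G \<Longrightarrow> gm0 \<phi> a \<in> arcs G'" "a \<in> arcs G \<Longrightarrow> gm0 \<phi> (dag G a) = dag G' (gm0 \<phi> a)"
  using \<phi> by (auto simp: graphical_map_def)

lemma gm1_Emb: "v \<in> verts G \<Longrightarrow> gm1 \<phi> v \<in> Emb G'"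
  using \<phi> by (auto simp: graphical_map_def)

lemma gm_rep: "v \<in> verts G \<Longrightarrow> embedding (rep_graph (gm1 \<phi> v)) G' (rep_map (gm1 \<phi> v))"
  using Emb_rep gm1_Emb by blast

lemma gm_disjoint:
  "v \<in> verts G \<Longrightarrow> u \<in> verts G \<Longrightarrow> w \<in> gm_verts \<phi> v \<Longrightarrow> w \<in> gm_verts \<phi> u \<Longrightarrow> v = u"
  using \<phi> unfolding graphical_map_iff by blast

lemma gm_inj_nb: "v \<in> verts G \<Longrightarrow> inj_on (gm0 \<phi>) (nb G v)"
  using \<phi> unfolding graphical_map_iff by blast

lemma gm_class_boundary:
  "v \<in> verts G \<Longrightarrow> class_boundary (gm1 \<phi> v) = (\<lambda>a. gm0 \<phi> (dag G a)) ` nb G v"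
  using \<phi> unfolding graphical_map_iff by blast

lemma gm_nonempty: "boundary G = {} \<Longrightarrow> \<exists>v\<in>verts G. gm_verts \<phi> v \<noteq> {}"
  using \<phi> unfolding graphical_map_iff by blast

lemma nb_arcs: "a \<in> nb G v \<Longrightarrow> a \<in> darcs G" "a \<in> nb G v \<Longrightarrow> a \<in> arcs G" "a \<in> nb G v \<Longrightarrow> tgt G a = v"
  using graph_simps(2)[OF gm_graphs(1)] by (auto simp: nb_def)

abbreviation "reps v \<equiv> rep_graph (gm1 \<phi> v)"
abbreviation "repm v \<equiv> rep_map (gm1 \<phi> v)"

lemma reps_facts:
  assumes "v \<in> verts G"
  shows "graph (reps v)" "pregraph (reps v)" "diagram (reps v)" "connected (reps v)"
    "pre_embedding (reps v) G' (repm v)" "nat_trans (reps v) G' (repm v)"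
  using gm_rep[OF assms] pre_embedding_graphs(5)[of "reps v" G' "repm v"]
  by (auto simp: embedding_pre graph_pregraph graph_diagram pre_embedding_def)

lemma port:
  assumes v: "v \<in> verts G" and a: "a \<in> nb G v"
  shows "port \<phi> v (dag G a) \<in> boundary (reps v)" "onA (repm v) (port \<phi> v (dag G a)) = gm0 \<phi> (dag G a)"
proof -
  have "gm0 \<phi> (dag G a) \<in> onA (repm v) ` boundary (reps v)"
    using gm_class_boundary[OF v] a by (auto simp: class_boundary_def)
  then show "port \<phi> v (dag G a) \<in> boundary (reps v)"
    "onA (repm v) (port \<phi> v (dag G a)) = gm0 \<phi> (dag G a)"
    by (simp_all add: port_def inv_into_into f_inv_into_f)
qed

lemma port_inj:
  assumes v: "v \<in> verts G" and "a \<in> nb G v" "b \<in> nb G v" "port \<phi> v (dag G a) = port \<phi> v (dag G b)"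
  shows "a = b"
proof -
  have "dag G' (gm0 \<phi> a) = dag G' (gm0 \<phi> b)"
    using port(2)[OF v] assms nb_arcs gm0_simps(2) by metis
  then have "gm0 \<phi> a = gm0 \<phi> b"
    using graph_simps(5)[OF gm_graphs(3)] gm0_simps(1) nb_arcs assms by metis
  then show ?thesis using inj_onD[OF gm_inj_nb[OF v]] assms by blast
qed

lemma port_surj:
  assumes v: "v \<in> verts G" and b: "b \<in> boundary (reps v)"
  obtains a where "a \<in> nb G v" "b = port \<phi> v (dag G a)"
proof -
  have "onA (repm v) b \<in> class_boundary (gm1 \<phi> v)" using b by (simp add: class_boundary_def)
  then obtain a where a: "a \<in> nb G v" "onA (repm v) b = gm0 \<phi> (dag G a)"
    using gm_class_boundary[OF v] by auto
  have "inj_on (onA (repm v)) (boundary (reps v))"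
    using pre_embedding_inj_boundary[OF reps_facts(5)[OF v]]
    by (simp add: graph_pre_boundary[OF reps_facts(1)[OF v]])
  then have "b = port \<phi> v (dag G a)"
    by (rule inj_onD) (use port[OF v a(1)] a b in auto)
  then show ?thesis using that a by blast
qed

abbreviation "C \<equiv> rep_coprod G \<phi>"

text \<open>Every internal edge contributes one pair for each of its two ends, so the ordering
  chosen by \<open>fst_arc\<close> disappears. Directed in this way, from a port to the involute of
  the opposite port, the relation is a partial injection.\<close>

definition glue_rel :: "(('v \<times> 'a) \<times> 'v \<times> 'a) set" where
  "glue_rel = {((tgt G x, port \<phi> (tgt G x) (dag G x)),
      dag C (tgt G (dag G x), port \<phi> (tgt G (dag G x)) x)) | x. x \<in> darcs G \<and> dag G x \<in> darcs G}"

abbreviation "R \<equiv> relA (edge_coprod G) C (glue1 G \<phi>) (glue2 G \<phi>)"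

lemma finite_verts: "finite (verts G)"
  using graph_diagram[OF gm_graphs(1)] by (simp add: diagram_def)

lemma C_pregraph: "pregraph C"
  using reps_facts(2) finite_verts by (intro pregraph_coprod) auto

lemma C_simps:
  "arcs C = (SIGMA v:verts G. arcs (reps v))" "darcs C = (SIGMA v:verts G. darcs (reps v))"
  "verts C = (SIGMA v:verts G. verts (reps v))"
  "v \<in> verts G \<Longrightarrow> b \<in> arcs (reps v) \<Longrightarrow> dag C (v, b) = (v, dag (reps v) b)"
  "v \<in> verts G \<Longrightarrow> d \<in> darcs (reps v) \<Longrightarrow> incl C (v, d) = (v, d)"
  "v \<in> verts G \<Longrightarrow> d \<in> darcs (reps v) \<Longrightarrow> tgt C (v, d) = (v, tgt (reps v) d)"
  using graph_simps(6)[OF reps_facts(1)] by (auto simp: coprod_def)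

lemma port_C:
  assumes "x \<in> darcs G"
  shows "(tgt G x, port \<phi> (tgt G x) (dag G x)) \<in> arcs C"
  using assms port(1)[of "tgt G x" x] graph_simps(3)[OF gm_graphs(1), of x]
  by (auto simp: C_simps nb_def boundary_def)

lemma port_C':
  assumes "x \<in> darcs G" "dag G x \<in> darcs G"
  shows "(tgt G (dag G x), port \<phi> (tgt G (dag G x)) x) \<in> arcs C"
  using port_C[OF assms(2)] graph_simps(2,5)[OF gm_graphs(1), of x] assms by simp

lemma internal_edge_arcs:
  assumes "e \<in> internal_edges G"
  defines "x \<equiv> fst_arc e"
  shows "x \<in> darcs G" "dag G x \<in> darcs G" "e = {x, dag G x}" "snd_arc G e = dag G x"
proof -
  obtain a where a: "e = {a, dag G a}" "a \<in> darcs G" "dag G a \<in> darcs G"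
    using assms(1) by (auto simp: internal_edges_def)
  have "x \<in> e" unfolding x_def fst_arc_def using a by (metis insertI1 someI_ex)
  then show "x \<in> darcs G" "dag G x \<in> darcs G" "e = {x, dag G x}"
    using a graph_simps(2,5)[OF gm_graphs(1)] by auto
  show "snd_arc G e = dag G x" by (simp add: snd_arc_def x_def)
qed

lemma finite_internal_edges: "finite (internal_edges G)"
proof (rule finite_subset)
  show "internal_edges G \<subseteq> (\<lambda>a. {a, dag G a}) ` darcs G" by (auto simp: internal_edges_def)
  show "finite ((\<lambda>a. {a, dag G a}) ` darcs G)"
    using graph_diagram[OF gm_graphs(1)] by (simp add: diagram_def)
qed

lemma edge_coprod_diagram: "diagram (edge_coprod G)"
  using finite_internal_edges pregraph_exc_edge by (intro diagram_coprod) (auto simp: pregraph_def)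

lemma nat_trans_glue:
  "nat_trans (edge_coprod G) C (glue1 G \<phi>)" "nat_trans (edge_coprod G) C (glue2 G \<phi>)"
  unfolding glue1_def glue2_def Let_def
proof -
  note * = internal_edge_arcs(1,2,4) port_C port_C' graph_simps(2,5)[OF gm_graphs(1)]
    pregraph_simps(1)[OF C_pregraph] pregraph_diagram[OF pregraph_exc_edge]
    nat_trans_pick_arc[OF C_pregraph]
  show "nat_trans (edge_coprod G) C (copair (internal_edges G) (\<lambda>_. exc_edge)
     (\<lambda>e. pick_arc C (tgt G (fst_arc e), port \<phi> (tgt G (fst_arc e)) (dag G (fst_arc e)))))"
    by (rule nat_trans_copair) (simp_all only: *)
  show "nat_trans (edge_coprod G) C (copair (internal_edges G) (\<lambda>_. exc_edge)
     (\<lambda>e. pick_arc C (dag C (tgt G (snd_arc G e), port \<phi> (tgt G (snd_arc G e)) (dag G (snd_arc G e))))))"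
    by (rule nat_trans_copair) (simp_all only: *)
qed

lemma onA_glue:
  assumes "e \<in> internal_edges G" defines "x \<equiv> fst_arc e"
  shows "onA (glue1 G \<phi>) (e, True) = (tgt G x, port \<phi> (tgt G x) (dag G x))"
    "onA (glue1 G \<phi>) (e, False) = dag C (tgt G x, port \<phi> (tgt G x) (dag G x))"
    "onA (glue2 G \<phi>) (e, True) = dag C (tgt G (dag G x), port \<phi> (tgt G (dag G x)) x)"
    "onA (glue2 G \<phi>) (e, False) = (tgt G (dag G x), port \<phi> (tgt G (dag G x)) x)"
  using assms(1) internal_edge_arcs[OF assms(1)] port_C'[of x] pregraph_simps(5)[OF C_pregraph]
    graph_simps(2,5)[OF gm_graphs(1)]
  by (simp_all add: glue1_def glue2_def copair_def exc_edge_def pick_arc_def Let_def x_def)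

text \<open>The index \<open>True\<close> contributes the pair of the chosen end and
  \<open>False\<close> that of the other end, reversed; the generated equivalence forgets
  directions.\<close>

lemma R_eq: "R = gen_equiv (arcs C) glue_rel"
proof -
  let ?r = "(\<lambda>a. (onA (glue1 G \<phi>) a, onA (glue2 G \<phi>) a)) ` arcs (edge_coprod G)"
  have 1: "(onA (glue1 G \<phi>) (e, b), onA (glue2 G \<phi>) (e, b)) \<in> glue_rel \<union> glue_rel\<inverse>"
    if e: "e \<in> internal_edges G" for e b
  proof -
    define x where "x = fst_arc e"
    have x: "x \<in> darcs G" "dag G x \<in> darcs G" "dag G (dag G x) = x"
      using internal_edge_arcs[OF e] graph_simps(2,5)[OF gm_graphs(1)] by (auto simp: x_def)
    show ?thesis
    proof (cases b)
      case True
      then show ?thesis using x onA_glue[OF e] by (auto simp: glue_rel_def x_def)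
    next
      case False
      have "(onA (glue2 G \<phi>) (e, b), onA (glue1 G \<phi>) (e, b)) \<in> glue_rel"
        using x False onA_glue[OF e] unfolding glue_rel_def mem_Collect_eq
        by (intro exI[of _ "dag G x"]) (simp add: x_def)
      then show ?thesis by simp
    qed
  qed
  have 2: "glue_rel \<subseteq> ?r \<union> ?r\<inverse>"
  proof
    fix p assume "p \<in> glue_rel"
    then obtain x where p: "p = ((tgt G x, port \<phi> (tgt G x) (dag G x)),
      dag C (tgt G (dag G x), port \<phi> (tgt G (dag G x)) x))" and x: "x \<in> darcs G" "dag G x \<in> darcs G"
      by (auto simp: glue_rel_def)
    define e where "e = {x, dag G x}"
    have e: "e \<in> internal_edges G" using x by (auto simp: e_def internal_edges_def)
    define y where "y = fst_arc e"
    have "y = x \<or> y = dag G x" using internal_edge_arcs(3)[OF e] by (auto simp: e_def y_def)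
    have eA: "(e, b) \<in> arcs (edge_coprod G)" for b using e by (simp add: coprod_def exc_edge_def)
    have xx: "dag G (dag G x) = x" using x graph_simps(2,5)[OF gm_graphs(1)] by simp
    from \<open>y = x \<or> y = dag G x\<close> show "p \<in> ?r \<union> ?r\<inverse>"
    proof
      assume "y = x"
      then have "p = (onA (glue1 G \<phi>) (e, True), onA (glue2 G \<phi>) (e, True))"
        using p onA_glue[OF e] by (simp add: y_def)
      then show ?thesis using eA by blast
    next
      assume "y = dag G x"
      then have "p = (onA (glue2 G \<phi>) (e, False), onA (glue1 G \<phi>) (e, False))"
        using p xx onA_glue[OF e] by (simp add: y_def)
      then show ?thesis using eA by blast
    qed
  qed
  have "?r \<subseteq> glue_rel \<union> glue_rel\<inverse>"
  proof (rule image_subsetI)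
    fix p assume "p \<in> arcs (edge_coprod G)"
    then obtain e b where "p = (e, b)" "e \<in> internal_edges G" by (cases p) (auto simp: coprod_def)
    then show "(onA (glue1 G \<phi>) p, onA (glue2 G \<phi>) p) \<in> glue_rel \<union> glue_rel\<inverse>" using 1 by simp
  qed
  then have "?r \<union> ?r\<inverse> = glue_rel \<union> glue_rel\<inverse>" using 2 by blast
  then show ?thesis by (simp add: relA_def gen_equiv_def)
qed

lemma relD_eq: "relD (edge_coprod G) C (glue1 G \<phi>) (glue2 G \<phi>) = Id_on (darcs C)"
proof -
  have "darcs (edge_coprod G) = {}" by (auto simp: coprod_def exc_edge_def)
  then show ?thesis by (simp add: relD_def gen_equiv_empty)
qed

lemma relV_eq: "relV (edge_coprod G) C (glue1 G \<phi>) (glue2 G \<phi>) = Id_on (verts C)"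
proof -
  have "verts (edge_coprod G) = {}" by (auto simp: coprod_def exc_edge_def)
  then show ?thesis by (simp add: relV_def gen_equiv_empty)
qed

lemma R_equiv: "equiv (arcs C) R"
  by (simp add: relA_def equiv_gen_equiv)

text \<open>Exceptional edges have neither attached arcs nor vertices, so only arcs get identified
  and the other classes are singletons.\<close>

lemma subst_carriers:
  "arcs (subst G \<phi>) = (\<lambda>b. R `` {b}) ` arcs C" "darcs (subst G \<phi>) = (\<lambda>d. {d}) ` darcs C"
  "verts (subst G \<phi>) = (\<lambda>w. {w}) ` verts C"
proof -
  have "Id_on S `` {x} = {x}" if "x \<in> S" for x and S :: "'x set" using that by auto
  then show "darcs (subst G \<phi>) = (\<lambda>d. {d}) ` darcs C" "verts (subst G \<phi>) = (\<lambda>w. {w}) ` verts C"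
    using coeq_carriers[OF pregraph_diagram[OF C_pregraph] nat_trans_glue]
    unfolding subst_def relD_eq relV_eq by (simp_all cong: image_cong_simp)
  show "arcs (subst G \<phi>) = (\<lambda>b. R `` {b}) ` arcs C"
    unfolding subst_def using coeq_carriers[OF pregraph_diagram[OF C_pregraph] nat_trans_glue] by simp
qed

lemma subst_class:
  "b \<in> arcs C \<Longrightarrow> dag (subst G \<phi>) (R `` {b}) = R `` {dag C b}"
  "d \<in> darcs C \<Longrightarrow> incl (subst G \<phi>) {d} = R `` {incl C d}"
  "d \<in> darcs C \<Longrightarrow> tgt (subst G \<phi>) {d} = {tgt C d}"
proof -
  have *: "Id_on S `` {x} = {x}" if "x \<in> S" for x and S :: "'x set" using that by auto
  note c = coeq_class[OF pregraph_diagram[OF C_pregraph] nat_trans_glue edge_coprod_diagram, folded subst_def,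
      unfolded relD_eq relV_eq]
  show "b \<in> arcs C \<Longrightarrow> dag (subst G \<phi>) (R `` {b}) = R `` {dag C b}" by (rule c(1))
  show "d \<in> darcs C \<Longrightarrow> incl (subst G \<phi>) {d} = R `` {incl C d}" using c(2)[of d] by (simp add: *)
  show "d \<in> darcs C \<Longrightarrow> tgt (subst G \<phi>) {d} = {tgt C d}"
    using c(3)[of d] pregraph_simps(3)[OF C_pregraph, of d] by (simp add: *)
qed

lemma subst_map_facts:
  shows "nat_trans (subst G \<phi>) G' (subst_map G \<phi>)"
    "(v, b) \<in> arcs C \<Longrightarrow> onA (subst_map G \<phi>) (R `` {(v, b)}) = onA (repm v) b"
    "(v, d) \<in> darcs C \<Longrightarrow> onD (subst_map G \<phi>) {(v, d)} = onD (repm v) d"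
    "(v, w) \<in> verts C \<Longrightarrow> onV (subst_map G \<phi>) {(v, w)} = onV (repm v) w"
proof -
  let ?k = "copair (verts G) reps repm"
  have k: "nat_trans C G' ?k"
    by (rule nat_trans_copair) (use reps_facts in auto)
  have kA: "onA ?k (v, b) = onA (repm v) b" if "(v, b) \<in> arcs C" for v b
    using that by (simp add: copair_def coprod_def)
  have eqs: "onA ?k (onA (glue1 G \<phi>) (e, b)) = onA ?k (onA (glue2 G \<phi>) (e, b))"
    if e: "e \<in> internal_edges G" for e b
  proof -
    define x where "x = fst_arc e"
    have x: "x \<in> darcs G" "dag G x \<in> darcs G" "dag G (dag G x) = x" "x \<in> arcs G"
      using internal_edge_arcs[OF e] graph_simps(2,5)[OF gm_graphs(1)] by (auto simp: x_def)
    have 1: "onA ?k (tgt G x, port \<phi> (tgt G x) (dag G x)) = gm0 \<phi> (dag G x)"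
      using kA[OF port_C[OF x(1)]] port(2)[of "tgt G x" x] x graph_simps(3)[OF gm_graphs(1)]
      by (simp add: nb_def)
    have 2: "onA ?k (tgt G (dag G x), port \<phi> (tgt G (dag G x)) x) = gm0 \<phi> x"
      using kA[OF port_C'[OF x(1,2)]] port(2)[of "tgt G (dag G x)" "dag G x"] x graph_simps(3)[OF gm_graphs(1)]
      by (simp add: nb_def)
    show ?thesis
      using onA_glue[OF e] 1 2 port_C[OF x(1)] port_C'[OF x(1,2)] nat_trans_simps(4)[OF k] gm0_simps[OF x(4)]
        graph_simps(5)[OF gm_graphs(3)]
      by (cases b) (simp_all add: x_def)
  qed
  have eq: "nt_comp (edge_coprod G) ?k (glue1 G \<phi>) = nt_comp (edge_coprod G) ?k (glue2 G \<phi>)"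
    using eqs by (auto simp: nt_comp_def compose_def coprod_def exc_edge_def fun_eq_iff restrict_def)
  have u: "nat_trans (subst G \<phi>) G' (subst_map G \<phi>) \<and>
    nt_comp C (subst_map G \<phi>) (coeq_proj (edge_coprod G) C (glue1 G \<phi>) (glue2 G \<phi>)) = ?k"
    unfolding subst_def subst_map_def
    using coeq_universal[OF pregraph_diagram[OF C_pregraph] nat_trans_glue edge_coprod_diagram k eq] by blast
  then show "nat_trans (subst G \<phi>) G' (subst_map G \<phi>)" by simp
  have *: "Id_on S `` {x} = {x}" if "x \<in> S" for x and S :: "'x set" using that by auto
  show "onA (subst_map G \<phi>) (R `` {(v, b)}) = onA (repm v) b" if "(v, b) \<in> arcs C"
    using that kA[OF that] arg_cong[OF conjunct2[OF u], of "\<lambda>g. onA g (v, b)"]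
    by (simp add: nt_comp_apply coeq_proj_def)
  show "onD (subst_map G \<phi>) {(v, d)} = onD (repm v) d" if "(v, d) \<in> darcs C"
    using that arg_cong[OF conjunct2[OF u], of "\<lambda>g. onD g (v, d)"]
    by (simp add: nt_comp_apply coeq_proj_def relD_eq * copair_def C_simps)
  show "onV (subst_map G \<phi>) {(v, d)} = onV (repm v) d" if "(v, d) \<in> verts C" for d
    using that arg_cong[OF conjunct2[OF u], of "\<lambda>g. onV g (v, d)"]
    by (simp add: nt_comp_apply coeq_proj_def relV_eq * copair_def C_simps)
qed

text \<open>Two facts are pulled back from \<open>G'\<close>. An arc fixed by the involution would
  have a fixed image. Attached arcs with the same underlying arc have the same image, so they belong
  to the same representative by disjointness and agree there.\<close>

lemma subst_pregraph: "pregraph (subst G \<phi>)"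
proof -
  let ?Q = "subst G \<phi>" and ?q = "subst_map G \<phi>"
  note qs = nat_trans_simps[OF subst_map_facts(1)]
  note Cs = pregraph_simps[OF C_pregraph]
  have d: "diagram ?Q"
    unfolding subst_def
    by (rule diagram_coeq[OF pregraph_diagram[OF C_pregraph] nat_trans_glue edge_coprod_diagram])
  have "inj_on (incl ?Q) (darcs ?Q)"
  proof (rule inj_onI)
    fix x y assume xy: "x \<in> darcs ?Q" "y \<in> darcs ?Q" "incl ?Q x = incl ?Q y"
    obtain v d where x: "x = {(v, d)}" "(v, d) \<in> darcs C" using xy(1) by (auto simp: subst_carriers)
    obtain u e where y: "y = {(u, e)}" "(u, e) \<in> darcs C" using xy(2) by (auto simp: subst_carriers)
    have v: "v \<in> verts G" "d \<in> darcs (reps v)" and u: "u \<in> verts G" "e \<in> darcs (reps u)"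
      using x y by (auto simp: C_simps)
    note fv = reps_facts(5)[OF v(1)] and fu = reps_facts(5)[OF u(1)]
    have "incl G' (onD ?q x) = incl G' (onD ?q y)" using qs(5)[OF xy(1)] qs(5)[OF xy(2)] xy(3) by simp
    then have eq: "onD (repm v) d = onD (repm u) e"
      using qs(2)[OF xy(1)] qs(2)[OF xy(2)] graph_simps(6)[OF gm_graphs(3)] x y subst_map_facts(3) by simp
    have "tgt G' (onD (repm v) d) \<in> gm_verts \<phi> v" "tgt G' (onD (repm u) e) \<in> gm_verts \<phi> u"
      using v u pre_embedding_simps(6)[OF fv] pre_embedding_simps(6)[OF fu]
        graph_simps(3)[OF reps_facts(1)]
      by (auto simp: gm_verts_def emb_verts_def intro!: rev_image_eqI)
    then have "v = u" using gm_disjoint v u eq by simp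
    then have "d = e" using eq pre_embedding_inj_D[OF fv] v u by simp
    then show "x = y" using \<open>v = u\<close> x y by simp
  qed
  moreover have "dag ?Q x \<noteq> x \<and> dag ?Q (dag ?Q x) = x" if x: "x \<in> arcs ?Q" for x
  proof
    show "dag ?Q x \<noteq> x"
      using qs(1)[OF x] qs(4)[OF x] graph_simps(4)[OF gm_graphs(3)] by metis
    obtain b where "b \<in> arcs C" "x = R `` {b}" using x by (auto simp: subst_carriers)
    then show "dag ?Q (dag ?Q x) = x" using subst_class(1) Cs(1,5) by simp
  qed
  ultimately show ?thesis using d by (auto simp: pregraph_def)
qed

lemma R_refl: "b \<in> arcs C \<Longrightarrow> (b, b) \<in> R"
  using R_equiv by (auto simp: equiv_def refl_on_def)

lemma R_class_eq: "b \<in> arcs C \<Longrightarrow> c \<in> arcs C \<Longrightarrow> R `` {b} = R `` {c} \<longleftrightarrow> (b, c) \<in> R"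
  using eq_equiv_class_iff[OF R_equiv] by blast

lemma glue_rel_arcs:
  assumes "(p, q) \<in> glue_rel" shows "p \<in> arcs C" "q \<in> arcs C"
  using assms port_C port_C' pregraph_simps(1)[OF C_pregraph] by (auto simp: glue_rel_def)

lemma glue_rel_R: "(p, q) \<in> glue_rel \<Longrightarrow> (p, q) \<in> R"
  using glue_rel_arcs by (auto simp: R_eq gen_equiv_def)

lemma glue_class:
  assumes "x \<in> darcs G" "dag G x \<in> darcs G"
  shows "R `` {(tgt G x, port \<phi> (tgt G x) (dag G x))} =
    R `` {dag C (tgt G (dag G x), port \<phi> (tgt G (dag G x)) x)}"
  by (rule equiv_class_eq[OF R_equiv], rule glue_rel_R) (use assms in \<open>auto simp: glue_rel_def\<close>)

text \<open>Representatives are connected, so a closed part of the glued diagram contains each of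
  them entirely or not at all. Gluing carries membership across internal edges, so the vertices
  whose representative is contained belong to a closed part of \<open>G\<close>.\<close>

lemma subst_connected:
  assumes ne: "verts G \<noteq> {}"
  shows "connected (subst G \<phi>)"
proof -
  let ?Q = "subst G \<phi>"
  note Cs = pregraph_simps[OF C_pregraph] and Gs = graph_simps[OF gm_graphs(1)]
  have rne: "arcs (reps v) \<noteq> {} \<or> verts (reps v) \<noteq> {}" if "v \<in> verts G" for v
    using connected_arcs_verts[OF reps_facts(4,3)[OF that]] .
  obtain v0 where "v0 \<in> verts G" using ne by auto
  then have "arcs C \<noteq> {} \<or> verts C \<noteq> {}" using rne[of v0] by (auto simp: C_simps)
  then have "nonempty ?Q" by (auto simp: nonempty_def subst_carriers)
  moreover have "P = arcs ?Q \<and> W = verts ?Q" if cl: "closed_part ?Q P W" and PW: "P \<noteq> {} \<or> W \<noteq> {}" for P W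
  proof -
    have P: "P \<subseteq> arcs ?Q" and W: "W \<subseteq> verts ?Q" using cl by (auto simp: closed_part_def)
    define Pv where "Pv v = {b \<in> arcs (reps v). R `` {(v, b)} \<in> P}" for v
    define Wv where "Wv v = {w \<in> verts (reps v). {(v, w)} \<in> W}" for v
    define I where "I v \<longleftrightarrow> Pv v \<noteq> {} \<or> Wv v \<noteq> {}" for v
    have all: "Pv v = arcs (reps v) \<and> Wv v = verts (reps v)" if v: "v \<in> verts G" "I v" for v
    proof -
      note Hs = graph_simps[OF reps_facts(1)[OF v(1)]]
      have "closed_part (reps v) (Pv v) (Wv v)"
        unfolding closed_part_def
      proof (intro conjI ballI)
        fix b assume b: "b \<in> arcs (reps v)"
        then have bC: "(v, b) \<in> arcs C" using v by (simp add: C_simps)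
        then have "R `` {(v, b)} \<in> arcs ?Q" by (simp add: subst_carriers)
        then have "dag ?Q (R `` {(v, b)}) \<in> P \<longleftrightarrow> R `` {(v, b)} \<in> P"
          using cl by (simp add: closed_part_def)
        then have "R `` {(v, dag (reps v) b)} \<in> P \<longleftrightarrow> R `` {(v, b)} \<in> P"
          using subst_class(1)[OF bC] v b by (simp only: C_simps)
        then show "dag (reps v) b \<in> Pv v \<longleftrightarrow> b \<in> Pv v" using b Hs by (simp add: Pv_def)
      next
        fix d assume d: "d \<in> darcs (reps v)"
        then have dC: "(v, d) \<in> darcs C" using v by (simp add: C_simps)
        then have "{(v, d)} \<in> darcs ?Q" by (simp add: subst_carriers)
        then have "incl ?Q {(v, d)} \<in> P \<longleftrightarrow> tgt ?Q {(v, d)} \<in> W"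
          using cl by (simp add: closed_part_def)
        then have "R `` {(v, d)} \<in> P \<longleftrightarrow> {(v, tgt (reps v) d)} \<in> W"
          using subst_class(2,3)[OF dC] v d by (simp only: C_simps)
        then show "incl (reps v) d \<in> Pv v \<longleftrightarrow> tgt (reps v) d \<in> Wv v"
          using d Hs by (simp add: Pv_def Wv_def)
      qed (auto simp: Pv_def Wv_def)
      then show ?thesis
        using connectedD[OF reps_facts(4,3)[OF v(1)]] v(2) by (auto simp: I_def)
    qed
    have adj: "I (tgt G (dag G x))" if x: "x \<in> darcs G" "dag G x \<in> darcs G" "I (tgt G x)" for x
    proof -
      let ?v = "tgt G x" and ?u = "tgt G (dag G x)"
      have v: "?v \<in> verts G" "?u \<in> verts G" using Gs x by auto
      have "port \<phi> ?v (dag G x) \<in> arcs (reps ?v)" using port_C[OF x(1)] by (simp add: C_simps)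
      then have "R `` {(?v, port \<phi> ?v (dag G x))} \<in> P" using all[OF v(1) x(3)] by (auto simp: Pv_def)
      moreover have pu: "(?u, port \<phi> ?u x) \<in> arcs C" by (rule port_C'[OF x(1,2)])
      then have "R `` {(?u, port \<phi> ?u x)} \<in> arcs ?Q" by (simp add: subst_carriers)
      then have "dag ?Q (R `` {(?u, port \<phi> ?u x)}) \<in> P \<longleftrightarrow> R `` {(?u, port \<phi> ?u x)} \<in> P"
        using cl by (simp add: closed_part_def)
      ultimately have "R `` {(?u, port \<phi> ?u x)} \<in> P"
        using glue_class[OF x(1,2)] subst_class(1)[OF pu] by simp
      then show ?thesis using pu by (auto simp: I_def Pv_def C_simps)
    qed
    \<comment> \<open>The arcs of edges with an end at a vertex satisfying \<open>I\<close>; by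
      \<open>adj\<close> both ends of an internal edge give the same answer.\<close>
    define P0 where "P0 = {x \<in> arcs G. (x \<in> darcs G \<and> I (tgt G x)) \<or> (dag G x \<in> darcs G \<and> I (tgt G (dag G x)))}"
    define V0 where "V0 = {v \<in> verts G. I v}"
    have "closed_part G P0 V0"
      unfolding closed_part_def
    proof (intro conjI ballI)
      show "dag G a \<in> P0 \<longleftrightarrow> a \<in> P0" if "a \<in> arcs G" for a
        using that Gs by (auto simp: P0_def)
      show "incl G d \<in> P0 \<longleftrightarrow> tgt G d \<in> V0" if d: "d \<in> darcs G" for d
        using d Gs adj[of "dag G d"] by (auto simp: P0_def V0_def)
    qed (auto simp: P0_def V0_def)
    moreover have "V0 \<noteq> {}"
    proof (cases "P = {}")
      case False
      then obtain c where c: "c \<in> P" by auto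
      then obtain p where "p \<in> arcs C" "R `` {p} \<in> P" using P by (auto simp: subst_carriers)
      then obtain v b where "(v, b) \<in> arcs C" "R `` {(v, b)} \<in> P" by (cases p) auto
      then show ?thesis by (auto simp: V0_def I_def Pv_def C_simps)
    next
      case True
      then obtain c where c: "c \<in> W" using PW by auto
      then obtain v w where "(v, w) \<in> verts C" "{(v, w)} \<in> W"
        using W by (auto simp: subst_carriers)
      then show ?thesis by (auto simp: V0_def I_def Wv_def C_simps)
    qed
    ultimately have V0: "V0 = verts G"
      using connectedD[OF gm_graphs(2) graph_diagram[OF gm_graphs(1)]] by blast
    have "arcs ?Q \<subseteq> P"
      using all V0 by (auto simp: subst_carriers C_simps V0_def Pv_def)
    moreover have "verts ?Q \<subseteq> W"
      using all V0 by (auto simp: subst_carriers C_simps V0_def Wv_def)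
    ultimately show ?thesis using P W by auto
  qed
  ultimately show ?thesis
    unfolding connected_iff[OF pregraph_diagram[OF subst_pregraph]] by blast
qed

text \<open>Gluing identifies no vertices and no attached arcs. The pullback condition is therefore
  inherited from the representatives, and injectivity on vertices combines that of the
  representatives with their disjointness.\<close>

lemma subst_pre_embedding:
  assumes ne: "verts G \<noteq> {}"
  shows "pre_embedding (subst G \<phi>) G' (subst_map G \<phi>)"
proof -
  let ?Q = "subst G \<phi>" and ?q = "subst_map G \<phi>"
  have "inj_on (onV ?q) (verts ?Q)"
  proof (rule inj_onI)
    fix x y assume xy: "x \<in> verts ?Q" "y \<in> verts ?Q" "onV ?q x = onV ?q y"
    obtain v d where x: "x = {(v, d)}" "(v, d) \<in> verts C" using xy(1) by (auto simp: subst_carriers)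
    obtain u e where y: "y = {(u, e)}" "(u, e) \<in> verts C" using xy(2) by (auto simp: subst_carriers)
    have v: "v \<in> verts G" "d \<in> verts (reps v)" and u: "u \<in> verts G" "e \<in> verts (reps u)"
      using x y by (auto simp: C_simps)
    have eq: "onV (repm v) d = onV (repm u) e" using x y xy subst_map_facts(4) by simp
    have "onV (repm v) d \<in> gm_verts \<phi> v" "onV (repm u) e \<in> gm_verts \<phi> u"
      using v u by (auto simp: gm_verts_def emb_verts_def)
    then have "v = u" using gm_disjoint v u eq by simp
    then show "x = y" using eq pre_embedding_inj_V[OF reps_facts(5)[OF v(1)]] v u x y by simp
  qed
  moreover have "\<exists>!d. d \<in> darcs ?Q \<and> tgt ?Q d = x \<and> onD ?q d = d'"
    if x: "x \<in> verts ?Q" and d': "d' \<in> darcs G'" "onV ?q x = tgt G' d'" for x d'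
  proof -
    obtain v w where vw: "x = {(v, w)}" "(v, w) \<in> verts C" using x by (auto simp: subst_carriers)
    have v: "v \<in> verts G" "w \<in> verts (reps v)" using vw by (auto simp: C_simps)
    note fv = reps_facts(5)[OF v(1)]
    have "tgt G' d' = onV (repm v) w" using d' vw subst_map_facts(4) by simp
    then obtain d where d: "d \<in> darcs (reps v)" "tgt (reps v) d = w" "onD (repm v) d = d'"
      using pre_embedding_lift_D[OF fv v(2) d'(1)] by blast
    have dC: "(v, d) \<in> darcs C" using d v by (simp add: C_simps)
    show ?thesis
    proof (intro ex1I[of _ "{(v, d)}"] conjI)
      show "{(v, d)} \<in> darcs ?Q" using dC by (simp add: subst_carriers)
      show "tgt ?Q {(v, d)} = x" using subst_class(3)[OF dC] d v vw by (simp add: C_simps)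
      show "onD ?q {(v, d)} = d'" using subst_map_facts(3)[OF dC] d by simp
      fix y assume y: "y \<in> darcs ?Q \<and> tgt ?Q y = x \<and> onD ?q y = d'"
      then obtain u e where ue: "y = {(u, e)}" "(u, e) \<in> darcs C" by (auto simp: subst_carriers)
      then have "{tgt C (u, e)} = {(v, w)}" using y subst_class(3)[OF ue(2)] vw by simp
      then have "u = v" "e \<in> darcs (reps v)" using ue by (auto simp: C_simps)
      moreover have "onD (repm v) e = d'" using y ue subst_map_facts(3)[OF ue(2)] \<open>u = v\<close> by simp
      ultimately show "y = {(v, d)}" using ue d pre_embedding_inj_D[OF fv, of e d] by simp
    qed
  qed
  then have "etale ?Q G' ?q" using subst_map_facts(1) unfolding etale_def by blast
  ultimately show ?thesis
    using subst_pregraph subst_connected[OF ne] gm_graphs by (auto simp: pre_embedding_def)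
qed

section \<open>Vertices and boundary of the glued diagram\<close>

lemma subst_verts: "onV (subst_map G \<phi>) ` verts (subst G \<phi>) = (\<Union>v\<in>verts G. gm_verts \<phi> v)"
proof -
  have "onV (subst_map G \<phi>) ` verts (subst G \<phi>) = (\<lambda>(v, w). onV (repm v) w) ` verts C"
    unfolding subst_carriers image_image by (rule image_cong) (auto simp: subst_map_facts(4))
  also have "\<dots> = (\<Union>v\<in>verts G. gm_verts \<phi> v)"
    by (force simp: C_simps gm_verts_def emb_verts_def)
  finally show ?thesis .
qed

text \<open>Gluing is a partial injection, so a class of glued arcs contains at most one arc at which it is
  undefined: either an arc with a vertex, or the copy of a boundary arc of \<open>G\<close>.\<close>

lemma glue_rel_single_valued: "single_valued glue_rel" "single_valued (glue_rel\<inverse>)"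
proof -
  note Gs = graph_simps[OF gm_graphs(1)]
  have eq: "x = y" if "x \<in> darcs G" "y \<in> darcs G" "tgt G x = tgt G y"
    "port \<phi> (tgt G x) (dag G x) = port \<phi> (tgt G y) (dag G y)" for x y
    using port_inj[of "tgt G x" x y] that Gs by (auto simp: nb_def)
  show "single_valued glue_rel"
    unfolding single_valued_def glue_rel_def using eq by blast
  show "single_valued (glue_rel\<inverse>)"
  proof (rule single_valuedI, unfold converse_iff)
    fix p q r assume "(q, p) \<in> glue_rel" "(r, p) \<in> glue_rel"
    then obtain x y where xy: "x \<in> darcs G" "dag G x \<in> darcs G" "y \<in> darcs G" "dag G y \<in> darcs G"
      and q: "q = (tgt G x, port \<phi> (tgt G x) (dag G x))" and r: "r = (tgt G y, port \<phi> (tgt G y) (dag G y))"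
      and p: "p = dag C (tgt G (dag G x), port \<phi> (tgt G (dag G x)) x)"
        "p = dag C (tgt G (dag G y), port \<phi> (tgt G (dag G y)) y)"
      unfolding glue_rel_def by blast
    have "(tgt G (dag G x), port \<phi> (tgt G (dag G x)) x) = (tgt G (dag G y), port \<phi> (tgt G (dag G y)) y)"
      using p port_C'[OF xy(1,2)] port_C'[OF xy(3,4)] pregraph_simps(5)[OF C_pregraph] by metis
    then have "dag G x = dag G y" using eq[of "dag G x" "dag G y"] xy Gs(2,5) by (metis prod.inject)
    then have "x = y" using xy Gs by metis
    then show "q = r" using q r by simp
  qed
qed

lemma glue_rel_DomainE:
  assumes "p \<in> Domain glue_rel"
  obtains x where "x \<in> darcs G" "dag G x \<in> darcs G" "p = (tgt G x, port \<phi> (tgt G x) (dag G x))"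
    "(p, dag C (tgt G (dag G x), port \<phi> (tgt G (dag G x)) x)) \<in> glue_rel"
  using assms unfolding glue_rel_def by blast

text \<open>Gluing is defined only at ports, which are boundary arcs of representatives.\<close>

lemma darcs_terminal:
  assumes "d \<in> darcs C" shows "d \<notin> Domain glue_rel"
proof
  assume "d \<in> Domain glue_rel"
  then obtain x where x: "x \<in> darcs G" "d = (tgt G x, port \<phi> (tgt G x) (dag G x))"
    by (rule glue_rel_DomainE)
  then show False
    using assms port(1)[of "tgt G x" x] graph_simps(3)[OF gm_graphs(1) x(1)]
    by (simp add: C_simps nb_def boundary_def)
qed

text \<open>The copy in the representatives of a boundary arc \<open>x\<close> of \<open>G\<close>:
  its involute is attached to some vertex, and this is the port of that end.\<close>

abbreviation "outer x \<equiv> (tgt G (dag G x), port \<phi> (tgt G (dag G x)) x)"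

lemma outer:
  assumes "x \<in> boundary G" "verts G \<noteq> {}"
  shows "x \<in> arcs G" "dag G x \<in> darcs G" "dag G x \<in> nb G (tgt G (dag G x))" "tgt G (dag G x) \<in> verts G"
    "outer x \<in> arcs C" "outer x \<notin> Domain glue_rel" "outer x \<notin> darcs C"
    "onA (subst_map G \<phi>) (R `` {outer x}) = gm0 \<phi> x"
proof -
  note Gs = graph_simps[OF gm_graphs(1)]
  show d: "dag G x \<in> darcs G" and x: "x \<in> arcs G"
    using graph_dag_boundary[OF gm_graphs(1,2) assms(2,1)] .
  then show nb: "dag G x \<in> nb G (tgt G (dag G x))" by (simp add: nb_def)
  show v: "tgt G (dag G x) \<in> verts G" using Gs d by simp
  have xx: "dag G (dag G x) = x" using Gs x by simp
  have p: "port \<phi> (tgt G (dag G x)) x \<in> boundary (reps (tgt G (dag G x)))"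
    "onA (repm (tgt G (dag G x))) (port \<phi> (tgt G (dag G x)) x) = gm0 \<phi> x"
    using port[OF v nb] xx by auto
  show C: "outer x \<in> arcs C" using p v by (simp add: C_simps boundary_def)
  show "outer x \<notin> darcs C" using p v by (simp add: C_simps boundary_def)
  show "onA (subst_map G \<phi>) (R `` {outer x}) = gm0 \<phi> x" using subst_map_facts(2)[OF C] p by simp
  \<comment> \<open>If gluing were defined at this port, then \<open>x\<close> itself would be
    attached to a vertex.\<close>
  show "outer x \<notin> Domain glue_rel"
  proof
    assume "outer x \<in> Domain glue_rel"
    then obtain y where y: "y \<in> darcs G" "dag G y \<in> darcs G" "tgt G (dag G x) = tgt G y"
      "port \<phi> (tgt G (dag G x)) x = port \<phi> (tgt G y) (dag G y)"
      by (auto elim!: glue_rel_DomainE)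
    then have "dag G x = y" using port_inj[OF v nb, of y] xx by (simp add: nb_def)
    then show False using y xx assms by (simp add: boundary_def)
  qed
qed

lemma terminal_class_eq:
  assumes "p \<in> arcs C" "q \<in> arcs C" "p \<notin> Domain glue_rel" "q \<notin> Domain glue_rel" "R `` {p} = R `` {q}"
  shows "p = q"
proof (rule single_valued_terminal_unique[OF glue_rel_single_valued(1) assms(3,4)])
  show "(p, q) \<in> (glue_rel \<union> glue_rel\<inverse>)\<^sup>*"
    using R_class_eq[OF assms(1,2)] assms(5) by (auto simp: R_eq gen_equiv_def)
qed

text \<open>An attached arc in the class would be a second arc at which gluing stops.\<close>

lemma outer_boundary:
  assumes "x \<in> boundary G" "verts G \<noteq> {}"
  shows "R `` {outer x} \<in> pre_boundary (subst G \<phi>)"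
proof -
  note o = outer[OF assms]
  have "R `` {outer x} \<noteq> incl (subst G \<phi>) {(v, d)}" if vd: "(v, d) \<in> darcs C" for v d
  proof
    assume "R `` {outer x} = incl (subst G \<phi>) {(v, d)}"
    then have "R `` {outer x} = R `` {(v, d)}" using subst_class(2)[OF vd] vd by (simp add: C_simps)
    moreover have "(v, d) \<in> arcs C" using vd pregraph_simps(2)[OF C_pregraph vd] by (simp add: C_simps)
    ultimately have "outer x = (v, d)"
      using terminal_class_eq[OF o(5) _ o(6) darcs_terminal[OF vd]] by blast
    then show False using o(7) vd by metis
  qed
  then show ?thesis using o(5) by (auto simp: pre_boundary_def subst_carriers)
qed

text \<open>A class without such an arc would be permuted by gluing. It would run around a cycle of vertices
  that are all sent to edges; by connectedness this cycle would be the whole of \<open>G\<close>, which is what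
  the last condition on graphical maps forbids.\<close>

lemma boundary_class_outer:
  assumes ne: "verts G \<noteq> {}" and c: "c \<in> pre_boundary (subst G \<phi>)"
  shows "\<exists>x\<in>boundary G. c = R `` {outer x}"
proof (rule ccontr)
  note Gs = graph_simps[OF gm_graphs(1)]
  assume no: "\<not> (\<exists>x\<in>boundary G. c = R `` {outer x})"
  obtain p0 where p0: "p0 \<in> arcs C" "c = R `` {p0}"
    using c by (auto simp: pre_boundary_def subst_carriers)
  have cC: "c \<subseteq> arcs C" using p0 by (auto simp: R_eq gen_equiv_def)
  have cR: "c = R `` {p}" if "p \<in> c" for p
    using that p0 equiv_class_eq[OF R_equiv, of p0 p] by auto
  have "p0 \<in> c" using p0 R_refl by auto
  \<comment> \<open>Gluing could stop only at an attached arc, contrary to the choice of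
    \<open>c\<close>, or at the port of a boundary arc of \<open>G\<close>, which \<open>no\<close>
    excludes.\<close>
  have dom: "p \<in> Domain glue_rel" if p: "p \<in> c" for p
  proof -
    obtain v b where vb: "p = (v, b)" by (cases p)
    then have v: "v \<in> verts G" "b \<in> arcs (reps v)" using cC p by (auto simp: C_simps)
    have "b \<notin> darcs (reps v)"
    proof
      assume b: "b \<in> darcs (reps v)"
      then have "(v, b) \<in> darcs C" using v by (simp add: C_simps)
      then have "c = incl (subst G \<phi>) {(v, b)}" "{(v, b)} \<in> darcs (subst G \<phi>)"
        using subst_class(2)[of "(v, b)"] cR[OF p] vb v b by (simp_all add: C_simps subst_carriers)
      then show False using c by (auto simp: pre_boundary_def)
    qed
    then obtain a where a: "a \<in> nb G v" "b = port \<phi> v (dag G a)"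
      using port_surj[OF v(1)] v by (auto simp: boundary_def)
    have aA: "a \<in> darcs G" "tgt G a = v" "dag G a \<in> arcs G" "dag G (dag G a) = a"
      using a Gs by (auto simp: nb_def)
    have "dag G a \<in> darcs G"
    proof (rule ccontr)
      assume "dag G a \<notin> darcs G"
      then have "dag G a \<in> boundary G" using aA by (simp add: boundary_def)
      moreover have "c = R `` {outer (dag G a)}" using cR[OF p] aA a vb by simp
      ultimately show False using no by blast
    qed
    then show ?thesis using aA a vb unfolding glue_rel_def by blast
  qed
  define \<sigma> where "\<sigma> p = (THE q. (p, q) \<in> glue_rel)" for p
  have \<sigma>: "(p, \<sigma> p) \<in> glue_rel" if p: "p \<in> c" for p
  proof -
    obtain q where q: "(p, q) \<in> glue_rel" using dom[OF p] by blast
    moreover have "\<sigma> p = q"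
      unfolding \<sigma>_def using q single_valuedD[OF glue_rel_single_valued(1)] by blast
    ultimately show ?thesis by simp
  qed
  have \<sigma>c: "\<sigma> p \<in> c" if "p \<in> c" for p
    using cR[OF that] glue_rel_R[OF \<sigma>[OF that]] by simp
  have "finite c"
    using cC pregraph_diagram[OF C_pregraph] by (auto simp: diagram_def intro: finite_subset)
  moreover have "inj_on \<sigma> c"
    using \<sigma> single_valuedD[OF glue_rel_single_valued(2)] by (metis converse_iff inj_onI)
  \<comment> \<open>An injection of a finite set into itself is onto, so every arc of the class has
    a predecessor as well as a successor.\<close>
  ultimately have surj: "\<sigma> ` c = c"
    using \<sigma>c by (intro endo_inj_surj) auto
  define V0 where "V0 = fst ` c"
  define P0 where "P0 = {x \<in> darcs G. tgt G x \<in> V0}"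
  \<comment> \<open>The arc \<open>b\<close> is a port and, coming from a predecessor, also the
    involute of a port. Hence the representative is a single edge, and \<open>v\<close> is bivalent
    with both neighbours on the cycle.\<close>
  have key: "verts (reps v) = {}" "nb G v = {y, dag G x}"
    "y \<in> darcs G" "dag G y \<in> darcs G" "tgt G (dag G y) \<in> V0"
    "x \<in> darcs G" "dag G x \<in> darcs G" "tgt G x \<in> V0"
    if "(v, b) \<in> c" "(v, b) = (tgt G y, port \<phi> (tgt G y) (dag G y))" "y \<in> darcs G" "dag G y \<in> darcs G"
      "(v, b) = dag C (tgt G (dag G x), port \<phi> (tgt G (dag G x)) x)" "x \<in> darcs G" "dag G x \<in> darcs G"
      "tgt G (dag G y) \<in> V0" "tgt G x \<in> V0" for v b x y
  proof -
    have xx: "dag G (dag G x) = x" using that Gs by simp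
    have v: "v \<in> verts G" "tgt G y = v" using that Gs by auto
    note Hs = graph_simps[OF reps_facts(1)[OF v(1)]]
    have p': "(tgt G (dag G x), port \<phi> (tgt G (dag G x)) x) \<in> arcs C"
      by (rule port_C') fact+
    then have tx: "tgt G (dag G x) = v" and b: "b = dag (reps v) (port \<phi> v x)"
      using that(5) by (auto simp: C_simps)
    have nbx: "dag G x \<in> nb G v" "y \<in> nb G v" using tx that v by (auto simp: nb_def)
    have px: "port \<phi> v x \<in> boundary (reps v)" using port(1)[OF v(1) nbx(1)] xx by simp
    have py: "port \<phi> v (dag G y) \<in> boundary (reps v)" by (rule port(1)[OF v(1) nbx(2)])
    have bp: "b = port \<phi> v (dag G y)" using that v by simp
    have "b \<in> pre_boundary (reps v)" "dag (reps v) b = port \<phi> v x" "port \<phi> v x \<in> pre_boundary (reps v)"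
      using px py b bp Hs graph_pre_boundary[OF reps_facts(1)[OF v(1)]]
      by (auto simp: boundary_def)
    then have pair: "arcs (reps v) = {b, port \<phi> v x}" "verts (reps v) = {}"
      using connected_boundary_pair[OF reps_facts(4,2)[OF v(1)], of b] by auto
    show "verts (reps v) = {}" by (rule pair)
    have "a = y \<or> a = dag G x" if a: "a \<in> nb G v" for a
    proof -
      have "port \<phi> v (dag G a) \<in> {b, port \<phi> v x}"
        using port(1)[OF v(1) a] pair by (auto simp: boundary_def)
      then show ?thesis
        using port_inj[OF v(1) a nbx(1)] port_inj[OF v(1) a nbx(2)] bp xx by auto
    qed
    then show "nb G v = {y, dag G x}" using nbx by auto
  qed (use that in auto)
  have key': "\<exists>x y. verts (reps v) = {} \<and> nb G v = {y, dag G x} \<and>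
      y \<in> darcs G \<and> dag G y \<in> darcs G \<and> tgt G (dag G y) \<in> V0 \<and>
      x \<in> darcs G \<and> dag G x \<in> darcs G \<and> tgt G x \<in> V0" if v: "v \<in> V0" for v
  proof -
    obtain b where vb: "(v, b) \<in> c" using v by (auto simp: V0_def)
    obtain y where y: "y \<in> darcs G" "dag G y \<in> darcs G" "(v, b) = (tgt G y, port \<phi> (tgt G y) (dag G y))"
      "\<sigma> (v, b) = dag C (tgt G (dag G y), port \<phi> (tgt G (dag G y)) y)"
      using \<sigma>[OF vb] unfolding glue_rel_def by blast
    have fst_dag: "fst (dag C p) = fst p" if "p \<in> arcs C" for p
      using that by (cases p) (auto simp: C_simps)
    have "tgt G (dag G y) = fst (\<sigma> (v, b))" using y fst_dag[OF port_C'[OF y(1,2)]] by simp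
    then have ty: "tgt G (dag G y) \<in> V0" using \<sigma>c[OF vb] by (simp add: V0_def)
    obtain q where q: "q \<in> c" "\<sigma> q = (v, b)" using surj vb by (metis imageE)
    obtain x where x: "x \<in> darcs G" "dag G x \<in> darcs G" "q = (tgt G x, port \<phi> (tgt G x) (dag G x))"
      "(v, b) = dag C (tgt G (dag G x), port \<phi> (tgt G (dag G x)) x)"
      using \<sigma>[OF q(1)] q(2) unfolding glue_rel_def by auto
    have "tgt G x = fst q" using x by simp
    then have "tgt G x \<in> V0" using q by (simp add: V0_def)
    with key[OF vb y(3,1,2) x(4,1,2) ty] show ?thesis by blast
  qed
  have step: "dag G a \<in> P0" if a: "a \<in> P0" for a
  proof -
    have aD: "a \<in> darcs G" "tgt G a \<in> V0" using a by (auto simp: P0_def)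
    obtain x y where xy: "nb G (tgt G a) = {y, dag G x}" "dag G y \<in> darcs G" "tgt G (dag G y) \<in> V0"
      "x \<in> darcs G" "tgt G x \<in> V0"
      using key'[OF aD(2)] by blast
    have "a \<in> nb G (tgt G a)" using aD by (simp add: nb_def)
    then have "a = y \<or> a = dag G x" using xy by simp
    then show ?thesis using xy Gs by (auto simp: P0_def)
  qed
  \<comment> \<open>By \<open>step\<close>, the arcs attached to the cycle are closed under the
    involution. The cycle is thus all of \<open>G\<close>, and every vertex is sent to an
    edge.\<close>
  have "closed_part G P0 V0"
    unfolding closed_part_def
  proof (intro conjI ballI)
    show "P0 \<subseteq> arcs G" "V0 \<subseteq> verts G" using Gs cC by (auto simp: P0_def V0_def C_simps)
    show "dag G a \<in> P0 \<longleftrightarrow> a \<in> P0" if "a \<in> arcs G" for a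
      using step[of a] step[of "dag G a"] Gs(5)[OF that] by auto
    show "incl G d \<in> P0 \<longleftrightarrow> tgt G d \<in> V0" if "d \<in> darcs G" for d
      using that Gs by (simp add: P0_def)
  qed
  moreover have "V0 \<noteq> {}" using \<open>p0 \<in> c\<close> by (auto simp: V0_def)
  ultimately have P0: "P0 = arcs G" and V0: "V0 = verts G"
    using connectedD[OF gm_graphs(2) graph_diagram[OF gm_graphs(1)]] by auto
  have "boundary G = {}" using P0 by (auto simp: boundary_def P0_def)
  then obtain v where v: "v \<in> verts G" "gm_verts \<phi> v \<noteq> {}" using gm_nonempty by blast
  moreover have "verts (reps v) = {}" using key' V0 v by blast
  ultimately show False by (simp add: gm_verts_def emb_verts_def)
qed

lemma subst_boundary:
  assumes ne: "verts G \<noteq> {}"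
  shows "onA (subst_map G \<phi>) ` pre_boundary (subst G \<phi>) = gm0 \<phi> ` boundary G"
proof (intro subset_antisym subsetI)
  fix a assume "a \<in> gm0 \<phi> ` boundary G"
  then obtain x where x: "x \<in> boundary G" "a = gm0 \<phi> x" by auto
  have "a = onA (subst_map G \<phi>) (R `` {outer x})" using outer(8)[OF x(1) ne] x(2) by simp
  then show "a \<in> onA (subst_map G \<phi>) ` pre_boundary (subst G \<phi>)"
    using outer_boundary[OF x(1) ne] by (rule image_eqI)
next
  fix a assume "a \<in> onA (subst_map G \<phi>) ` pre_boundary (subst G \<phi>)"
  then obtain c where c: "c \<in> pre_boundary (subst G \<phi>)" "a = onA (subst_map G \<phi>) c" by auto
  then obtain x where "x \<in> boundary G" "c = R `` {outer x}" using boundary_class_outer[OF ne] by blast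
  then show "a \<in> gm0 \<phi> ` boundary G" using c outer(8)[OF _ ne] by simp
qed

text \<open>Boundary arcs with equal images have equal classes in the glued diagram, whose embedding
  is injective on the boundary; but each class has at most one end. This consequence of the
  definition is what makes composites bijective onto class boundaries.\<close>

lemma gm0_inj_boundary: "inj_on (gm0 \<phi>) (boundary G)"
proof (cases "verts G = {}")
  case True
  obtain a where "a \<in> arcs G" "arcs G = {a, dag G a}" "dag G a \<noteq> a"
    using connected_no_verts[OF gm_graphs(2) graph_pregraph[OF gm_graphs(1)] True] by metis
  moreover from this have "gm0 \<phi> (dag G a) \<noteq> gm0 \<phi> a"
    using gm0_simps[of a] graph_simps(4)[OF gm_graphs(3)] by simp
  ultimately have "inj_on (gm0 \<phi>) {a, dag G a}" "arcs G = {a, dag G a}"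
    by (auto simp: inj_on_def)
  then have "inj_on (gm0 \<phi>) (arcs G)" by simp
  then show ?thesis by (rule inj_on_subset) (auto simp: boundary_def)
next
  case ne: False
  note Gs = graph_simps[OF gm_graphs(1)]
  show ?thesis
  proof (rule inj_onI)
    fix x y assume xy: "x \<in> boundary G" "y \<in> boundary G" "gm0 \<phi> x = gm0 \<phi> y"
    note ox = outer[OF xy(1) ne] and oy = outer[OF xy(2) ne]
    have "R `` {outer x} = R `` {outer y}"
      by (rule inj_onD[OF pre_embedding_inj_boundary[OF subst_pre_embedding[OF ne]]])
        (use ox oy xy outer_boundary ne in auto)
    then have o: "outer x = outer y" using terminal_class_eq ox oy by blast
    have xx: "dag G (dag G x) = x" "dag G (dag G y) = y" using ox oy Gs by auto
    have "dag G x = dag G y"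
      by (rule port_inj[OF ox(4,3)]) (use o oy xx in auto)
    then show "x = y" using xx by metis
  qed
qed

text \<open>The interface to images used from here on: the two invariants determine the class, so
  the coequalizer is not inspected again.\<close>

lemma im_data:
  "im G G' \<phi> \<in> Emb G'" "emb_verts (im G G' \<phi>) = (\<Union>v\<in>verts G. gm_verts \<phi> v)"
  "class_boundary (im G G' \<phi>) = gm0 \<phi> ` boundary G"
proof -
  have "im G G' \<phi> \<in> Emb G' \<and> emb_verts (im G G' \<phi>) = (\<Union>v\<in>verts G. gm_verts \<phi> v) \<and>
    class_boundary (im G G' \<phi>) = gm0 \<phi> ` boundary G"
  proof (cases "verts G = {}")
    case True
    let ?f = "\<lparr>onA = gm0 \<phi>, onD = (\<lambda>_. undefined), onV = (\<lambda>_. undefined)\<rparr>"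
    obtain a where a: "a \<in> arcs G" "arcs G = {a, dag G a}" "darcs G = {}"
      using connected_no_verts[OF gm_graphs(2) graph_pregraph[OF gm_graphs(1)] True] by metis
    have "nat_trans G G' ?f"
      using \<phi> a True by (auto simp: nat_trans_def graphical_map_def)
    then have f: "pre_embedding G G' ?f"
      using gm_graphs graph_pregraph True by (auto simp: pre_embedding_def etale_def)
    have "im G G' \<phi> = emb_class G' G ?f"
      using is_exc_iff[OF gm_graphs(1,2)] True by (simp add: im_def)
    then show ?thesis using emb_class_data[OF f] True graph_pre_boundary[OF gm_graphs(1)] by simp
  next
    case False
    have "im G G' \<phi> = emb_class G' (subst G \<phi>) (subst_map G \<phi>)"
      using is_exc_iff[OF gm_graphs(1,2)] False by (simp add: im_def)
    then show ?thesis
      using emb_class_data[OF subst_pre_embedding[OF False]] subst_verts subst_boundary[OF False] by simp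
  qed
  then show "im G G' \<phi> \<in> Emb G'" "emb_verts (im G G' \<phi>) = (\<Union>v\<in>verts G. gm_verts \<phi> v)"
    "class_boundary (im G G' \<phi>) = gm0 \<phi> ` boundary G" by auto
qed

end

section \<open>The graphical category\<close>

text \<open>The boundary of each class is determined by \<open>gm0\<close>, which leaves its
  vertices as the only further datum.\<close>

lemma gmap_eqI:
  fixes G G' :: "('a :: infinite, 'v) graph"
  assumes \<phi>: "graphical_map G G' \<phi>" and \<psi>: "graphical_map G G' \<psi>"
    and A: "\<And>a. a \<in> arcs G \<Longrightarrow> gm0 \<phi> a = gm0 \<psi> a"
    and V: "\<And>v. v \<in> verts G \<Longrightarrow> gm_verts \<phi> v = gm_verts \<psi> v"
  shows "\<phi> = \<psi>"
proof (rule gmap.equality)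
  interpret f: graphical G G' \<phi> by unfold_locales (rule \<phi>)
  interpret g: graphical G G' \<psi> by unfold_locales (rule \<psi>)
  show "gm0 \<phi> = gm0 \<psi>"
    using \<phi> \<psi> A unfolding graphical_map_def by (intro PiE_ext[of _ "arcs G" "\<lambda>_. arcs G'"]) auto
  have "gm1 \<phi> v = gm1 \<psi> v" if v: "v \<in> verts G" for v
  proof (rule Emb_eqI[OF f.gm1_Emb[OF v] g.gm1_Emb[OF v]])
    show "emb_verts (gm1 \<phi> v) = emb_verts (gm1 \<psi> v)" using V[OF v] by (simp add: gm_verts_def)
    show "class_boundary (gm1 \<phi> v) = class_boundary (gm1 \<psi> v)"
      unfolding f.gm_class_boundary[OF v] g.gm_class_boundary[OF v]
      using A graph_simps(1)[OF f.gm_graphs(1)] f.nb_arcs(2) by (intro image_cong) auto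
  qed
  then show "gm1 \<phi> = gm1 \<psi>"
    using \<phi> \<psi> unfolding graphical_map_def by (intro PiE_ext[of _ "verts G" "\<lambda>_. Emb G'"]) auto
qed simp

lemma embedding_simps:
  assumes f: "embedding H G f"
  shows "graph H" "connected H" "graph G" "connected G" "pre_embedding H G f"
    "d \<in> darcs H \<Longrightarrow> onA f d = onD f d" "d \<in> darcs H \<Longrightarrow> onA f d \<in> darcs G"
    "d \<in> darcs H \<Longrightarrow> tgt G (onA f d) = onV f (tgt H d)"
    "onA f ` nb H v = (if v \<in> verts H then nb G (onV f v) else {})" "inj_on (onA f) (darcs H)"
proof -
  show H: "graph H" "connected H" "graph G" "connected G" and pe: "pre_embedding H G f"
    using f by (auto simp: embedding_def pre_embedding_def graph_pregraph)
  note fs = pre_embedding_simps[OF pe] and Hs = graph_simps[OF H(1)]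
  show D: "onA f d = onD f d" if "d \<in> darcs H" for d using fs(5)[OF that] Hs(6)[OF that] by simp
  show D2: "d \<in> darcs H \<Longrightarrow> onA f d \<in> darcs G" and T: "d \<in> darcs H \<Longrightarrow> tgt G (onA f d) = onV f (tgt H d)" for d
    using D fs by auto
  show "inj_on (onA f) (darcs H)"
    using D pre_embedding_inj_D[OF pe] by (simp add: inj_on_def)
  show "onA f ` nb H v = (if v \<in> verts H then nb G (onV f v) else {})"
  proof (cases "v \<in> verts H")
    case True
    have "nb G (onV f v) \<subseteq> onA f ` nb H v"
    proof
      fix d assume "d \<in> nb G (onV f v)"
      then obtain e where "e \<in> darcs H" "tgt H e = v" "onD f e = d"
        using pre_embedding_lift_D[OF pe True, of d] by (auto simp: nb_def)
      then show "d \<in> onA f ` nb H v" using D by (auto simp: nb_def)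
    qed
    moreover have "onA f ` nb H v \<subseteq> nb G (onV f v)" using D2 T by (auto simp: nb_def)
    ultimately show ?thesis using True by auto
  qed (use Hs(3) in \<open>auto simp: nb_def\<close>)
qed

lemma graph_boundary_verts:
  assumes "graph G" "connected G" "boundary G = {}"
  shows "verts G \<noteq> {}"
proof
  assume "verts G = {}"
  then obtain a where "a \<in> arcs G" "darcs G = {}"
    using connected_no_verts[OF assms(2) graph_pregraph[OF assms(1)]] by metis
  then show False using assms(3) by (simp add: boundary_def)
qed

lemma Emb_full_boundary:
  fixes G :: "('a :: infinite, 'v) graph"
  assumes "c \<in> Emb G" "class_boundary c \<subseteq> boundary G"
  shows "emb_verts c = verts G" "class_boundary c = boundary G"
proof -
  have e: "embedding (rep_graph c) G (rep_map c)" using Emb_rep(1)[OF assms(1)] .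
  have pb: "pre_boundary (rep_graph c) = boundary (rep_graph c)"
    by (rule graph_pre_boundary[OF embedding_simps(1)[OF e]])
  note f = pre_embedding_full_boundary[OF embedding_simps(5)[OF e], unfolded pb]
  show "emb_verts c = verts G" "class_boundary c = boundary G"
    using f assms(2) unfolding emb_verts_def class_boundary_def by auto
qed

section \<open>Restriction, composition and identities\<close>

lemma gmap_restrict:
  fixes G G' :: "('a :: infinite, 'v) graph"
  assumes \<phi>: "graphical_map G G' \<phi>" and f: "embedding H G f"
  shows "graphical_map H G' (gmap_restrict \<phi> H f)"
    "a \<in> arcs H \<Longrightarrow> gm0 (gmap_restrict \<phi> H f) a = gm0 \<phi> (onA f a)"
    "v \<in> verts H \<Longrightarrow> gm_verts (gmap_restrict \<phi> H f) v = gm_verts \<phi> (onV f v)"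
proof -
  interpret p: graphical G G' \<phi> by unfold_locales (rule \<phi>)
  let ?\<chi> = "gmap_restrict \<phi> H f"
  note fs = embedding_simps[OF f] 
  note ps = pre_embedding_simps[OF fs(5)] and Hs = graph_simps[OF fs(1)]
  show A: "gm0 ?\<chi> a = gm0 \<phi> (onA f a)" if "a \<in> arcs H" for a
    using that by (simp add: gmap_restrict_def compose_def)
  have V1: "gm1 ?\<chi> v = gm1 \<phi> (onV f v)" if "v \<in> verts H" for v
    using that by (simp add: gmap_restrict_def compose_def)
  show V: "gm_verts ?\<chi> v = gm_verts \<phi> (onV f v)" if "v \<in> verts H" for v
    using V1[OF that] by (simp add: gm_verts_def)
  have nbA: "a \<in> arcs H" "a \<in> darcs H" if "a \<in> nb H v" for a v using that Hs(2) by (auto simp: nb_def)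
  show "graphical_map H G' ?\<chi>"
    unfolding graphical_map_iff
  proof (intro conjI ballI impI)
    show "gm0 ?\<chi> \<in> arcs H \<rightarrow>\<^sub>E arcs G'"
      using p.gm0_simps(1) ps(1) by (auto simp: gmap_restrict_def compose_def)
    show "gm1 ?\<chi> \<in> verts H \<rightarrow>\<^sub>E Emb G'"
      using p.gm1_Emb ps(3) by (auto simp: gmap_restrict_def compose_def)
    show "gm0 ?\<chi> (dag H a) = dag G' (gm0 ?\<chi> a)" if "a \<in> arcs H" for a
      using that A Hs(1) ps(1,4) p.gm0_simps(2) by simp
    show "v = u" if "v \<in> verts H" "u \<in> verts H" "gm_verts ?\<chi> v \<inter> gm_verts ?\<chi> u \<noteq> {}" for v u
      using that V p.gm_disjoint[of "onV f v" "onV f u"] ps(3) pre_embedding_inj_V[OF fs(5)] by auto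
    fix v assume v: "v \<in> verts H"
    show "inj_on (gm0 ?\<chi>) (nb H v)"
    proof (rule inj_onI)
      fix a b assume ab: "a \<in> nb H v" "b \<in> nb H v" "gm0 ?\<chi> a = gm0 ?\<chi> b"
      then have "onA f a \<in> nb G (onV f v)" "onA f b \<in> nb G (onV f v)"
        using fs(9)[of v] v by auto
      then have "onA f a = onA f b"
        using inj_onD[OF p.gm_inj_nb[OF ps(3)[OF v]]] ab A nbA by simp
      then show "a = b" using inj_onD[OF fs(10)] ab nbA by blast
    qed
    have "class_boundary (gm1 ?\<chi> v) = (\<lambda>a. gm0 \<phi> (dag G a)) ` onA f ` nb H v"
      using V1[OF v] p.gm_class_boundary[OF ps(3)[OF v]] fs(9)[of v] v by simp
    also have "\<dots> = (\<lambda>a. gm0 ?\<chi> (dag H a)) ` nb H v"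
      unfolding image_image using A Hs(1) ps(4) nbA by (intro image_cong) simp_all
    finally show "class_boundary (gm1 ?\<chi> v) = (\<lambda>a. gm0 ?\<chi> (dag H a)) ` nb H v" .
  next
    \<comment> \<open>An embedded graph without boundary contains all vertices of \<open>G\<close>,
      and then \<open>G\<close> has no boundary either; so the last condition holds because it does
      for \<open>\<phi>\<close>.\<close>
    assume b: "boundary H = {}"
    then have full: "onV f ` verts H = verts G" "boundary G = {}"
      using pre_embedding_full_boundary[OF fs(5)] graph_pre_boundary[OF fs(1)] by auto
    then obtain w where "w \<in> verts G" "gm_verts \<phi> w \<noteq> {}" using p.gm_nonempty by blast
    then show "\<exists>v\<in>verts H. gm_verts ?\<chi> v \<noteq> {}" using full(1) V by (metis imageE)
  qed (use fs p.gm_graphs in auto)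
qed

text \<open>The vertex and boundary sets come from the description of images. Injectivity on
  \<open>nb G v\<close> needs the restriction of \<open>\<psi>\<close> to a representative to be
  injective on its boundary; the last condition needs the image of \<open>\<phi>\<close> to fill
  \<open>H\<close> when \<open>G\<close> has no boundary.\<close>

lemma gmap_comp:
  fixes G H K :: "('a :: infinite, 'v) graph"
  assumes \<phi>: "graphical_map G H \<phi>" and \<psi>: "graphical_map H K \<psi>"
  shows "graphical_map G K (gmap_comp G H K \<psi> \<phi>)"
    "a \<in> arcs G \<Longrightarrow> gm0 (gmap_comp G H K \<psi> \<phi>) a = gm0 \<psi> (gm0 \<phi> a)"
    "v \<in> verts G \<Longrightarrow> gm_verts (gmap_comp G H K \<psi> \<phi>) v = (\<Union>w\<in>gm_verts \<phi> v. gm_verts \<psi> w)"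
proof -
  interpret f: graphical G H \<phi> by unfold_locales (rule \<phi>)
  interpret g: graphical H K \<psi> by unfold_locales (rule \<psi>)
  let ?\<chi> = "gmap_comp G H K \<psi> \<phi>"
  let ?r = "\<lambda>v. gmap_restrict \<psi> (f.reps v) (f.repm v)"
  note Gs = graph_simps[OF f.gm_graphs(1)]
  show A: "gm0 ?\<chi> a = gm0 \<psi> (gm0 \<phi> a)" if "a \<in> arcs G" for a
    using that by (simp add: gmap_comp_def compose_def)
  have V1: "gm1 ?\<chi> v = im (f.reps v) K (?r v)" if "v \<in> verts G" for v
    using that by (simp add: gmap_comp_def)
  have r: "graphical (f.reps v) K (?r v)" if "v \<in> verts G" for v
    using gmap_restrict(1)[OF \<psi> f.gm_rep[OF that]] by unfold_locales
  note rs = gmap_restrict(2,3)[OF \<psi> f.gm_rep]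
  show V: "gm_verts ?\<chi> v = (\<Union>w\<in>gm_verts \<phi> v. gm_verts \<psi> w)" if v: "v \<in> verts G" for v
  proof -
    have "gm_verts ?\<chi> v = (\<Union>u\<in>verts (f.reps v). gm_verts (?r v) u)"
      using V1[OF v] graphical.im_data(2)[OF r[OF v]] by (simp add: gm_verts_def)
    also have "\<dots> = (\<Union>u\<in>verts (f.reps v). gm_verts \<psi> (onV (f.repm v) u))"
      using rs(2)[OF v] by (intro SUP_cong) auto
    finally show ?thesis by (simp add: gm_verts_def emb_verts_def)
  qed
  have portb: "port \<phi> v (dag G a) \<in> boundary (f.reps v)"
    "gm0 (?r v) (port \<phi> v (dag G a)) = gm0 \<psi> (gm0 \<phi> (dag G a))" if "v \<in> verts G" "a \<in> nb G v" for v a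
    using f.port[OF that] rs(1)[OF that(1)] by (auto simp: boundary_def)
  show "graphical_map G K ?\<chi>"
    unfolding graphical_map_iff
  proof (intro conjI ballI impI)
    show "gm0 ?\<chi> \<in> arcs G \<rightarrow>\<^sub>E arcs K"
      using f.gm0_simps(1) g.gm0_simps(1) by (auto simp: gmap_comp_def compose_def)
    show "gm1 ?\<chi> \<in> verts G \<rightarrow>\<^sub>E Emb K"
      using graphical.im_data(1)[OF r] by (auto simp: gmap_comp_def)
    show dag: "gm0 ?\<chi> (dag G a) = dag K (gm0 ?\<chi> a)" if "a \<in> arcs G" for a
      using that A Gs(1) f.gm0_simps g.gm0_simps by simp
    show "v = u" if vu: "v \<in> verts G" "u \<in> verts G" "gm_verts ?\<chi> v \<inter> gm_verts ?\<chi> u \<noteq> {}" for v u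
    proof -
      obtain w w' x where w: "w \<in> gm_verts \<phi> v" "w' \<in> gm_verts \<phi> u" "x \<in> gm_verts \<psi> w" "x \<in> gm_verts \<psi> w'"
        using vu V by auto
      have "gm_verts \<phi> v \<subseteq> verts H" if "v \<in> verts G" for v
        using pre_embedding_simps(3)[OF f.reps_facts(5)[OF that]] by (auto simp: gm_verts_def emb_verts_def)
      then have "w = w'" using w vu g.gm_disjoint by blast
      then show "v = u" using f.gm_disjoint w vu by blast
    qed
    fix v assume v: "v \<in> verts G"
    show "inj_on (gm0 ?\<chi>) (nb G v)"
    proof (rule inj_onI)
      fix a b assume ab: "a \<in> nb G v" "b \<in> nb G v" "gm0 ?\<chi> a = gm0 ?\<chi> b"
      have abA: "a \<in> arcs G" "b \<in> arcs G" using ab f.nb_arcs by auto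
      have "gm0 \<psi> (gm0 \<phi> (dag G a)) = gm0 \<psi> (gm0 \<phi> (dag G b))"
        using ab abA A f.gm0_simps g.gm0_simps by simp
      then have "port \<phi> v (dag G a) = port \<phi> v (dag G b)"
        using inj_onD[OF graphical.gm0_inj_boundary[OF r[OF v]]] portb[OF v] ab by simp
      then show "a = b" using f.port_inj[OF v] ab by blast
    qed
    have "class_boundary (gm1 ?\<chi> v) = gm0 (?r v) ` boundary (f.reps v)"
      using V1[OF v] graphical.im_data(3)[OF r[OF v]] by simp
    also have "\<dots> = gm0 \<psi> ` class_boundary (gm1 \<phi> v)"
      unfolding class_boundary_def image_image
      using rs(1)[OF v] by (intro image_cong) (auto simp: boundary_def)
    also have "\<dots> = (\<lambda>a. gm0 ?\<chi> (dag G a)) ` nb G v"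
      unfolding f.gm_class_boundary[OF v] image_image
      using A Gs(1) f.nb_arcs by (intro image_cong) auto
    finally show "class_boundary (gm1 ?\<chi> v) = (\<lambda>a. gm0 ?\<chi> (dag G a)) ` nb G v" .
  next
    assume b: "boundary G = {}"
    have "(\<Union>v\<in>verts G. gm_verts \<phi> v) = verts H" "boundary H = {}"
      using Emb_full_boundary[OF f.im_data(1)] f.im_data(2,3) b by auto
    moreover from this obtain w where "w \<in> verts H" "gm_verts \<psi> w \<noteq> {}" using g.gm_nonempty by blast
    ultimately obtain v where "v \<in> verts G" "w \<in> gm_verts \<phi> v" by blast
    then show "\<exists>v\<in>verts G. gm_verts ?\<chi> v \<noteq> {}" using V \<open>gm_verts \<psi> w \<noteq> {}\<close> by blast
  qed (use f.gm_graphs g.gm_graphs in auto)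
qed

lemma emb_gmap:
  fixes H G :: "('a :: infinite, 'v) graph"
  assumes f: "embedding H G f"
  shows "graphical_map H G (emb_gmap H G f)" "gm0 (emb_gmap H G f) = onA f"
    "v \<in> verts H \<Longrightarrow> gm_verts (emb_gmap H G f) v = {onV f v}"
proof -
  let ?\<chi> = "emb_gmap H G f"
  note fs = embedding_simps[OF f]
  note ps = pre_embedding_simps[OF fs(5)] and Hs = graph_simps[OF fs(1)]
  show A: "gm0 ?\<chi> = onA f" by (simp add: emb_gmap_def)
  have V1: "gm1 ?\<chi> v = emb_class G (star G (onV f v)) (star_emb G (onV f v))" if "v \<in> verts H" for v
    using that by (simp add: emb_gmap_def)
  note sd = star_class_data[OF fs(3,4) ps(3)]
  show V: "gm_verts ?\<chi> v = {onV f v}" if "v \<in> verts H" for v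
    using V1[OF that] sd(2)[OF that] by (simp add: gm_verts_def)
  show "graphical_map H G ?\<chi>"
    unfolding graphical_map_iff
  proof (intro conjI ballI impI)
    show "gm0 ?\<chi> \<in> arcs H \<rightarrow>\<^sub>E arcs G"
      using pre_embedding_graphs(5)[OF fs(5)] by (simp add: A nat_trans_def)
    show "gm1 ?\<chi> \<in> verts H \<rightarrow>\<^sub>E Emb G" using sd(1) by (auto simp: emb_gmap_def)
    show "gm0 ?\<chi> (dag H a) = dag G (gm0 ?\<chi> a)" if "a \<in> arcs H" for a
      using ps(4)[OF that] by (simp add: A)
    show "v = u" if "v \<in> verts H" "u \<in> verts H" "gm_verts ?\<chi> v \<inter> gm_verts ?\<chi> u \<noteq> {}" for v u
      using that V pre_embedding_inj_V[OF fs(5)] by auto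
    fix v assume v: "v \<in> verts H"
    show "inj_on (gm0 ?\<chi>) (nb H v)"
      unfolding A by (rule inj_on_subset[OF fs(10)]) (auto simp: nb_def)
    have "class_boundary (gm1 ?\<chi> v) = dag G ` onA f ` nb H v"
      using V1[OF v] sd(3)[OF v] fs(9)[of v] v by simp
    also have "\<dots> = (\<lambda>a. gm0 ?\<chi> (dag H a)) ` nb H v"
      unfolding image_image A using ps(4) Hs(2) by (intro image_cong) (auto simp: nb_def)
    finally show "class_boundary (gm1 ?\<chi> v) = (\<lambda>a. gm0 ?\<chi> (dag H a)) ` nb H v" .
  next
    assume "boundary H = {}"
    then obtain v where "v \<in> verts H" using graph_boundary_verts[OF fs(1,2)] by blast
    then show "\<exists>v\<in>verts H. gm_verts ?\<chi> v \<noteq> {}" using V by blast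
  qed (use fs in auto)
qed

lemma embedding_nt_id:
  assumes "graph G" "connected G" shows "embedding G G (nt_id G)"
  using assms graph_simps[OF assms(1)]
  by (auto simp: embedding_def etale_def nat_trans_def nt_id_def)

abbreviation gm_id :: "('a, 'v) graph \<Rightarrow> ('a, 'v) gmap" where
  "gm_id G \<equiv> emb_gmap G G (nt_id G)"

lemma gm_id:
  fixes G :: "('a :: infinite, 'v) graph"
  assumes "graph G" "connected G"
  shows "graphical_map G G (gm_id G)" "a \<in> arcs G \<Longrightarrow> gm0 (gm_id G) a = a"
    "v \<in> verts G \<Longrightarrow> gm_verts (gm_id G) v = {v}"
  using emb_gmap[OF embedding_nt_id[OF assms]] by (auto simp: nt_id_def)

lemma gm_verts_subset: "graphical_map G G' \<phi> \<Longrightarrow> v \<in> verts (G :: ('a :: infinite, 'v) graph) \<Longrightarrow> gm_verts \<phi> v \<subseteq> verts G'"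
  using pre_embedding_simps(3)[OF graphical.reps_facts(5)[OF graphical.intro]]
  by (fastforce simp: gm_verts_def emb_verts_def)

lemma gmap_comp_id:
  fixes G G' :: "('a :: infinite, 'v) graph"
  assumes \<phi>: "graphical_map G G' \<phi>"
  shows "gmap_comp G G G' \<phi> (gm_id G) = \<phi>" "gmap_comp G G' G' (gm_id G') \<phi> = \<phi>"
proof -
  interpret f: graphical G G' \<phi> by unfold_locales (rule \<phi>)
  note i = gm_id[OF f.gm_graphs(1,2)] and i' = gm_id[OF f.gm_graphs(3,4)]
  note c = gmap_comp[OF i(1) \<phi>] and c' = gmap_comp[OF \<phi> i'(1)]
  show "gmap_comp G G G' \<phi> (gm_id G) = \<phi>"
    by (rule gmap_eqI[OF c(1) \<phi>]) (simp_all add: c i)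
  show "gmap_comp G G' G' (gm_id G') \<phi> = \<phi>"
    by (rule gmap_eqI[OF c'(1) \<phi>])
      (use gm_verts_subset[OF \<phi>] in \<open>auto simp: c' i' f.gm0_simps subset_iff\<close>)
qed

text \<open>With both sides described by \<open>gm0\<close> and \<open>gm_verts\<close>, there
  remains the associativity of composing functions and of taking unions; no isomorphism between
  iterated gluings has to be constructed.\<close>

lemma gmap_comp_assoc:
  fixes G H K L :: "('a :: infinite, 'v) graph"
  assumes "graphical_map G H \<phi>" "graphical_map H K \<psi>" "graphical_map K L \<chi>"
  shows "gmap_comp G H L (gmap_comp H K L \<chi> \<psi>) \<phi> = gmap_comp G K L \<chi> (gmap_comp G H K \<psi> \<phi>)"
proof -
  note c1 = gmap_comp[OF assms(1,2)] and c2 = gmap_comp[OF assms(2,3)]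
  note c3 = gmap_comp[OF assms(1) c2(1)] and c4 = gmap_comp[OF c1(1) assms(3)]
  have "gm_verts \<phi> v \<subseteq> verts H" "a \<in> arcs G \<Longrightarrow> gm0 \<phi> a \<in> arcs H" if "v \<in> verts G" for v a
    using gm_verts_subset[OF assms(1) that] by simp (metis graphical.gm0_simps(1) graphical.intro assms(1))
  then show ?thesis
    using graphical.gm0_simps(1)[OF graphical.intro[OF assms(1)]]
    by (intro gmap_eqI[OF c3(1) c4(1)]) (auto simp: c1 c2 c3 c4 subset_iff)
qed

lemma is_category_graphical:
  "is_category (graphical_category :: (('a :: infinite, 'v) graph, ('a, 'v) gmap) category)"
  unfolding is_category_def graphical_category_def
  by (simp add: gm_id(1) gmap_comp(1) gmap_comp_id gmap_comp_assoc)

section \<open>Collapsed and non-collapsed vertices\<close>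

context graphical begin

text \<open>The representative is an exceptional edge. Its two boundary arcs are the ports of two
  different arcs at \<open>v\<close>, and the involution exchanges them.\<close>

lemma collapsed_ports:
  assumes v: "v \<in> verts G" "gm_verts \<phi> v = {}"
  obtains x y where "nb G v = {x, y}" "x \<noteq> y" "gm0 \<phi> (dag G x) = gm0 \<phi> y" "gm0 \<phi> (dag G y) = gm0 \<phi> x"
proof -
  note r = reps_facts[OF v(1)]
  note Gs = graph_simps[OF gm_graphs(1)] and Hs = graph_simps[OF r(1)]
  have "verts (reps v) = {}" using v(2) by (simp add: gm_verts_def emb_verts_def)
  then obtain b where b: "b \<in> arcs (reps v)" "arcs (reps v) = {b, dag (reps v) b}"
      "darcs (reps v) = {}" "dag (reps v) b \<noteq> b"
    using connected_no_verts[OF r(4,2)] by metis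
  then have bd: "boundary (reps v) = {b, dag (reps v) b}" by (simp add: boundary_def)
  obtain x where x: "x \<in> nb G v" "b = port \<phi> v (dag G x)" using port_surj[OF v(1), of b] bd by auto
  obtain y where y: "y \<in> nb G v" "dag (reps v) b = port \<phi> v (dag G y)"
    using port_surj[OF v(1), of "dag (reps v) b"] bd by auto
  have "z = x \<or> z = y" if z: "z \<in> nb G v" for z
    using port(1)[OF v(1) z] bd x y port_inj[OF v(1) z] by auto
  then have nb: "nb G v = {x, y}" using x y by auto
  have eq: "gm0 \<phi> (dag G y) = dag G' (gm0 \<phi> (dag G x))"
    using port(2)[OF v(1) x(1)] port(2)[OF v(1) y(1)] pre_embedding_simps(4)[OF r(5) b(1)] x y by simp
  have xA: "x \<in> arcs G" "y \<in> arcs G" using x y nb_arcs by auto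
  have "gm0 \<phi> (dag G y) = gm0 \<phi> x"
    using eq xA gm0_simps Gs(1,5) by metis
  moreover have "gm0 \<phi> (dag G x) = gm0 \<phi> y"
    using eq xA gm0_simps Gs(1,5) graph_simps(5)[OF gm_graphs(3)] by metis
  moreover have "x \<noteq> y" using x y b by auto
  ultimately show ?thesis using that nb by blast
qed

lemma collapsed_swap:
  assumes "v \<in> verts G" "gm_verts \<phi> v = {}" "nb G v = {x, y}"
  shows "x \<noteq> y" "gm0 \<phi> (dag G x) = gm0 \<phi> y" "gm0 \<phi> (dag G y) = gm0 \<phi> x"
proof -
  obtain x' y' where "nb G v = {x', y'}" "x' \<noteq> y'" "gm0 \<phi> (dag G x') = gm0 \<phi> y'" "gm0 \<phi> (dag G y') = gm0 \<phi> x'"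
    using collapsed_ports[OF assms(1,2)] by blast
  then show "x \<noteq> y" "gm0 \<phi> (dag G x) = gm0 \<phi> y" "gm0 \<phi> (dag G y) = gm0 \<phi> x"
    using assms(3) by (auto simp: doubleton_eq_iff)
qed

text \<open>A loop at a bivalent vertex is a closed part, so \<open>G\<close> would be a circle
  whose only vertex is sent to an edge, contrary to the last condition on graphical maps.\<close>

lemma collapsed_no_loop:
  assumes v: "v \<in> verts G" "gm_verts \<phi> v = {}" and nb: "nb G v = {x, y}"
  shows "dag G x \<noteq> y"
proof
  assume xy: "dag G x = y"
  note Gs = graph_simps[OF gm_graphs(1)]
  have x: "x \<in> darcs G" "y \<in> darcs G" "tgt G x = v" "tgt G y = v" "dag G y = x"
    using nb xy Gs(5)[OF Gs(2), of x] by (auto simp: nb_def)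
  have "closed_part G {x, y} {v}"
    unfolding closed_part_def
  proof (intro conjI ballI)
    show "dag G a \<in> {x, y} \<longleftrightarrow> a \<in> {x, y}" if "a \<in> arcs G" for a
      using Gs(5)[OF that] x xy by auto
    show "incl G d \<in> {x, y} \<longleftrightarrow> tgt G d \<in> {v}" if "d \<in> darcs G" for d
      using that Gs(6)[OF that] nb by (auto simp: nb_def)
  qed (use x v Gs in auto)
  then have "arcs G = {x, y}" "verts G = {v}"
    using connectedD[OF gm_graphs(2) graph_diagram[OF gm_graphs(1)], of "{x, y}" "{v}"] by auto
  then have "boundary G = {}" "verts G = {v}" using x by (auto simp: boundary_def)
  then show False using gm_nonempty v by auto
qed

lemma port_darc:
  assumes v: "v \<in> verts G" "gm_verts \<phi> v \<noteq> {}" and a: "a \<in> nb G v"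
  obtains e where "e \<in> darcs (reps v)" "dag (reps v) (port \<phi> v (dag G a)) = e" "onD (repm v) e = gm0 \<phi> a"
proof -
  note r = reps_facts[OF v(1)] and Hs = graph_simps[OF reps_facts(1)[OF v(1)]]
  let ?b = "port \<phi> v (dag G a)"
  have ne: "verts (reps v) \<noteq> {}" using v(2) by (auto simp: gm_verts_def emb_verts_def)
  have b: "?b \<in> boundary (reps v)" "?b \<in> arcs (reps v)" using port(1)[OF v(1) a] by (auto simp: boundary_def)
  then obtain e where e: "e \<in> darcs (reps v)" "dag (reps v) ?b = e"
    using connected_dag_boundary[OF r(4,2) ne, of ?b] graph_pre_boundary[OF r(1)] Hs(6) by metis
  have "onD (repm v) e = dag G' (gm0 \<phi> (dag G a))"
    using pre_embedding_simps(4)[OF r(5) b(2)] e pre_embedding_simps(5)[OF r(5) e(1)] Hs(6)[OF e(1)]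
      port(2)[OF v(1) a] by simp
  also have "\<dots> = gm0 \<phi> a"
    using gm0_simps nb_arcs(2)[OF a] graph_simps(5)[OF gm_graphs(3)] by simp
  finally show ?thesis using that e by blast
qed

lemma gm_verts_image:
  assumes v: "v \<in> verts G" and d: "d \<in> darcs (reps v)"
  shows "onD (repm v) d \<in> darcs G'" "tgt G' (onD (repm v) d) \<in> gm_verts \<phi> v"
  using pre_embedding_simps(2,6)[OF reps_facts(5)[OF v] d] graph_simps(3)[OF reps_facts(1)[OF v] d]
  by (auto simp: gm_verts_def emb_verts_def intro!: rev_image_eqI[of "tgt (reps v) d"])

lemma noncollapsed_darc:
  assumes v: "v \<in> verts G" "gm_verts \<phi> v \<noteq> {}" and a: "a \<in> nb G v"
  shows "gm0 \<phi> a \<in> darcs G'" "tgt G' (gm0 \<phi> a) \<in> gm_verts \<phi> v"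
  using port_darc[OF assms] gm_verts_image[OF v(1)] by metis+

text \<open>The attached arc over \<open>gm0 \<phi> a\<close> is the involute of a port, hence of a
  boundary arc, so its edge is not internal to the representative.\<close>

lemma internal_not_nb:
  assumes v: "v \<in> verts G" "gm_verts \<phi> v \<noteq> {}" and a: "a \<in> nb G v"
    and d: "d \<in> darcs (reps v)" "dag (reps v) d \<in> darcs (reps v)"
  shows "onD (repm v) d \<noteq> gm0 \<phi> a"
proof
  assume eq: "onD (repm v) d = gm0 \<phi> a"
  note Hs = graph_simps[OF reps_facts(1)[OF v(1)]]
  have b: "port \<phi> v (dag G a) \<in> boundary (reps v)" by (rule port(1)[OF v(1) a])
  obtain e where e: "e \<in> darcs (reps v)" "dag (reps v) (port \<phi> v (dag G a)) = e" "onD (repm v) e = gm0 \<phi> a"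
    using port_darc[OF v a] .
  then have "e = d" using pre_embedding_inj_D[OF reps_facts(5)[OF v(1)] e(1) d(1)] eq by simp
  then have "port \<phi> v (dag G a) = dag (reps v) d"
    using e b Hs(5)[of "port \<phi> v (dag G a)"] by (simp add: boundary_def)
  then show False using b d by (simp add: boundary_def)
qed

lemma gm_verts_darc:
  assumes v: "v \<in> verts G" and d': "d' \<in> darcs G'" "tgt G' d' \<in> gm_verts \<phi> v"
  obtains d where "d \<in> darcs (reps v)" "onD (repm v) d = d'"
proof -
  obtain w where w: "w \<in> verts (reps v)" "tgt G' d' = onV (repm v) w"
    using d'(2) by (auto simp: gm_verts_def emb_verts_def)
  show ?thesis using pre_embedding_lift_D[OF reps_facts(5)[OF v] w(1) d'(1) w(2)] that by blast
qed

text \<open>Lift \<open>d'\<close> to the representative. If the involute of the lift were a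
  boundary arc, it would be a port, and \<open>d'\<close> would come from \<open>nb G v\<close>. So
  the arcs missed at these vertices lie on internal edges of \<open>G'\<close>.\<close>

lemma noncollapsed_internal:
  assumes v: "v \<in> verts G" "gm_verts \<phi> v \<noteq> {}"
    and d': "d' \<in> darcs G'" "tgt G' d' \<in> gm_verts \<phi> v" "d' \<notin> gm0 \<phi> ` nb G v"
  shows "dag G' d' \<in> darcs G'"
proof -
  note r = reps_facts[OF v(1)] and Hs = graph_simps[OF reps_facts(1)[OF v(1)]]
  obtain d where d: "d \<in> darcs (reps v)" "onD (repm v) d = d'" using gm_verts_darc[OF v(1) d'(1,2)] .
  have eq: "onA (repm v) (dag (reps v) d) = dag G' d'"
    using pre_embedding_simps(4)[OF r(5), of d] pre_embedding_simps(5)[OF r(5) d(1)] Hs(2,6)[OF d(1)] d(2) by simp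
  have "dag (reps v) d \<in> darcs (reps v)"
  proof (rule ccontr)
    assume "dag (reps v) d \<notin> darcs (reps v)"
    then obtain a where a: "a \<in> nb G v" "dag (reps v) d = port \<phi> v (dag G a)"
      using port_surj[OF v(1), of "dag (reps v) d"] Hs(1,2) d(1) by (auto simp: boundary_def)
    then have "gm0 \<phi> (dag G a) = dag G' d'" using port(2)[OF v(1) a(1)] eq by simp
    then have "gm0 \<phi> a = d'"
      using gm0_simps nb_arcs(2)[OF a(1)] graph_simps(2,5)[OF gm_graphs(3)] d'(1) by metis
    then show False using d'(3) a by blast
  qed
  then show ?thesis
    using eq pre_embedding_simps(2,5)[OF r(5), of "dag (reps v) d"] Hs(6)[of "dag (reps v) d"] by simp
qed

text \<open>The hypothesis leaves no internal edge in the representative, so any one of its vertices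
  together with the edges at it is a closed part.\<close>

lemma noncollapsed_corolla:
  assumes v: "v \<in> verts G" "gm_verts \<phi> v \<noteq> {}"
    and all: "\<And>d'. d' \<in> darcs G' \<Longrightarrow> tgt G' d' \<in> gm_verts \<phi> v \<Longrightarrow> d' \<in> gm0 \<phi> ` nb G v"
  obtains w where "gm_verts \<phi> v = {w}"
proof -
  note r = reps_facts[OF v(1)] and Hs = graph_simps[OF reps_facts(1)[OF v(1)]]
  have no: "dag (reps v) d \<notin> darcs (reps v)" if d: "d \<in> darcs (reps v)" for d
    using all[OF gm_verts_image[OF v(1) d]] internal_not_nb[OF v _ d] by auto
  obtain w where w: "w \<in> verts (reps v)" using v(2) by (auto simp: gm_verts_def emb_verts_def)
  define P where "P = {a \<in> arcs (reps v). (a \<in> darcs (reps v) \<and> tgt (reps v) a = w) \<or>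
    (dag (reps v) a \<in> darcs (reps v) \<and> tgt (reps v) (dag (reps v) a) = w)}"
  have "closed_part (reps v) P {w}"
    unfolding closed_part_def
  proof (intro conjI ballI)
    show "dag (reps v) a \<in> P \<longleftrightarrow> a \<in> P" if "a \<in> arcs (reps v)" for a
      using that Hs by (auto simp: P_def)
    show "incl (reps v) d \<in> P \<longleftrightarrow> tgt (reps v) d \<in> {w}" if "d \<in> darcs (reps v)" for d
      using that Hs no by (auto simp: P_def)
  qed (use w in \<open>auto simp: P_def\<close>)
  then have "verts (reps v) = {w}" using connectedD(2)[OF r(4,3)] by blast
  then show ?thesis using that by (simp add: gm_verts_def emb_verts_def)
qed

text \<open>An arc attached to \<open>v\<close> goes to an arc attached to a vertex of
  \<open>gm_verts \<phi> v\<close>. Disjointness recovers \<open>v\<close> from the image, and on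
  \<open>nb G v\<close> injectivity is part of being a graphical map.\<close>

lemma noncollapsed_inj_darcs:
  assumes nd: "\<forall>v\<in>verts G. gm_verts \<phi> v \<noteq> {}"
  shows "inj_on (gm0 \<phi>) (darcs G)" "a \<in> darcs G \<Longrightarrow> gm0 \<phi> a \<in> darcs G'"
proof -
  note Gs = graph_simps[OF gm_graphs(1)]
  have D: "gm0 \<phi> a \<in> darcs G' \<and> tgt G' (gm0 \<phi> a) \<in> gm_verts \<phi> (tgt G a)" if "a \<in> darcs G" for a
    using noncollapsed_darc[of "tgt G a" a] nd that Gs(3) by (auto simp: nb_def)
  then show "gm0 \<phi> a \<in> darcs G'" if "a \<in> darcs G" using that by blast
  show "inj_on (gm0 \<phi>) (darcs G)"
  proof (rule inj_onI)
    fix a b assume ab: "a \<in> darcs G" "b \<in> darcs G" "gm0 \<phi> a = gm0 \<phi> b"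
    then have "tgt G a = tgt G b"
      using D[of a] D[of b] gm_disjoint[of "tgt G a" "tgt G b"] Gs(3) by auto
    then show "a = b"
      using inj_onD[OF gm_inj_nb[OF Gs(3)[OF ab(1)]], of a b] ab by (simp add: nb_def)
  qed
qed

lemma active_verts:
  assumes "active G G' \<phi>"
  shows "(\<Union>v\<in>verts G. gm_verts \<phi> v) = verts G'"
  using Emb_full_boundary(1)[OF im_data(1)] im_data(2,3) assms by (simp add: active_def bij_betw_def)

end

section \<open>Active factors of maps without collapsed vertices\<close>

lemma embedding_no_verts:
  fixes X Y :: "('a :: infinite, 'v) graph"
  assumes \<phi>: "graphical_map X Y \<phi>" and ne: "verts X = {}"
  defines "f \<equiv> \<lparr>onA = gm0 \<phi>, onD = (\<lambda>_. undefined), onV = (\<lambda>_. undefined)\<rparr>"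
  shows "embedding X Y f"
proof -
  interpret f: graphical X Y \<phi> by unfold_locales (rule \<phi>)
  obtain a where a: "a \<in> arcs X" "arcs X = {a, dag X a}" "darcs X = {}"
    using connected_no_verts[OF f.gm_graphs(2) graph_pregraph[OF f.gm_graphs(1)] ne] by metis
  have "nat_trans X Y f"
    using \<phi> a ne by (auto simp: nat_trans_def graphical_map_def f_def)
  then show ?thesis
    using f.gm_graphs graph_pregraph ne by (auto simp: embedding_def etale_def)
qed

lemma active_id:
  fixes X :: "('a :: infinite, 'v) graph"
  assumes "graph X" "connected X"
  shows "active X X (gm_id X)" "gm0 (gm_id X) ` arcs X = arcs X" "inj_on (gm0 (gm_id X)) (arcs X)"
proof -
  note i = gm_id[OF assms]
  have "bij_betw (gm0 (gm_id X)) (boundary X) (boundary X) \<longleftrightarrow> bij_betw id (boundary X) (boundary X)"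
    by (rule bij_betw_cong) (simp add: i boundary_def)
  then show "active X X (gm_id X)" using i by (simp add: active_def)
  show "gm0 (gm_id X) ` arcs X = arcs X" "inj_on (gm0 (gm_id X)) (arcs X)"
    using i by (simp_all add: inj_on_def)
qed

text \<open>The map is lifted through the embedding \<open>f\<close> that represents its image.
  Lifts of attached arcs are forced, representatives are lifted by
  \<open>pre_embedding_lift\<close>, and the two lifts fit together because ports
  correspond.\<close>

lemma noncollapsed_factor:
  fixes X Y :: "('a :: infinite, 'v) graph"
  assumes \<phi>: "graphical_map X Y \<phi>" and nd: "\<forall>v\<in>verts X. gm_verts \<phi> v \<noteq> {}" and ne: "verts X \<noteq> {}"
  obtains K \<phi>' f where "active X K \<phi>'" "embedding K Y f" "\<phi> = gmap_comp X K Y (emb_gmap K Y f) \<phi>'"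
    "inj_on (gm0 \<phi>') (arcs X)"
proof -
  interpret p: graphical X Y \<phi> by unfold_locales (rule \<phi>)
  note X = p.gm_graphs(1,2) and Y = p.gm_graphs(3,4)
  note Xs = graph_simps[OF X(1)] and Ys = graph_simps[OF Y(1)]
  note inj = p.noncollapsed_inj_darcs[OF nd]
  define c where "c = im X Y \<phi>"
  have c: "c \<in> Emb Y" "emb_verts c = (\<Union>v\<in>verts X. gm_verts \<phi> v)" "class_boundary c = gm0 \<phi> ` boundary X"
    using p.im_data by (simp_all add: c_def)
  define K where "K = rep_graph c"
  define f where "f = rep_map c"
  have f: "embedding K Y f" using Emb_rep(1)[OF c(1)] by (simp add: K_def f_def)
  have fV: "onV f ` verts K = (\<Union>v\<in>verts X. gm_verts \<phi> v)" and fB: "onA f ` boundary K = gm0 \<phi> ` boundary X"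
    using c by (simp_all add: K_def f_def emb_verts_def class_boundary_def)
  note fe = embedding_simps[OF f]
  note K = fe(1,2) and pe = fe(5)
  note Ks = graph_simps[OF K(1)] and fs = pre_embedding_simps[OF pe]
  have neK: "verts K \<noteq> {}" using fV ne nd by auto
  note dagX = graph_dag_boundary[OF X ne]
  note dagK = graph_dag_boundary[OF K neK]
  have injK: "b = b'" if "b \<in> boundary K" "b' \<in> boundary K" "onA f b = onA f b'" for b b'
    using pre_embedding_inj_boundary[OF pe] graph_pre_boundary[OF K(1)] that by (auto simp: inj_on_def)
  define q where "q x = inv_into (darcs K) (onA f) (gm0 \<phi> x)" for x
  \<comment> \<open>As in the lifting of embeddings, a boundary arc is lifted through its attached
    involute.\<close>
  define p where "p x = (if x \<in> darcs X then q x else dag K (q (dag X x)))" for x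
  have pD: "p x \<in> darcs K" "onA f (p x) = gm0 \<phi> x" if x: "x \<in> darcs X" for x
  proof -
    have "tgt Y (gm0 \<phi> x) \<in> onV f ` verts K" "gm0 \<phi> x \<in> darcs Y"
      using p.noncollapsed_darc[of "tgt X x" x] nd x Xs(3) unfolding fV by (auto simp: nb_def)
    then have "gm0 \<phi> x \<in> onD f ` darcs K" using pre_embedding_onD_image[OF pe] by simp
    then have "gm0 \<phi> x \<in> onA f ` darcs K" using fe(6) by (metis (no_types) image_cong)
    then show "p x \<in> darcs K" "onA f (p x) = gm0 \<phi> x"
      using x by (simp_all add: p_def q_def inv_into_into f_inv_into_f)
  qed
  have pB0: "p x = dag K (p (dag X x))" if "x \<in> boundary X" for x
    using that dagX[OF that] by (simp add: p_def boundary_def)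
  have pA: "p x \<in> arcs K \<and> onA f (p x) = gm0 \<phi> x" if x: "x \<in> arcs X" for x
  proof (cases "x \<in> darcs X")
    case True
    then show ?thesis using pD Ks(2) by blast
  next
    case False
    then have b: "x \<in> boundary X" using x by (simp add: boundary_def)
    have "onA f (p x) = dag Y (gm0 \<phi> (dag X x))"
      using pB0[OF b] pD[OF dagX(1)[OF b]] fs(4) Ks(2) by simp
    also have "\<dots> = gm0 \<phi> x" using p.gm0_simps x Xs Ys by simp
    finally show ?thesis using pB0[OF b] pD[OF dagX(1)[OF b]] Ks(1,2) by simp
  qed
  have pB: "p x \<in> boundary K" if b: "x \<in> boundary X" for x
  proof -
    note x = dagX[OF b]
    obtain b' where b': "b' \<in> boundary K" "onA f b' = gm0 \<phi> x" using fB b by (metis imageE imageI)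
    note d' = dagK[OF b'(1)]
    have "onA f (dag K b') = onA f (p (dag X x))"
      using b' d' fs(4) pD[OF x(1)] p.gm0_simps(2)[OF x(2)] by simp
    then have "dag K b' = p (dag X x)" using inj_onD[OF fe(10)] d' pD[OF x(1)] by blast
    then have "b' = p x" using pB0[OF b] d' Ks(5) by metis
    then show ?thesis using b' by simp
  qed
  have pdag: "p (dag X x) = dag K (p x)" if x: "x \<in> arcs X" for x
  proof (cases "x \<in> darcs X")
    case False
    then have b: "x \<in> boundary X" using x by (simp add: boundary_def)
    then show ?thesis using pB0[OF b] pD[OF dagX(1)[OF b]] Ks by simp
  next
    case xD: True
    show ?thesis
    proof (cases "dag X x \<in> darcs X")
      case False
      then have b: "dag X x \<in> boundary X" using x Xs by (simp add: boundary_def)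
      then show ?thesis using pB0[OF b] Xs x by simp
    next
      case True
      have eq: "onA f (dag K (p x)) = gm0 \<phi> (dag X x)"
        using pA[OF x] fs(4) p.gm0_simps(2)[OF x] by simp
      show ?thesis
      proof (cases "dag K (p x) \<in> darcs K")
        case k: True
        then show ?thesis using inj_onD[OF fe(10)] eq pD[OF True] by metis
      next
        \<comment> \<open>The edge cannot be cut in \<open>K\<close>: a boundary arc there would lie
          over the image of some boundary arc \<open>z\<close> of \<open>X\<close>, and injectivity
          on attached arcs gives \<open>z = dag X x\<close>, which is attached.\<close>
        case False
        then have "dag K (p x) \<in> boundary K" using pA[OF x] Ks(1) by (simp add: boundary_def)
        then have "gm0 \<phi> (dag X x) \<in> gm0 \<phi> ` boundary X" using fB eq by (metis imageI)
        then obtain z where z: "z \<in> boundary X" "gm0 \<phi> (dag X x) = gm0 \<phi> z" by auto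
        then have "gm0 \<phi> (dag X z) = gm0 \<phi> x"
          using p.gm0_simps dagX[OF z(1)] x Xs Ys(5) by metis
        then have "dag X z = x" using inj_onD[OF inj(1)] dagX[OF z(1)] xD by blast
        then have "z = dag X x" using dagX[OF z(1)] Xs(5) by metis
        then show ?thesis using z True by (simp add: boundary_def)
      qed
    qed
  qed
  have "\<exists>z. etale (p.reps v) K z \<and> inj_on (onV z) (verts (p.reps v)) \<and> nt_comp (p.reps v) f z = p.repm v"
    if v: "v \<in> verts X" for v
  proof -
    note r = p.reps_facts[OF v] and nv = bspec[OF nd v]
    note Hs = graph_simps[OF r(1)]
    have "verts (p.reps v) \<noteq> {}" using nv by (auto simp: gm_verts_def emb_verts_def)
    moreover have "onV (p.repm v) ` verts (p.reps v) \<subseteq> onV f ` verts K"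
      unfolding fV using v by (auto simp: gm_verts_def emb_verts_def)
    \<comment> \<open>If one end of an internal edge of a representative lay over the boundary of
      the image, the other end would lie over \<open>gm0 \<phi> (dag X z)\<close>; but the image of
      an arc attached to \<open>v\<close> does not lie under an internal edge of the
      representative.\<close>
    moreover have "onD (p.repm v) e \<notin> onA f ` pre_boundary K"
      if de: "d \<in> darcs (p.reps v)" "e \<in> darcs (p.reps v)" "dag (p.reps v) (incl (p.reps v) d) = incl (p.reps v) e" for d e
    proof
      assume "onD (p.repm v) e \<in> onA f ` pre_boundary K"
      then obtain z where z: "z \<in> boundary X" "gm0 \<phi> z = onD (p.repm v) e"
        using fB graph_pre_boundary[OF K(1)] by auto
      note dz = dagX[OF z(1)]
      have ed: "dag (p.reps v) e = d" "dag (p.reps v) d = e" using de Hs by auto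
      have "gm0 \<phi> (dag X z) = dag Y (onD (p.repm v) e)" using p.gm0_simps(2)[OF dz(2)] z by simp
      also have "\<dots> = onD (p.repm v) d"
        using pre_embedding_simps(4)[OF r(5), of e] pre_embedding_simps(5)[OF r(5)] Hs de ed by metis
      finally have eq: "onD (p.repm v) d = gm0 \<phi> (dag X z)" by simp
      have u: "tgt X (dag X z) \<in> verts X" using Xs(3) dz by simp
      have nbz: "dag X z \<in> nb X (tgt X (dag X z))" using dz by (simp add: nb_def)
      have "tgt X (dag X z) = v"
        using p.noncollapsed_darc(2)[OF u bspec[OF nd u] nbz] p.gm_verts_image(2)[OF v de(1)]
          eq p.gm_disjoint[OF u v] by simp
      then show False using p.internal_not_nb[OF v nv _ de(1)] nbz eq ed de by auto
    qed
    ultimately show ?thesis using pre_embedding_lift[OF pe r(5)] by metis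
  qed
  then obtain z where z: "\<And>v. v \<in> verts X \<Longrightarrow> etale (p.reps v) K (z v)"
    "\<And>v. v \<in> verts X \<Longrightarrow> inj_on (onV (z v)) (verts (p.reps v))"
    "\<And>v. v \<in> verts X \<Longrightarrow> nt_comp (p.reps v) f (z v) = p.repm v" by metis
  have zp: "pre_embedding (p.reps v) K (z v)" if "v \<in> verts X" for v
    using z(1,2)[OF that] p.reps_facts[OF that] K by (simp add: pre_embedding_def)
  have zA: "onA f (onA (z v) a) = onA (p.repm v) a" if "v \<in> verts X" "a \<in> arcs (p.reps v)" for v a
    using z(3)[OF that(1)] that nt_comp_apply(1) by metis
  have zD: "onD f (onD (z v) a) = onD (p.repm v) a" if "v \<in> verts X" "a \<in> darcs (p.reps v)" for v a
    using z(3)[OF that(1)] that nt_comp_apply(2) by metis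
  have zV: "onV f (onV (z v) a) = onV (p.repm v) a" if "v \<in> verts X" "a \<in> verts (p.reps v)" for v a
    using z(3)[OF that(1)] that nt_comp_apply(3) by metis
  note cl = emb_class_data[OF zp]
  have fcl: "onV f ` emb_verts (emb_class K (p.reps v) (z v)) = gm_verts \<phi> v" if v: "v \<in> verts X" for v
  proof -
    have "gm_verts \<phi> v = onV (p.repm v) ` verts (p.reps v)" by (simp add: gm_verts_def emb_verts_def)
    then show ?thesis unfolding cl(2)[OF v] image_image using zV[OF v] by (metis (no_types) image_cong)
  qed
  \<comment> \<open>The involutes of both sides are attached arcs of \<open>K\<close>, hence
    determined by their images under \<open>f\<close>.\<close>
  have ports: "onA (z v) (port \<phi> v (dag X a)) = p (dag X a)" if v: "v \<in> verts X" and a: "a \<in> nb X v" for v a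
  proof -
    note r = p.reps_facts[OF v]
    note Hs = graph_simps[OF r(1)] and zs = pre_embedding_simps[OF zp[OF v]]
    have aX: "a \<in> darcs X" "a \<in> arcs X" using a p.nb_arcs by auto
    let ?b = "port \<phi> v (dag X a)"
    have b: "?b \<in> arcs (p.reps v)" using p.port(1)[OF v a] by (simp add: boundary_def)
    obtain e where e: "e \<in> darcs (p.reps v)" "dag (p.reps v) ?b = e" "onD (p.repm v) e = gm0 \<phi> a"
      using p.port_darc[OF v bspec[OF nd v] a] .
    have eA: "onA (z v) e = onD (z v) e" using zs(5)[OF e(1)] Hs(6)[OF e(1)] by simp
    have "onA f (onD (z v) e) = onA f (p a)"
      using fe(6) zs(2)[OF e(1)] zD[OF v e(1)] e(3) pD[OF aX(1)] by simp
    then have "onD (z v) e = p a" using inj_onD[OF fe(10)] zs(2)[OF e(1)] pD[OF aX(1)] by blast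
    then have "dag K (onA (z v) ?b) = p a" using zs(4)[OF b] e(2) eA by simp
    then show ?thesis using pdag[OF aX(2)] Ks(5) zs(1)[OF b] by metis
  qed
  define \<phi>' where "\<phi>' = \<lparr>gm0 = restrict p (arcs X), gm1 = (\<lambda>v\<in>verts X. emb_class K (p.reps v) (z v))\<rparr>"
  have \<phi>'0: "gm0 \<phi>' x = p x" if "x \<in> arcs X" for x using that by (simp add: \<phi>'_def)
  have \<phi>'1: "gm1 \<phi>' v = emb_class K (p.reps v) (z v)" if "v \<in> verts X" for v using that by (simp add: \<phi>'_def)
  have \<phi>'V: "gm_verts \<phi>' v = emb_verts (emb_class K (p.reps v) (z v))" if "v \<in> verts X" for v
    using \<phi>'1[OF that] by (simp add: gm_verts_def)
  have pinj: "inj_on p (darcs X)" "inj_on p (boundary X)"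
  proof -
    show "inj_on p (darcs X)" using pD(2) inj_onD[OF inj(1)] by (metis inj_onI)
    show "inj_on p (boundary X)" using pA dagX(2) inj_onD[OF p.gm0_inj_boundary] by (metis inj_onI)
  qed
  have gm: "graphical_map X K \<phi>'"
    unfolding graphical_map_iff
  proof (intro conjI ballI impI)
    show "gm0 \<phi>' \<in> arcs X \<rightarrow>\<^sub>E arcs K" using pA by (auto simp: \<phi>'_def)
    show "gm1 \<phi>' \<in> verts X \<rightarrow>\<^sub>E Emb K" using cl(1) by (auto simp: \<phi>'_def)
    show "gm0 \<phi>' (dag X a) = dag K (gm0 \<phi>' a)" if "a \<in> arcs X" for a
      using that \<phi>'0 pdag Xs(1) by simp
    show "v = u" if vu: "v \<in> verts X" "u \<in> verts X" "gm_verts \<phi>' v \<inter> gm_verts \<phi>' u \<noteq> {}" for v u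
    proof -
      obtain w where "w \<in> gm_verts \<phi>' v" "w \<in> gm_verts \<phi>' u" using vu by blast
      then have "onV f w \<in> gm_verts \<phi> v" "onV f w \<in> gm_verts \<phi> u"
        using fcl[OF vu(1)] fcl[OF vu(2)] \<phi>'V vu by auto
      then show ?thesis using p.gm_disjoint vu by blast
    qed
    fix v assume v: "v \<in> verts X"
    have nbX: "a \<in> darcs X" "a \<in> arcs X" if "a \<in> nb X v" for a using that p.nb_arcs by auto
    show "inj_on (gm0 \<phi>') (nb X v)"
    proof (rule inj_onI)
      fix a b assume ab: "a \<in> nb X v" "b \<in> nb X v" "gm0 \<phi>' a = gm0 \<phi>' b"
      then have "p a = p b" using \<phi>'0 nbX by simp
      then show "a = b" using inj_onD[OF pinj(1)] nbX ab by blast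
    qed
    have "boundary (p.reps v) = (\<lambda>a. port \<phi> v (dag X a)) ` nb X v"
    proof (intro subset_antisym subsetI)
      fix b assume "b \<in> boundary (p.reps v)"
      then show "b \<in> (\<lambda>a. port \<phi> v (dag X a)) ` nb X v" using p.port_surj[OF v] by blast
    qed (use p.port(1)[OF v] in auto)
    then have "class_boundary (gm1 \<phi>' v) = onA (z v) ` (\<lambda>a. port \<phi> v (dag X a)) ` nb X v"
      using \<phi>'1[OF v] cl(3)[OF v] graph_pre_boundary[OF p.reps_facts(1)[OF v]] by simp
    also have "\<dots> = (\<lambda>a. gm0 \<phi>' (dag X a)) ` nb X v"
      unfolding image_image using ports[OF v] \<phi>'0 nbX Xs(1) by (intro image_cong) auto
    finally show "class_boundary (gm1 \<phi>' v) = (\<lambda>a. gm0 \<phi>' (dag X a)) ` nb X v" .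
  next
    obtain v where v: "v \<in> verts X" using ne by auto
    then have "gm_verts \<phi>' v \<noteq> {}" using fcl[OF v] nd \<phi>'V by auto
    then show "\<exists>v\<in>verts X. gm_verts \<phi>' v \<noteq> {}" using v by blast
  qed (use X K in auto)
  have "bij_betw p (boundary X) (boundary K)"
    unfolding bij_betw_def
  proof (intro conjI subset_antisym subsetI)
    fix b assume b: "b \<in> boundary K"
    then obtain x where x: "x \<in> boundary X" "onA f b = gm0 \<phi> x" using fB by (metis imageE imageI)
    then have "b = p x" using injK[OF b pB[OF x(1)]] pA dagX(2) by simp
    then show "b \<in> p ` boundary X" using x by simp
  qed (use pinj pB in auto)
  moreover have "bij_betw (gm0 \<phi>') (boundary X) (boundary K) \<longleftrightarrow> bij_betw p (boundary X) (boundary K)"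
    by (rule bij_betw_cong) (simp add: \<phi>'0 boundary_def)
  ultimately have act: "active X K \<phi>'" using gm by (simp add: active_def)
  have "inj_on (gm0 \<phi>') (arcs X)"
  proof (rule inj_onI)
    fix x y assume xy: "x \<in> arcs X" "y \<in> arcs X" "gm0 \<phi>' x = gm0 \<phi>' y"
    then have eq: "p x = p y" using \<phi>'0 by simp
    \<comment> \<open>Attached arcs and boundary arcs are not identified with each other, so
      injectivity may be checked on each kind separately.\<close>
    have iff: "p x \<in> darcs K \<longleftrightarrow> x \<in> darcs X" if "x \<in> arcs X" for x
      using that pD(1)[of x] pB[of x] by (auto simp: boundary_def)
    show "x = y"
      using iff[OF xy(1)] iff[OF xy(2)] eq inj_onD[OF pinj(1) eq] inj_onD[OF pinj(2) eq] xy
      by (auto simp: boundary_def)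
  qed
  moreover have "\<phi> = gmap_comp X K Y (emb_gmap K Y f) \<phi>'"
  proof (rule gmap_eqI[OF \<phi>])
    note co = gmap_comp[OF gm emb_gmap(1)[OF f]]
    show "graphical_map X Y (gmap_comp X K Y (emb_gmap K Y f) \<phi>')" by (rule co)
    show "gm0 \<phi> a = gm0 (gmap_comp X K Y (emb_gmap K Y f) \<phi>') a" if "a \<in> arcs X" for a
      using co(2)[OF that] emb_gmap(2)[OF f] \<phi>'0[OF that] pA[OF that] by simp
    show "gm_verts \<phi> v = gm_verts (gmap_comp X K Y (emb_gmap K Y f) \<phi>') v" if v: "v \<in> verts X" for v
    proof -
      have "gm_verts (gmap_comp X K Y (emb_gmap K Y f) \<phi>') v = (\<Union>w\<in>gm_verts \<phi>' v. {onV f w})"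
        unfolding co(3)[OF v] using emb_gmap(3)[OF f] gm_verts_subset[OF gm v] by (intro SUP_cong) auto
      then show ?thesis using fcl[OF v] \<phi>'V[OF v] by auto
    qed
  qed
  ultimately show ?thesis using that act f by blast
qed

text \<open>If the active factor collapsed a vertex with arcs \<open>x\<close> and \<open>y\<close>,
  its injectivity would force \<open>dag X x = y\<close>, a loop that cannot occur. Conversely, a
  source without vertices is itself embedded by the map, and otherwise the map is factored through
  its image.\<close>

lemma U_plus_iff:
  fixes X Y :: "('a :: infinite, 'v) graph"
  shows "\<phi> \<in> U_plus X Y \<longleftrightarrow> graphical_map X Y \<phi> \<and> (\<forall>v\<in>verts X. gm_verts \<phi> v \<noteq> {})"
proof (intro iffI conjI ballI)
  assume "\<phi> \<in> U_plus X Y"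
  then obtain K \<phi>' f where \<phi>: "graphical_map X Y \<phi>" and \<phi>': "graphical_map X K \<phi>'" and f: "embedding K Y f"
    and eq: "\<phi> = gmap_comp X K Y (emb_gmap K Y f) \<phi>'" and inj: "inj_on (gm0 \<phi>') (arcs X)"
    by (auto simp: U_plus_def active_def)
  show "graphical_map X Y \<phi>" by (rule \<phi>)
  interpret p: graphical X K \<phi>' by unfold_locales (rule \<phi>')
  fix v assume v: "v \<in> verts X"
  have "gm_verts \<phi>' v \<noteq> {}"
  proof
    assume e: "gm_verts \<phi>' v = {}"
    obtain x y where xy: "nb X v = {x, y}" "gm0 \<phi>' (dag X x) = gm0 \<phi>' y"
      using p.collapsed_ports[OF v e] .
    have "x \<in> arcs X" "y \<in> arcs X" using xy p.nb_arcs(2)[of _ v] by auto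
    then have "dag X x = y" using inj_onD[OF inj xy(2)] graph_simps(1)[OF p.gm_graphs(1)] by blast
    then show False using p.collapsed_no_loop[OF v e xy(1)] by simp
  qed
  then obtain w where w: "w \<in> gm_verts \<phi>' v" by blast
  then have "onV f w \<in> gm_verts \<phi> v"
    using gm_verts_subset[OF \<phi>' v] emb_gmap(3)[OF f]
    unfolding eq gmap_comp(3)[OF \<phi>' emb_gmap(1)[OF f] v] by blast
  then show "gm_verts \<phi> v \<noteq> {}" by blast
next
  assume *: "graphical_map X Y \<phi> \<and> (\<forall>v\<in>verts X. gm_verts \<phi> v \<noteq> {})"
  then have \<phi>: "graphical_map X Y \<phi>" by blast
  interpret p: graphical X Y \<phi> by unfold_locales (rule \<phi>)
  show "\<phi> \<in> U_plus X Y"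
  proof (cases "verts X = {}")
    case True
    let ?f = "\<lparr>onA = gm0 \<phi>, onD = (\<lambda>_. undefined), onV = (\<lambda>_. undefined)\<rparr>"
    have f: "embedding X Y ?f" by (rule embedding_no_verts[OF \<phi> True])
    note i = active_id[OF p.gm_graphs(1,2)] and e = emb_gmap[OF f]
    have ig: "graphical_map X X (gm_id X)" using gm_id p.gm_graphs by blast
    have "\<phi> = gmap_comp X X Y (emb_gmap X Y ?f) (gm_id X)"
      unfolding gmap_comp_id(1)[OF e(1)] using e(1,2) True by (intro gmap_eqI[OF \<phi>]) simp_all
    then show ?thesis using \<phi> f i unfolding U_plus_def by blast
  next
    case False
    obtain K \<phi>' f where "active X K \<phi>'" "embedding K Y f" "\<phi> = gmap_comp X K Y (emb_gmap K Y f) \<phi>'"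
      "inj_on (gm0 \<phi>') (arcs X)"
      using noncollapsed_factor[OF \<phi> _ False] * by blast
    then show ?thesis using \<phi> unfolding U_plus_def by blast
  qed
qed

section \<open>Smoothing a bivalent vertex\<close>

locale bivalent =
  fixes X :: "('a :: infinite, 'v) graph" and v x y
  assumes X: "graph X" "connected X" and v: "v \<in> verts X" and nb: "nb X v = {x, y}"
    and xy: "x \<noteq> y" "dag X x \<noteq> y"
begin

text \<open>The two edges at \<open>v\<close> lose their inner halves \<open>x\<close> and
  \<open>y\<close>, and the outer halves are joined to a single edge.\<close>

definition smooth :: "('a, 'v) graph" where
  "smooth = \<lparr>arcs = arcs X - {x, y}, darcs = darcs X - {x, y}, verts = verts X - {v},
    dag = (\<lambda>a\<in>arcs X - {x, y}. if a = dag X x then dag X y else if a = dag X y then dag X x else dag X a),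
    incl = (\<lambda>d\<in>darcs X - {x, y}. d), tgt = restrict (tgt X) (darcs X - {x, y})\<rparr>"

text \<open>The values at \<open>x\<close> and \<open>y\<close> are forced by the involution:
  \<open>dag X x\<close> and \<open>dag X y\<close> stay fixed and become involutes of each other in
  \<open>smooth\<close>.\<close>

definition smooth_arc :: "'a \<Rightarrow> 'a" where
  "smooth_arc a = (if a = x then dag X y else if a = y then dag X x else a)"

definition smooth_map :: "('a, 'v) gmap" where
  "smooth_map = \<lparr>gm0 = restrict smooth_arc (arcs X), gm1 = (\<lambda>u\<in>verts X.
     if u = v then emb_class smooth (exc_edge :: (bool, bool, 'v) diagram) (pick_arc smooth (dag X x))
     else emb_class smooth (star smooth u) (star_emb smooth u))\<rparr>"

lemmas Xs = graph_simps[OF X(1)]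

lemma ends:
  "x \<in> darcs X" "y \<in> darcs X" "x \<in> arcs X" "y \<in> arcs X" "tgt X x = v" "tgt X y = v"
  "dag X y \<noteq> x" "dag X x \<in> arcs X" "dag X y \<in> arcs X" "dag X x \<noteq> x" "dag X y \<noteq> y"
  "dag X (dag X x) = x" "dag X (dag X y) = y" "dag X x \<noteq> dag X y"
proof -
  show *: "x \<in> darcs X" "y \<in> darcs X" "tgt X x = v" "tgt X y = v" using nb by (auto simp: nb_def)
  then show **: "x \<in> arcs X" "y \<in> arcs X" "dag X x \<in> arcs X" "dag X y \<in> arcs X" "dag X x \<noteq> x"
    "dag X y \<noteq> y" "dag X (dag X x) = x" "dag X (dag X y) = y" using Xs by auto
  show "dag X y \<noteq> x" "dag X x \<noteq> dag X y" using ** xy by metis+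
qed

lemma smooth_simps:
  "arcs smooth = arcs X - {x, y}" "darcs smooth = darcs X - {x, y}" "verts smooth = verts X - {v}"
  "boundary smooth = boundary X" "d \<in> darcs smooth \<Longrightarrow> tgt smooth d = tgt X d"
  "d \<in> darcs smooth \<Longrightarrow> incl smooth d = d"
  using ends by (auto simp: smooth_def boundary_def)

lemma smooth_dag:
  "dag smooth (dag X x) = dag X y" "dag smooth (dag X y) = dag X x"
  "a \<in> arcs X \<Longrightarrow> a \<notin> {x, y, dag X x, dag X y} \<Longrightarrow> dag smooth a = dag X a"
  using ends xy by (auto simp: smooth_def)

lemma smooth_dag_other:
  assumes "a \<in> arcs X" "a \<notin> {x, y, dag X x, dag X y}"
  shows "dag X a \<in> arcs X" "dag X a \<notin> {x, y, dag X x, dag X y}"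
proof -
  show "dag X a \<in> arcs X" using Xs(1)[OF assms(1)] .
  have "dag X a = b \<Longrightarrow> a = dag X b" for b using Xs(5)[OF assms(1)] by metis
  then show "dag X a \<notin> {x, y, dag X x, dag X y}" using assms(2) ends(12,13) by auto
qed

lemma smooth_graph: "graph smooth"
proof -
  have tgt: "tgt X d \<noteq> v" if "d \<in> darcs X" "d \<notin> {x, y}" for d
    using that nb by (auto simp: nb_def)
  have "dag smooth a \<in> arcs smooth \<and> dag smooth a \<noteq> a \<and> dag smooth (dag smooth a) = a"
    if a: "a \<in> arcs smooth" for a
  proof (cases "a = dag X x \<or> a = dag X y")
    case True
    then show ?thesis using smooth_dag ends xy by (auto simp: smooth_simps)
  next
    case False
    then have o: "a \<in> arcs X" "a \<notin> {x, y, dag X x, dag X y}" using a by (auto simp: smooth_simps)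
    show ?thesis
      using smooth_dag(3)[OF o] smooth_dag(3)[OF smooth_dag_other[OF o]] smooth_dag_other[OF o] Xs(4,5)[OF o(1)]
      by (simp add: smooth_simps)
  qed
  moreover have "diagram X" by (rule graph_diagram[OF X(1)])
  moreover have "dag smooth \<in> extensional (arcs smooth)" by (simp add: smooth_def)
  ultimately show ?thesis
    using tgt Xs(2,3) unfolding graph_def diagram_def PiE_iff
    by (auto simp: smooth_simps) (auto simp: smooth_def)
qed

text \<open>A closed part of \<open>smooth\<close> extends to a closed part of \<open>X\<close>: it
  receives \<open>x\<close>, \<open>y\<close> and \<open>v\<close> exactly if it contains the merged
  edge.\<close>

lemma smooth_connected: "connected smooth"
proof -
  note d = graph_diagram[OF smooth_graph] and dX = graph_diagram[OF X(1)]
  have "P = arcs smooth \<and> Q = verts smooth" if cl: "closed_part smooth P Q" and ne: "P \<noteq> {} \<or> Q \<noteq> {}" for P Q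
  proof -
    have P: "P \<subseteq> arcs X - {x, y}" and Q: "Q \<subseteq> verts X - {v}"
      using cl by (auto simp: closed_part_def smooth_simps)
    have dagP: "dag smooth a \<in> P \<longleftrightarrow> a \<in> P" if "a \<in> arcs smooth" for a
      using cl that by (simp add: closed_part_def)
    have tgtP: "d \<in> P \<longleftrightarrow> tgt X d \<in> Q" if "d \<in> darcs X" "d \<notin> {x, y}" for d
    proof -
      have d: "d \<in> darcs smooth" using that by (simp add: smooth_simps(2))
      then have "incl smooth d \<in> P \<longleftrightarrow> tgt smooth d \<in> Q" using cl by (simp add: closed_part_def)
      then show ?thesis using smooth_simps(5,6)[OF d] by simp
    qed
    have xyP: "dag X x \<in> P \<longleftrightarrow> dag X y \<in> P"
      using dagP[of "dag X y"] smooth_dag(2) ends by (simp add: smooth_simps)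
    define b where "b \<longleftrightarrow> dag X x \<in> P"
    define P' where "P' = P \<union> (if b then {x, y} else {})"
    define Q' where "Q' = Q \<union> (if b then {v} else {})"
    have mem: "a \<in> P' \<longleftrightarrow> (if a \<in> {x, y} then b else a \<in> P)" for a using P by (auto simp: P'_def)
    have "closed_part X P' Q'"
      unfolding closed_part_def
    proof (intro conjI ballI)
      fix a assume a: "a \<in> arcs X"
      show "dag X a \<in> P' \<longleftrightarrow> a \<in> P'"
      proof (cases "a \<in> {x, y, dag X x, dag X y}")
        case True
        then show ?thesis using ends xy xyP by (auto simp: mem b_def)
      next
        case False
        note o = smooth_dag_other[OF a False]
        then have "dag X a \<in> P \<longleftrightarrow> a \<in> P"
          using dagP[of a] smooth_dag(3)[OF a False] a False by (simp add: smooth_simps)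
        then show ?thesis using o False by (simp add: mem)
      qed
    next
      fix d assume d: "d \<in> darcs X"
      show "incl X d \<in> P' \<longleftrightarrow> tgt X d \<in> Q'"
      proof (cases "d \<in> {x, y}")
        case True
        then show ?thesis using ends Xs(6) d Q by (auto simp: mem Q'_def)
      next
        case False
        then have "tgt X d \<noteq> v" using nb d by (auto simp: nb_def)
        then show ?thesis using tgtP[OF d False] False Xs(6)[OF d] by (simp add: mem Q'_def)
      qed
    qed (use P Q ends v in \<open>auto simp: P'_def Q'_def\<close>)
    moreover have "P' \<noteq> {} \<or> Q' \<noteq> {}" using ne by (auto simp: P'_def Q'_def)
    ultimately have "P' = arcs X" "Q' = verts X" using connectedD[OF X(2) dX] by blast+
    then show ?thesis using P Q by (auto simp: smooth_simps P'_def Q'_def split: if_splits)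
  qed
  moreover have "nonempty smooth" using ends xy by (auto simp: nonempty_def smooth_simps)
  ultimately show ?thesis unfolding connected_iff[OF d] by blast
qed

lemma smooth_nb:
  assumes "u \<in> verts smooth" shows "nb smooth u = nb X u"
proof -
  have "u \<noteq> v" using assms by (simp add: smooth_simps)
  then have "d \<in> darcs smooth \<and> tgt smooth d = u \<longleftrightarrow> d \<in> darcs X \<and> tgt X d = u" for d
    using ends(5,6) smooth_simps(5)[of d] by (cases "d \<in> {x, y}") (auto simp: smooth_simps(2))
  then show ?thesis by (simp add: nb_def)
qed

lemma smooth_arc:
  "a \<in> arcs X \<Longrightarrow> smooth_arc a \<in> arcs smooth" "a \<in> arcs smooth \<Longrightarrow> smooth_arc a = a"
  "a \<in> arcs X \<Longrightarrow> smooth_arc (dag X a) = dag smooth (smooth_arc a)"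
proof -
  show "a \<in> arcs X \<Longrightarrow> smooth_arc a \<in> arcs smooth" "a \<in> arcs smooth \<Longrightarrow> smooth_arc a = a"
    using ends xy by (auto simp: smooth_arc_def smooth_simps)
  show "smooth_arc (dag X a) = dag smooth (smooth_arc a)" if a: "a \<in> arcs X"
  proof (cases "a \<in> {x, y, dag X x, dag X y}")
    case True
    then show ?thesis using ends xy smooth_dag by (auto simp: smooth_arc_def)
  next
    case False
    then show ?thesis using smooth_dag(3)[OF a False] smooth_dag_other[OF a False] by (auto simp: smooth_arc_def)
  qed
qed

lemma smooth_map:
  "graphical_map X smooth smooth_map" "a \<in> arcs X \<Longrightarrow> gm0 smooth_map a = smooth_arc a"
  "u \<in> verts X \<Longrightarrow> gm_verts smooth_map u = (if u = v then {} else {u})"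
  "smooth_map \<in> U_minus X smooth"
proof -
  note S = smooth_graph smooth_connected
  show A: "gm0 smooth_map a = smooth_arc a" if "a \<in> arcs X" for a
    using that by (simp add: smooth_map_def)
  have dx: "dag X x \<in> arcs smooth" using ends xy by (simp add: smooth_simps)
  note e = emb_class_data[OF pre_embedding_pick_arc[OF S dx, where 'd = bool and 'w = 'v]]
  note st = star_class_data[OF S]
  have V1: "gm1 smooth_map u = (if u = v then emb_class smooth (exc_edge :: (bool, bool, 'v) diagram) (pick_arc smooth (dag X x))
     else emb_class smooth (star smooth u) (star_emb smooth u))" if "u \<in> verts X" for u
    using that by (simp add: smooth_map_def)
  show V: "gm_verts smooth_map u = (if u = v then {} else {u})" if "u \<in> verts X" for u
    using V1[OF that] e(2) st(2)[of u] that by (simp add: gm_verts_def smooth_simps exc_edge_def)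
  show g: "graphical_map X smooth smooth_map"
    unfolding graphical_map_iff
  proof (intro conjI ballI impI)
    show "gm0 smooth_map \<in> arcs X \<rightarrow>\<^sub>E arcs smooth"
      using smooth_arc(1) by (auto simp: smooth_map_def)
    show "gm1 smooth_map \<in> verts X \<rightarrow>\<^sub>E Emb smooth"
      using e(1) st(1) by (auto simp: smooth_map_def smooth_simps)
    show "gm0 smooth_map (dag X a) = dag smooth (gm0 smooth_map a)" if "a \<in> arcs X" for a
      using that A Xs(1) smooth_arc(3) by simp
    show "u = w" if "u \<in> verts X" "w \<in> verts X" "gm_verts smooth_map u \<inter> gm_verts smooth_map w \<noteq> {}" for u w
      using that V by (auto split: if_splits)
    fix u assume u: "u \<in> verts X"
    have nbA: "a \<in> arcs X" if "a \<in> nb X u" for a using that Xs(2) by (auto simp: nb_def)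
    show "inj_on (gm0 smooth_map) (nb X u)"
    proof (cases "u = v")
      case True
      then show ?thesis using A ends xy nb by (auto simp: smooth_arc_def inj_on_def)
    next
      case False
      then have "a \<notin> {x, y}" if "a \<in> nb X u" for a using that ends by (auto simp: nb_def)
      then show ?thesis using A nbA by (auto simp: inj_on_def smooth_arc_def)
    qed
    show "class_boundary (gm1 smooth_map u) = (\<lambda>a. gm0 smooth_map (dag X a)) ` nb X u"
    proof (cases "u = v")
      case True
      have "class_boundary (gm1 smooth_map u) = {dag X x, dag X y}"
        using V1[OF u] True e(3) smooth_dag(1) by (auto simp: exc_edge_def pick_arc_def pre_boundary_def UNIV_bool)
      then show ?thesis using True nb A ends xy by (auto simp: smooth_arc_def)
    next
      case False
      then have us: "u \<in> verts smooth" using u by (simp add: smooth_simps)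
      have "class_boundary (gm1 smooth_map u) = dag smooth ` nb X u"
        using V1[OF u] False st(3)[OF us] smooth_nb[OF us] by simp
      also have "\<dots> = (\<lambda>a. gm0 smooth_map (dag X a)) ` nb X u"
      proof (rule image_cong)
        fix a assume a: "a \<in> nb X u"
        then have "a \<in> arcs smooth" using nbA False ends by (auto simp: smooth_simps nb_def)
        then show "dag smooth a = gm0 smooth_map (dag X a)"
          using smooth_arc(2,3) A Xs(1) nbA[OF a] by simp
      qed simp
      finally show ?thesis .
    qed
  next
    assume b: "boundary X = {}"
    \<comment> \<open>Otherwise, as there is no boundary, \<open>x\<close> and \<open>y\<close>
      would be the only arcs of \<open>X\<close> and hence form a loop.\<close>
    have "verts X \<noteq> {v}"
    proof
      assume "verts X = {v}"
      then have "darcs X = {x, y}" using nb Xs(3) by (auto simp: nb_def)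
      then have "arcs X = {x, y}" using b Xs(2) by (auto simp: boundary_def)
      then show False using ends xy by auto
    qed
    then obtain u where "u \<in> verts X" "u \<noteq> v" using v by blast
    then show "\<exists>u\<in>verts X. gm_verts smooth_map u \<noteq> {}" using V by auto
  qed (use X S in auto)
  have id: "gm0 smooth_map a = a" if "a \<in> arcs smooth" for a
    using that A smooth_arc(2) by (simp add: smooth_simps)
  have "bij_betw (gm0 smooth_map) (boundary X) (boundary X) \<longleftrightarrow> bij_betw id (boundary X) (boundary X)"
    by (rule bij_betw_cong) (use id smooth_simps(4) in \<open>auto simp: boundary_def\<close>)
  moreover have "gm0 smooth_map ` arcs X = arcs smooth"
  proof (intro subset_antisym subsetI)
    fix a assume "a \<in> arcs smooth"
    then show "a \<in> gm0 smooth_map ` arcs X"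
      using id by (intro image_eqI[of _ _ a]) (auto simp: smooth_simps)
  qed (use A smooth_arc(1) in auto)
  ultimately show "smooth_map \<in> U_minus X smooth"
    using g by (simp add: U_minus_def active_def smooth_simps(4))
qed

text \<open>A map collapsing \<open>v\<close> agrees on \<open>x\<close> and \<open>dag X y\<close>,
  and on \<open>y\<close> and \<open>dag X x\<close>. So it is determined by its restriction to
  \<open>smooth\<close>, and the restriction respects the merged edge.\<close>

lemma smooth_factor:
  assumes \<psi>: "graphical_map X Y \<psi>" and c: "gm_verts \<psi> v = {}"
  obtains \<psi>' where "graphical_map smooth Y \<psi>'" "gmap_comp X smooth Y \<psi>' smooth_map = \<psi>"
    "\<And>u. u \<in> verts smooth \<Longrightarrow> gm_verts \<psi>' u = gm_verts \<psi> u"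
    "\<psi> \<in> U_minus X Y \<Longrightarrow> \<psi>' \<in> U_minus smooth Y"
proof -
  interpret p: graphical X Y \<psi> by unfold_locales (rule \<psi>)
  note sw = p.collapsed_swap(2,3)[OF v c nb]
  define \<psi>' where "\<psi>' = \<lparr>gm0 = restrict (gm0 \<psi>) (arcs smooth), gm1 = restrict (gm1 \<psi>) (verts smooth)\<rparr>"
  have A: "gm0 \<psi>' a = gm0 \<psi> a" if "a \<in> arcs smooth" for a using that by (simp add: \<psi>'_def)
  have V: "gm_verts \<psi>' u = gm_verts \<psi> u" if "u \<in> verts smooth" for u
    using that by (simp add: \<psi>'_def gm_verts_def)
  have dag: "gm0 \<psi> (dag smooth a) = gm0 \<psi> (dag X a)" if a: "a \<in> arcs smooth" for a
  proof (cases "a = dag X x \<or> a = dag X y")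
    case True
    then show ?thesis using smooth_dag sw ends by auto
  next
    case False
    then show ?thesis using smooth_dag(3)[of a] a by (auto simp: smooth_simps)
  qed
  have sub: "arcs smooth \<subseteq> arcs X" "verts smooth \<subseteq> verts X" by (auto simp: smooth_simps)
  have arc: "gm0 \<psi> (smooth_arc a) = gm0 \<psi> a" if "a \<in> arcs X" for a
    using sw by (auto simp: smooth_arc_def)
  note Ss = graph_simps[OF smooth_graph]
  have g: "graphical_map smooth Y \<psi>'"
    unfolding graphical_map_iff
  proof (intro conjI ballI impI)
    show "gm0 \<psi>' \<in> arcs smooth \<rightarrow>\<^sub>E arcs Y" using p.gm0_simps(1) sub by (auto simp: \<psi>'_def)
    show "gm1 \<psi>' \<in> verts smooth \<rightarrow>\<^sub>E Emb Y" using p.gm1_Emb sub by (auto simp: \<psi>'_def)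
    show "gm0 \<psi>' (dag smooth a) = dag Y (gm0 \<psi>' a)" if "a \<in> arcs smooth" for a
      using that A dag Ss(1) p.gm0_simps(2) sub by auto
    show "u = w" if "u \<in> verts smooth" "w \<in> verts smooth" "gm_verts \<psi>' u \<inter> gm_verts \<psi>' w \<noteq> {}" for u w
      using that V p.gm_disjoint sub by blast
    fix u assume u: "u \<in> verts smooth"
    have uX: "u \<in> verts X" using u sub by blast
    have nbA: "a \<in> arcs smooth" if "a \<in> nb X u" for a
      using that Ss(2) smooth_nb[OF u] by (auto simp: nb_def)
    have "inj_on (gm0 \<psi>') (nb smooth u) \<longleftrightarrow> inj_on (gm0 \<psi>) (nb X u)"
      unfolding smooth_nb[OF u] using A nbA by (intro inj_on_cong) auto
    then show "inj_on (gm0 \<psi>') (nb smooth u)" using p.gm_inj_nb[OF uX] by simp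
    have "class_boundary (gm1 \<psi>' u) = (\<lambda>a. gm0 \<psi> (dag X a)) ` nb X u"
      using u p.gm_class_boundary[OF uX] by (simp add: \<psi>'_def)
    also have "\<dots> = (\<lambda>a. gm0 \<psi>' (dag smooth a)) ` nb smooth u"
      unfolding smooth_nb[OF u] using A dag nbA Ss(1) by (intro image_cong) auto
    finally show "class_boundary (gm1 \<psi>' u) = (\<lambda>a. gm0 \<psi>' (dag smooth a)) ` nb smooth u" .
  next
    assume "boundary smooth = {}"
    then obtain u where u: "u \<in> verts X" "gm_verts \<psi> u \<noteq> {}" using p.gm_nonempty by (auto simp: smooth_simps)
    then have "u \<in> verts smooth" using c by (auto simp: smooth_simps)
    then show "\<exists>u\<in>verts smooth. gm_verts \<psi>' u \<noteq> {}" using u V by auto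
  qed (use smooth_graph smooth_connected p.gm_graphs in auto)
  note co = gmap_comp[OF smooth_map(1) g]
  have "gmap_comp X smooth Y \<psi>' smooth_map = \<psi>"
  proof (rule gmap_eqI[OF co(1) \<psi>])
    show "gm0 (gmap_comp X smooth Y \<psi>' smooth_map) a = gm0 \<psi> a" if "a \<in> arcs X" for a
      using co(2)[OF that] smooth_map(2)[OF that] A[OF smooth_arc(1)[OF that]] arc[OF that] by simp
    show "gm_verts (gmap_comp X smooth Y \<psi>' smooth_map) u = gm_verts \<psi> u" if "u \<in> verts X" for u
      using co(3)[OF that] smooth_map(3)[OF that] V[of u] c that by (simp add: smooth_simps)
  qed
  moreover have "\<psi>' \<in> U_minus smooth Y" if um: "\<psi> \<in> U_minus X Y"
  proof -
    have "bij_betw (gm0 \<psi>') (boundary smooth) (boundary Y) \<longleftrightarrow> bij_betw (gm0 \<psi>) (boundary X) (boundary Y)"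
      unfolding smooth_simps(4)[symmetric] using A by (intro bij_betw_cong) (auto simp: boundary_def)
    moreover have "gm0 \<psi>' ` arcs smooth = gm0 \<psi> ` arcs X"
    proof (intro subset_antisym subsetI)
      fix b assume "b \<in> gm0 \<psi> ` arcs X"
      then obtain a where a: "a \<in> arcs X" "b = gm0 \<psi> a" by auto
      then have "b = gm0 \<psi>' (smooth_arc a)" using arc A smooth_arc(1) by simp
      then show "b \<in> gm0 \<psi>' ` arcs smooth" using smooth_arc(1)[OF a(1)] by simp
    next
      fix b assume "b \<in> gm0 \<psi>' ` arcs smooth"
      then show "b \<in> gm0 \<psi> ` arcs X" using A sub by auto
    qed
    ultimately show ?thesis using um g by (simp add: U_minus_def active_def)
  qed
  ultimately show ?thesis using that g V by blast
qed

text \<open>Each arc of \<open>smooth\<close> is its own image under \<open>smooth_map\<close>, and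
  each vertex of \<open>smooth\<close> is sent to itself, so nothing is lost by
  precomposing.\<close>

lemma smooth_epi:
  assumes "graphical_map smooth Y \<psi>1" "graphical_map smooth Y \<psi>2"
    and eq: "gmap_comp X smooth Y \<psi>1 smooth_map = gmap_comp X smooth Y \<psi>2 smooth_map"
  shows "\<psi>1 = \<psi>2"
proof (rule gmap_eqI[OF assms(1,2)])
  note c1 = gmap_comp[OF smooth_map(1) assms(1)] and c2 = gmap_comp[OF smooth_map(1) assms(2)]
  show "gm0 \<psi>1 a = gm0 \<psi>2 a" if a: "a \<in> arcs smooth" for a
  proof -
    have "a \<in> arcs X" using a by (simp add: smooth_simps)
    then show ?thesis using c1(2) c2(2) smooth_map(2) smooth_arc(2)[OF a] eq by metis
  qed
  show "gm_verts \<psi>1 u = gm_verts \<psi>2 u" if u: "u \<in> verts smooth" for u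
  proof -
    have "u \<in> verts X" "u \<noteq> v" using u by (auto simp: smooth_simps)
    then show ?thesis using c1(3)[of u] c2(3)[of u] smooth_map(3)[of u] eq by simp
  qed
qed

end

section \<open>Smoothing as a universal property\<close>

lemma collapsed_bivalent:
  fixes X Y :: "('a :: infinite, 'v) graph"
  assumes "graphical_map X Y \<phi>" "v \<in> verts X" "gm_verts \<phi> v = {}"
  obtains x y where "bivalent X v x y"
proof -
  interpret p: graphical X Y \<phi> by unfold_locales (rule assms(1))
  obtain x y where "nb X v = {x, y}" "x \<noteq> y" using p.collapsed_ports[OF assms(2,3)] by blast
  then have "bivalent X v x y"
    using p.collapsed_no_loop[OF assms(2,3)] p.gm_graphs assms(2) by unfold_locales auto
  then show ?thesis by (rule that)
qed

definition collapsed :: "('a, 'v) graph \<Rightarrow> ('a, 'v) gmap \<Rightarrow> 'v set" where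
  "collapsed X \<phi> = {v \<in> verts X. gm_verts \<phi> v = {}}"

text \<open>This makes \<open>c\<close> the universal map collapsing \<open>v\<close> and records
  what the inductions use: the factor collapses one vertex less and remains in
  \<open>U_minus\<close>. The construction itself is then no longer needed.\<close>

definition smoothing ::
  "('a, 'v) graph \<Rightarrow> 'v \<Rightarrow> ('a, 'v) graph \<Rightarrow> ('a, 'v) gmap \<Rightarrow> bool" where
  "smoothing X v Z c \<longleftrightarrow> verts Z = verts X - {v} \<and> c \<in> U_minus X Z \<and>
     (\<forall>Y \<psi>. graphical_map X Y \<psi> \<longrightarrow> gm_verts \<psi> v = {} \<longrightarrow>
       (\<exists>\<psi>'. graphical_map Z Y \<psi>' \<and> gmap_comp X Z Y \<psi>' c = \<psi> \<and> collapsed Z \<psi>' = collapsed X \<psi> - {v} \<and>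
         (\<psi> \<in> U_minus X Y \<longrightarrow> \<psi>' \<in> U_minus Z Y))) \<and>
     (\<forall>Y \<psi>1 \<psi>2. graphical_map Z Y \<psi>1 \<longrightarrow> graphical_map Z Y \<psi>2 \<longrightarrow>
       gmap_comp X Z Y \<psi>1 c = gmap_comp X Z Y \<psi>2 c \<longrightarrow> \<psi>1 = \<psi>2)"

lemma smoothing_exists:
  fixes X Y :: "('a :: infinite, 'v) graph"
  assumes "graphical_map X Y \<phi>" "v \<in> collapsed X \<phi>"
  obtains Z c where "smoothing X v Z c"
proof -
  have "v \<in> verts X" "gm_verts \<phi> v = {}" using assms(2) by (auto simp: collapsed_def)
  then obtain x y where "bivalent X v x y" using collapsed_bivalent[OF assms(1)] by blast
  then interpret b: bivalent X v x y .
  have "\<exists>\<psi>'. graphical_map b.smooth Y \<psi>' \<and> gmap_comp X b.smooth Y \<psi>' b.smooth_map = \<psi> \<and>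
      collapsed b.smooth \<psi>' = collapsed X \<psi> - {v} \<and> (\<psi> \<in> U_minus X Y \<longrightarrow> \<psi>' \<in> U_minus b.smooth Y)"
    if "graphical_map X Y \<psi>" "gm_verts \<psi> v = {}" for Y \<psi>
  proof -
    from b.smooth_factor[OF that] obtain \<psi>' where "graphical_map b.smooth Y \<psi>'"
      "gmap_comp X b.smooth Y \<psi>' b.smooth_map = \<psi>"
      "\<And>u. u \<in> verts b.smooth \<Longrightarrow> gm_verts \<psi>' u = gm_verts \<psi> u"
      "\<psi> \<in> U_minus X Y \<Longrightarrow> \<psi>' \<in> U_minus b.smooth Y" by blast
    then show ?thesis by (intro exI[of _ \<psi>']) (auto simp: collapsed_def b.smooth_simps)
  qed
  then have "smoothing X v b.smooth b.smooth_map"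
    unfolding smoothing_def using b.smooth_simps(3) b.smooth_map(4) b.smooth_epi by blast
  then show ?thesis by (rule that)
qed

lemma smoothing_factor:
  assumes "smoothing X v Z c" "graphical_map X Y \<psi>" "v \<in> collapsed X \<psi>"
  obtains \<psi>' where "graphical_map Z Y \<psi>'" "gmap_comp X Z Y \<psi>' c = \<psi>" "collapsed Z \<psi>' = collapsed X \<psi> - {v}"
    "\<psi> \<in> U_minus X Y \<Longrightarrow> \<psi>' \<in> U_minus Z Y"
  using assms unfolding smoothing_def collapsed_def by blast

lemma smoothing_epi:
  assumes "smoothing X v Z c" "graphical_map Z Y \<psi>1" "graphical_map Z Y \<psi>2"
    "gmap_comp X Z Y \<psi>1 c = gmap_comp X Z Y \<psi>2 c"
  shows "\<psi>1 = \<psi>2"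
  using assms unfolding smoothing_def by blast

section \<open>The generalized Reedy structure\<close>

lemma isos_iff:
  "f \<in> isos graphical_category X Y \<longleftrightarrow> graphical_map X Y f \<and> (\<exists>g. graphical_map Y X g \<and>
     gmap_comp X Y X g f = gm_id X \<and> gmap_comp Y X Y f g = gm_id Y)"
  by (auto simp: isos_def graphical_category_def)

lemma U_minus_graphical: "\<phi> \<in> U_minus X Y \<Longrightarrow> graphical_map X Y \<phi>"
  by (simp add: U_minus_def active_def)

lemma U_plus_graphical: "\<phi> \<in> U_plus X Y \<Longrightarrow> graphical_map X Y \<phi>"
  by (simp add: U_plus_def)

lemma graphical_map_graphs:
  assumes "graphical_map X Y \<phi>" shows "graph X" "connected X" "graph Y" "connected Y"
  using assms by (auto simp: graphical_map_def)

lemma U_plus_comp: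
  fixes X Y Z :: "('a :: infinite, 'v) graph"
  assumes "\<phi> \<in> U_plus X Y" "\<psi> \<in> U_plus Y Z" shows "gmap_comp X Y Z \<psi> \<phi> \<in> U_plus X Z"
proof -
  note g = U_plus_graphical[OF assms(1)] U_plus_graphical[OF assms(2)]
  note co = gmap_comp[OF g]
  have "gm_verts (gmap_comp X Y Z \<psi> \<phi>) v \<noteq> {}" if v: "v \<in> verts X" for v
  proof -
    obtain w where w: "w \<in> gm_verts \<phi> v" using assms(1) v by (auto simp: U_plus_iff)
    then have "w \<in> verts Y" using gm_verts_subset[OF g(1) v] by blast
    then have "gm_verts \<psi> w \<noteq> {}" using assms(2) by (simp add: U_plus_iff)
    then show ?thesis unfolding co(3)[OF v] using w by blast
  qed
  then show ?thesis using co(1) by (simp add: U_plus_iff)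
qed

lemma U_minus_comp:
  fixes X Y Z :: "('a :: infinite, 'v) graph"
  assumes "\<phi> \<in> U_minus X Y" "\<psi> \<in> U_minus Y Z" shows "gmap_comp X Y Z \<psi> \<phi> \<in> U_minus X Z"
proof -
  note g = U_minus_graphical[OF assms(1)] U_minus_graphical[OF assms(2)]
  note co = gmap_comp[OF g]
  have "bij_betw (gm0 \<psi> \<circ> gm0 \<phi>) (boundary X) (boundary Z)"
    using assms by (auto simp: U_minus_def active_def intro: bij_betw_trans)
  moreover have "bij_betw (gm0 (gmap_comp X Y Z \<psi> \<phi>)) (boundary X) (boundary Z) \<longleftrightarrow>
    bij_betw (gm0 \<psi> \<circ> gm0 \<phi>) (boundary X) (boundary Z)"
    by (rule bij_betw_cong) (simp add: co boundary_def)
  moreover have "gm0 (gmap_comp X Y Z \<psi> \<phi>) ` arcs X = gm0 \<psi> ` gm0 \<phi> ` arcs X"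
    unfolding image_image by (rule image_cong) (simp_all add: co)
  ultimately show ?thesis using co(1) assms by (simp add: U_minus_def active_def)
qed

text \<open>A vertex collapsed by \<open>f\<close> is collapsed by every composite
  \<open>g f\<close>, whereas the identity collapses nothing.\<close>

lemma iso_U_plus:
  fixes X Y :: "('a :: infinite, 'v) graph"
  assumes "f \<in> isos graphical_category X Y" shows "f \<in> U_plus X Y"
proof -
  obtain g where f: "graphical_map X Y f" and g: "graphical_map Y X g" and gf: "gmap_comp X Y X g f = gm_id X"
    using assms by (auto simp: isos_iff)
  have "gm_verts f v \<noteq> {}" if v: "v \<in> verts X" for v
    using gmap_comp(3)[OF f g v] gm_id(3)[OF graphical_map_graphs(1,2)[OF f] v] gf by auto
  then show ?thesis using f by (simp add: U_plus_iff)
qed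

lemma isos_inverse:
  assumes "f \<in> isos graphical_category X Y"
  obtains g where "g \<in> isos graphical_category Y X" "gmap_comp X Y X g f = gm_id X" "gmap_comp Y X Y f g = gm_id Y"
  using assms unfolding isos_iff by blast

lemma isos_comp:
  fixes X Y Z :: "('a :: infinite, 'v) graph"
  assumes "f \<in> isos graphical_category X Y" "g \<in> isos graphical_category Y Z"
  shows "gmap_comp X Y Z g f \<in> isos graphical_category X Z"
proof -
  obtain f' where f: "graphical_map X Y f" "graphical_map Y X f'" "gmap_comp X Y X f' f = gm_id X"
    "gmap_comp Y X Y f f' = gm_id Y" using assms(1) by (auto simp: isos_iff)
  obtain g' where g: "graphical_map Y Z g" "graphical_map Z Y g'" "gmap_comp Y Z Y g' g = gm_id Y"
    "gmap_comp Z Y Z g g' = gm_id Z" using assms(2) by (auto simp: isos_iff)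
  have "gmap_comp X Z X (gmap_comp Z Y X f' g') (gmap_comp X Y Z g f) = gm_id X"
  proof -
    have "gmap_comp X Z X (gmap_comp Z Y X f' g') (gmap_comp X Y Z g f) =
      gmap_comp X Y X f' (gmap_comp X Z Y g' (gmap_comp X Y Z g f))"
      using gmap_comp_assoc[OF gmap_comp(1)[OF f(1) g(1)] g(2) f(2)] .
    also have "gmap_comp X Z Y g' (gmap_comp X Y Z g f) = f"
      using gmap_comp_assoc[OF f(1) g(1,2)] g(3) gmap_comp_id(2)[OF f(1)] by simp
    finally show ?thesis using f by simp
  qed
  moreover have "gmap_comp Z X Z (gmap_comp X Y Z g f) (gmap_comp Z Y X f' g') = gm_id Z"
  proof -
    have "gmap_comp Z X Z (gmap_comp X Y Z g f) (gmap_comp Z Y X f' g') =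
      gmap_comp Z Y Z g (gmap_comp Z X Y f (gmap_comp Z Y X f' g'))"
      using gmap_comp_assoc[OF gmap_comp(1)[OF g(2) f(2)] f(1) g(1)] .
    also have "gmap_comp Z X Y f (gmap_comp Z Y X f' g') = g'"
      using gmap_comp_assoc[OF g(2) f(2,1)] f(4) gmap_comp_id(2)[OF g(2)] by simp
    finally show ?thesis using g by simp
  qed
  ultimately show ?thesis
    unfolding isos_iff using gmap_comp(1)[OF f(1) g(1)] gmap_comp(1)[OF g(2) f(2)] by blast
qed

text \<open>Neither \<open>f\<close> nor its inverse collapses a vertex, so both preserve attached
  arcs. Being mutually inverse on arcs, they also preserve boundary arcs.\<close>

lemma iso_U_minus:
  fixes X Y :: "('a :: infinite, 'v) graph"
  assumes iso: "f \<in> isos graphical_category X Y" shows "f \<in> U_minus X Y"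
proof -
  obtain g where g: "g \<in> isos graphical_category Y X" and gf: "gmap_comp X Y X g f = gm_id X"
    and fg: "gmap_comp Y X Y f g = gm_id Y"
    using isos_inverse[OF iso] .
  have f: "graphical_map X Y f" and g': "graphical_map Y X g" using iso g by (auto simp: isos_iff)
  interpret f: graphical X Y f by unfold_locales (rule f)
  interpret g: graphical Y X g by unfold_locales (rule g')
  have 1: "gm0 g (gm0 f a) = a" if "a \<in> arcs X" for a
    using gmap_comp(2)[OF f g' that] gm_id(2)[OF f.gm_graphs(1,2) that] gf by simp
  have 2: "gm0 f (gm0 g a) = a" if "a \<in> arcs Y" for a
    using gmap_comp(2)[OF g' f that] gm_id(2)[OF g.gm_graphs(1,2) that] fg by simp
  have fD: "gm0 f a \<in> darcs Y" if "a \<in> darcs X" for a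
    using f.noncollapsed_inj_darcs(2)[OF _ that] iso_U_plus[OF iso] by (simp add: U_plus_iff)
  have gD: "gm0 g a \<in> darcs X" if "a \<in> darcs Y" for a
    using g.noncollapsed_inj_darcs(2)[OF _ that] iso_U_plus[OF g] by (simp add: U_plus_iff)
  have "bij_betw (gm0 f) (boundary X) (boundary Y)"
  proof (rule bij_betw_byWitness[of _ "gm0 g"])
    show "gm0 f ` boundary X \<subseteq> boundary Y"
      using f.gm0_simps(1) gD 1 by (auto simp: boundary_def) metis
    show "gm0 g ` boundary Y \<subseteq> boundary X"
      using g.gm0_simps(1) fD 2 by (auto simp: boundary_def) metis
  qed (use 1 2 in \<open>auto simp: boundary_def\<close>)
  moreover have "gm0 f ` arcs X = arcs Y"
    using f.gm0_simps(1) g.gm0_simps(1) 2 by (auto simp: image_iff) metis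
  ultimately show ?thesis using f by (simp add: U_minus_def active_def)
qed

text \<open>Surjectivity on arcs and the bijection of boundaries make every attached arc of
  \<open>Y\<close> come from an attached arc of \<open>X\<close>. Representatives then have no
  internal edges, so every vertex goes to a single vertex and the map merely relabels
  \<open>X\<close>.\<close>

lemma U_plus_minus_iso:
  fixes X Y :: "('a :: infinite, 'v) graph"
  assumes "\<phi> \<in> U_plus X Y" "\<phi> \<in> U_minus X Y"
  shows "\<phi> \<in> isos graphical_category X Y"
proof -
  have \<phi>: "graphical_map X Y \<phi>" by (rule U_plus_graphical[OF assms(1)])
  interpret p: graphical X Y \<phi> by unfold_locales (rule \<phi>)
  have nd: "\<forall>v\<in>verts X. gm_verts \<phi> v \<noteq> {}" using assms(1) by (simp add: U_plus_iff)
  have act: "active X Y \<phi>" and surj: "gm0 \<phi> ` arcs X = arcs Y" using assms(2) by (auto simp: U_minus_def)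
  then have bd: "bij_betw (gm0 \<phi>) (boundary X) (boundary Y)" by (simp add: active_def)
  note X = p.gm_graphs(1,2) and Y = p.gm_graphs(3,4)
  note Xs = graph_simps[OF X(1)] and Ys = graph_simps[OF Y(1)]
  note inj = p.noncollapsed_inj_darcs[OF nd]
  have bdY: "gm0 \<phi> a \<notin> darcs Y" if "a \<in> boundary X" for a
    using bij_betwE[OF bd] that by (auto simp: boundary_def)
  have injA: "inj_on (gm0 \<phi>) (arcs X)"
  proof (rule inj_onI)
    fix a b assume ab: "a \<in> arcs X" "b \<in> arcs X" "gm0 \<phi> a = gm0 \<phi> b"
    have iff: "gm0 \<phi> a \<in> darcs Y \<longleftrightarrow> a \<in> darcs X" if "a \<in> arcs X" for a
      using that inj(2)[of a] bdY[of a] by (auto simp: boundary_def)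
    show "a = b"
      using iff[OF ab(1)] iff[OF ab(2)] ab inj_onD[OF inj(1) ab(3)]
        inj_onD[OF bij_betw_imp_inj_on[OF bd] ab(3)] by (auto simp: boundary_def)
  qed
  \<comment> \<open>A preimage of \<open>d'\<close> cannot be a boundary arc, and disjointness
    identifies its vertex as \<open>v\<close>.\<close>
  have all: "d' \<in> gm0 \<phi> ` nb X v" if v: "v \<in> verts X" and d': "d' \<in> darcs Y" "tgt Y d' \<in> gm_verts \<phi> v" for v d'
  proof -
    obtain a where a: "a \<in> arcs X" "d' = gm0 \<phi> a" using surj Ys(2)[OF d'(1)] by blast
    then have aD: "a \<in> darcs X" using bdY[of a] d'(1) by (auto simp: boundary_def)
    then have u: "tgt X a \<in> verts X" "a \<in> nb X (tgt X a)" using Xs by (auto simp: nb_def)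
    then have "tgt X a = v"
      using p.noncollapsed_darc(2)[OF u(1) bspec[OF nd u(1)] u(2)] d'(2) a(2) p.gm_disjoint[OF u(1) v] by simp
    then show ?thesis using a u by blast
  qed
  have "\<exists>w. gm_verts \<phi> v = {w}" if v: "v \<in> verts X" for v
    using p.noncollapsed_corolla[OF v bspec[OF nd v] all[OF v]] by metis
  then obtain s where s: "\<And>v. v \<in> verts X \<Longrightarrow> gm_verts \<phi> v = {s v}" by metis
  have sV: "s ` verts X = verts Y" using p.active_verts[OF act] s by auto
  have sY: "s v \<in> verts Y" if "v \<in> verts X" for v using that sV by blast
  have sinj: "inj_on s (verts X)" using p.gm_disjoint s by (auto simp: inj_on_def)
  define t where "t = inv_into (verts X) s"
  have t: "t w \<in> verts X" "s (t w) = w" if "w \<in> verts Y" for w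
    using that sV by (auto simp: t_def inv_into_into f_inv_into_f)
  have ts: "t (s v) = v" if "v \<in> verts X" for v using that sinj by (simp add: t_def)
  define q where "q = inv_into (arcs X) (gm0 \<phi>)"
  have q: "q b \<in> arcs X" "gm0 \<phi> (q b) = b" if "b \<in> arcs Y" for b
    using that surj by (auto simp: q_def inv_into_into f_inv_into_f)
  have qp: "q (gm0 \<phi> a) = a" if "a \<in> arcs X" for a using that injA by (simp add: q_def)
  \<comment> \<open>The class of a star has one vertex, so the bijection \<open>t\<close> prescribes
    the inverse on vertices and \<open>q\<close> does so on arcs.\<close>
  define \<psi> where "\<psi> = \<lparr>gm0 = restrict q (arcs Y), gm1 = (\<lambda>w\<in>verts Y. emb_class X (star X (t w)) (star_emb X (t w)))\<rparr>"
  note st = star_class_data[OF X t(1)]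
  have A: "gm0 \<psi> a = q a" if "a \<in> arcs Y" for a using that by (simp add: \<psi>_def)
  have V: "gm_verts \<psi> w = {t w}" if "w \<in> verts Y" for w using that st(2) by (simp add: \<psi>_def gm_verts_def)
  have qdag: "q (dag Y b) = dag X (q b)" if "b \<in> arcs Y" for b
    using q[OF that] p.gm0_simps(2)[of "q b"] qp[of "dag X (q b)"] Xs(1) by simp
  have \<psi>: "graphical_map Y X \<psi>"
    unfolding graphical_map_iff
  proof (intro conjI ballI impI)
    show "gm0 \<psi> \<in> arcs Y \<rightarrow>\<^sub>E arcs X" using q by (auto simp: \<psi>_def)
    show "gm1 \<psi> \<in> verts Y \<rightarrow>\<^sub>E Emb X" using st(1) by (auto simp: \<psi>_def)
    show "gm0 \<psi> (dag Y a) = dag X (gm0 \<psi> a)" if "a \<in> arcs Y" for a using that A qdag Ys(1) by simp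
    show "v = u" if "v \<in> verts Y" "u \<in> verts Y" "gm_verts \<psi> v \<inter> gm_verts \<psi> u \<noteq> {}" for v u
      using that V t(2) by (metis disjoint_insert(2) inf_bot_right singleton_iff)
    fix w assume w: "w \<in> verts Y"
    have nbY: "nb Y w = gm0 \<phi> ` nb X (t w)"
    proof (intro subset_antisym subsetI)
      fix d assume "d \<in> nb Y w"
      then show "d \<in> gm0 \<phi> ` nb X (t w)" using all[OF t(1)[OF w]] s[OF t(1)[OF w]] t(2)[OF w] by (simp add: nb_def)
    next
      fix d assume "d \<in> gm0 \<phi> ` nb X (t w)"
      then show "d \<in> nb Y w"
        using p.noncollapsed_darc[OF t(1)[OF w] bspec[OF nd t(1)[OF w]]] s[OF t(1)[OF w]] t(2)[OF w]
        by (auto simp: nb_def)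
    qed
    have nbA: "a \<in> arcs Y" if "a \<in> nb Y w" for a using that Ys(2) by (auto simp: nb_def)
    show "inj_on (gm0 \<psi>) (nb Y w)" using A q(2) nbA by (metis inj_onI)
    have "(\<lambda>a. gm0 \<psi> (dag Y a)) ` nb Y w = dag X ` nb X (t w)"
      unfolding nbY image_image
    proof (rule image_cong)
      fix a assume "a \<in> nb X (t w)"
      then have a: "a \<in> arcs X" using p.nb_arcs by blast
      then show "gm0 \<psi> (dag Y (gm0 \<phi> a)) = dag X a"
        using A Ys(1) p.gm0_simps(1) qdag qp by simp
    qed simp
    then show "class_boundary (gm1 \<psi> w) = (\<lambda>a. gm0 \<psi> (dag Y a)) ` nb Y w"
      using st(3)[OF w] w by (simp add: \<psi>_def)
  next
    assume "boundary Y = {}"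
    then show "\<exists>v\<in>verts Y. gm_verts \<psi> v \<noteq> {}" using graph_boundary_verts[OF Y] V by auto
  qed (use X Y in auto)
  note c1 = gmap_comp[OF \<phi> \<psi>] and c2 = gmap_comp[OF \<psi> \<phi>]
  have "gmap_comp X Y X \<psi> \<phi> = gm_id X"
    by (rule gmap_eqI[OF c1(1) gm_id(1)[OF X]])
      (simp_all add: c1 gm_id[OF X] A p.gm0_simps(1) qp s sY V ts)
  moreover have "gmap_comp Y X Y \<phi> \<psi> = gm_id Y"
    by (rule gmap_eqI[OF c2(1) gm_id(1)[OF Y]]) (simp_all add: c2 gm_id[OF Y] A q s V t)
  ultimately show ?thesis using \<phi> \<psi> by (auto simp: isos_iff)
qed

section \<open>The degree on \<open>U_plus\<close>\<close>

lemma internal_edgesE: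
  assumes "graph X" "e \<in> internal_edges X"
  obtains a where "e = {a, dag X a}" "a \<in> darcs X" "dag X a \<in> darcs X" "a \<in> arcs X"
  using assms graph_simps(2)[OF assms(1)] by (auto simp: internal_edges_def)

text \<open>Picking a vertex from each \<open>gm_verts \<phi> v\<close> injects the vertices by
  disjointness, and internal edges inject because attached arcs do. If the degrees agree, both
  injections are onto, and this leaves no arc of \<open>Y\<close> outside the image.\<close>

lemma U_plus_deg:
  fixes X Y :: "('a :: infinite, 'v) graph"
  assumes up: "\<phi> \<in> U_plus X Y"
  shows "deg X \<le> deg Y" "deg Y \<le> deg X \<Longrightarrow> \<phi> \<in> U_minus X Y"
proof -
  have \<phi>: "graphical_map X Y \<phi>" by (rule U_plus_graphical[OF up])
  interpret p: graphical X Y \<phi> by unfold_locales (rule \<phi>)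
  have nd: "\<forall>v\<in>verts X. gm_verts \<phi> v \<noteq> {}" using up by (simp add: U_plus_iff)
  note X = p.gm_graphs(1,2) and Y = p.gm_graphs(3,4)
  note Xs = graph_simps[OF X(1)] and Ys = graph_simps[OF Y(1)]
  note inj = p.noncollapsed_inj_darcs[OF nd]
  have finV: "finite (verts Y)" using graph_diagram[OF Y(1)] by (simp add: diagram_def)
  have finE: "finite (internal_edges Y)"
  proof (rule finite_subset)
    show "internal_edges Y \<subseteq> (\<lambda>a. {a, dag Y a}) ` darcs Y" by (auto simp: internal_edges_def)
    show "finite ((\<lambda>a. {a, dag Y a}) ` darcs Y)"
      using graph_diagram[OF Y(1)] by (simp add: diagram_def)
  qed
  define s where "s v = (SOME w. w \<in> gm_verts \<phi> v)" for v
  have s: "s v \<in> gm_verts \<phi> v" if "v \<in> verts X" for v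
    using nd that by (simp add: s_def some_in_eq)
  have sinj: "inj_on s (verts X)" using s p.gm_disjoint by (metis inj_onI)
  have sV: "s ` verts X \<subseteq> verts Y" using s gm_verts_subset[OF \<phi>] by blast
  let ?E = "image (gm0 \<phi>)"
  have Einj: "inj_on ?E (internal_edges X)"
  proof (rule inj_onI)
    fix e e' assume e: "e \<in> internal_edges X" "e' \<in> internal_edges X" "?E e = ?E e'"
    have "e \<subseteq> darcs X" "e' \<subseteq> darcs X" using e by (auto simp: internal_edges_def)
    then show "e = e'" using inj_on_image_eq_iff[OF inj(1)] e(3) by blast
  qed
  have Esub: "?E ` internal_edges X \<subseteq> internal_edges Y"
  proof
    fix e' assume "e' \<in> ?E ` internal_edges X"
    then obtain e where e: "e \<in> internal_edges X" "e' = ?E e" by blast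
    obtain a where a: "e = {a, dag X a}" "a \<in> darcs X" "dag X a \<in> darcs X" "a \<in> arcs X"
      using internal_edgesE[OF X(1) e(1)] .
    then have "e' = {gm0 \<phi> a, dag Y (gm0 \<phi> a)}" using e p.gm0_simps(2) by simp
    moreover have "gm0 \<phi> a \<in> darcs Y" "dag Y (gm0 \<phi> a) \<in> darcs Y"
      using inj(2)[OF a(2)] inj(2)[OF a(3)] p.gm0_simps(2)[OF a(4)] by auto
    ultimately show "e' \<in> internal_edges Y" unfolding internal_edges_def by blast
  qed
  have cV: "card (verts X) \<le> card (verts Y)" using card_inj_on_le[OF sinj sV finV] .
  have cE: "card (internal_edges X) \<le> card (internal_edges Y)" using card_inj_on_le[OF Einj Esub finE] .
  show "deg X \<le> deg Y" using cV cE by (simp add: deg_def)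
  assume "deg Y \<le> deg X"
  then have "card (verts X) = card (verts Y)" "card (internal_edges X) = card (internal_edges Y)"
    using cV cE by (simp_all add: deg_def)
  then have sV': "s ` verts X = verts Y" and E': "?E ` internal_edges X = internal_edges Y"
    using card_image[OF sinj] card_image[OF Einj] card_subset_eq[OF finV sV] card_subset_eq[OF finE Esub] by auto
  have int: "\<exists>a. a \<in> darcs X \<and> dag X a \<in> darcs X \<and> d = gm0 \<phi> a" if d: "d \<in> darcs Y" "dag Y d \<in> darcs Y" for d
  proof -
    have "{d, dag Y d} \<in> internal_edges Y" using d by (auto simp: internal_edges_def)
    then obtain e where e: "e \<in> internal_edges X" "{d, dag Y d} = ?E e" using E' by blast
    obtain a where a: "e = {a, dag X a}" "a \<in> darcs X" "dag X a \<in> darcs X" "a \<in> arcs X"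
      using internal_edgesE[OF X(1) e(1)] .
    then have "d = gm0 \<phi> a \<or> d = gm0 \<phi> (dag X a)" using e by auto
    then show ?thesis using a Xs(5) by metis
  qed
  \<comment> \<open>The vertex of \<open>d\<close> is one of the picked ones. An arc at it that is
    missed would lie on an internal edge of \<open>Y\<close>, but these are all hit.\<close>
  have D: "d \<in> gm0 \<phi> ` darcs X" if d: "d \<in> darcs Y" for d
  proof (rule ccontr)
    assume no: "d \<notin> gm0 \<phi> ` darcs X"
    obtain v where v: "v \<in> verts X" "tgt Y d = s v" using sV' Ys(3)[OF d] by (metis imageE)
    have "d \<notin> gm0 \<phi> ` nb X v" using no by (auto simp: nb_def)
    then have "dag Y d \<in> darcs Y"
      using p.noncollapsed_internal[OF v(1) bspec[OF nd v(1)] d] v s by simp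
    then show False using int[OF d] no by blast
  qed
  show "\<phi> \<in> U_minus X Y"
  proof (cases "verts X = {}")
    case True
    then have "verts Y = {}" using sV' by simp
    obtain a where a: "a \<in> arcs X" "arcs X = {a, dag X a}" "darcs X = {}"
      using connected_no_verts[OF X(2) graph_pregraph[OF X(1)] True] by metis
    obtain b where b: "b \<in> arcs Y" "arcs Y = {b, dag Y b}" "darcs Y = {}"
      using connected_no_verts[OF Y(2) graph_pregraph[OF Y(1)] \<open>verts Y = {}\<close>] by metis
    have "gm0 \<phi> ` arcs X = {gm0 \<phi> a, dag Y (gm0 \<phi> a)}"
      using a(2) p.gm0_simps(2)[OF a(1)] by (metis image_empty image_insert)
    moreover have "gm0 \<phi> a = b \<or> gm0 \<phi> a = dag Y b" using p.gm0_simps(1)[OF a(1)] b(2) by auto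
    ultimately have "gm0 \<phi> ` arcs X = arcs Y" using b(1,2) Ys(5) by auto
    moreover have "boundary X = arcs X" "boundary Y = arcs Y" using a b by (auto simp: boundary_def)
    ultimately show ?thesis
      using \<phi> p.gm0_inj_boundary by (simp add: U_minus_def active_def bij_betw_def)
  next
    case False
    then have neY: "verts Y \<noteq> {}" using sV' by auto
    note dagX = graph_dag_boundary[OF X False]
    note dagY = graph_dag_boundary[OF Y neY]
    \<comment> \<open>Otherwise the edge of \<open>x\<close> goes to an internal edge of
      \<open>Y\<close>, which is already the image of an internal edge of \<open>X\<close>.
      Comparing involutes by injectivity on attached arcs, \<open>x\<close> would be
      attached.\<close>
    have sub: "gm0 \<phi> x \<in> boundary Y" if x: "x \<in> boundary X" for x
    proof (rule ccontr)
      note d = dagX[OF x]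
      assume "gm0 \<phi> x \<notin> boundary Y"
      then have "gm0 \<phi> x \<in> darcs Y" using p.gm0_simps(1)[OF d(2)] by (simp add: boundary_def)
      moreover have "gm0 \<phi> (dag X x) \<in> darcs Y" by (rule inj(2)[OF d(1)])
      ultimately obtain a where a: "a \<in> darcs X" "dag X a \<in> darcs X" "gm0 \<phi> x = gm0 \<phi> a"
        using int[of "gm0 \<phi> x"] p.gm0_simps(2)[OF d(2)] by auto
      then have "gm0 \<phi> (dag X x) = gm0 \<phi> (dag X a)" using p.gm0_simps(2) d(2) Xs(2) by simp
      then have "dag X x = dag X a" using inj_onD[OF inj(1)] a d by blast
      then have "x = a" using Xs(2,5) a d by metis
      then show False using a x by (simp add: boundary_def)
    qed
    have sup: "b \<in> gm0 \<phi> ` boundary X" if b: "b \<in> boundary Y" for b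
    proof -
      note d = dagY[OF b]
      obtain a where a: "a \<in> darcs X" "dag Y b = gm0 \<phi> a" using D[OF d(1)] by blast
      have "gm0 \<phi> (dag X a) = b" using p.gm0_simps(2)[OF Xs(2)[OF a(1)]] a(2) Ys(5)[OF d(2)] by simp
      moreover from this have "dag X a \<notin> darcs X" using inj(2)[of "dag X a"] b by (auto simp: boundary_def)
      ultimately show ?thesis using Xs(1,2) a by (intro image_eqI[of _ _ "dag X a"]) (auto simp: boundary_def)
    qed
    have "bij_betw (gm0 \<phi>) (boundary X) (boundary Y)"
      using p.gm0_inj_boundary sub sup by (auto simp: bij_betw_def)
    moreover have "gm0 \<phi> ` arcs X = arcs Y"
    proof (intro subset_antisym subsetI)
      fix b assume "b \<in> arcs Y"
      then show "b \<in> gm0 \<phi> ` arcs X" using D[of b] sup[of b] Xs(2) by (auto simp: boundary_def)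
    qed (use p.gm0_simps(1) in auto)
    ultimately show ?thesis using \<phi> by (simp add: U_minus_def active_def)
  qed
qed

section \<open>Inductions on the number of collapsed vertices\<close>

lemma finite_collapsed: "graph X \<Longrightarrow> finite (collapsed X \<phi>)"
  using graph_diagram[of X] by (simp add: diagram_def collapsed_def)

lemma not_collapsed_U_plus:
  fixes X Y :: "('a :: infinite, 'v) graph"
  shows "graphical_map X Y \<phi> \<Longrightarrow> collapsed X \<phi> = {} \<Longrightarrow> \<phi> \<in> U_plus X Y"
  by (auto simp: U_plus_iff collapsed_def)

lemma card_collapsed_less:
  assumes "graph X" "v \<in> collapsed X \<phi>"
  shows "card (collapsed X \<phi> - {v}) < card (collapsed X \<phi>)"
  by (rule card_Diff1_less[OF finite_collapsed[OF assms(1)] assms(2)])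

text \<open>If nothing is collapsed, the identity serves as the factor in \<open>U_minus\<close>; in
  the inductive step the smoothing is composed with the one obtained for the smaller graph.\<close>

lemma factor_exists:
  fixes X Y :: "('a :: infinite, 'v) graph"
  assumes "graphical_map X Y \<phi>"
  shows "\<exists>Z h g. graph Z \<and> connected Z \<and> h \<in> U_minus X Z \<and> g \<in> U_plus Z Y \<and> \<phi> = gmap_comp X Z Y g h"
  using assms
proof (induction "card (collapsed X \<phi>)" arbitrary: X \<phi> rule: less_induct)
  case less
  note \<phi> = less.prems and X = graphical_map_graphs(1,2)[OF less.prems]
  show ?case
  proof (cases "collapsed X \<phi> = {}")
    case True
    have "gm_id X \<in> U_minus X X" using active_id[OF X] by (simp add: U_minus_def)
    then show ?thesis using not_collapsed_U_plus[OF \<phi> True] gmap_comp_id(1)[OF \<phi>] X by metis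
  next
    case False
    then obtain v where v: "v \<in> collapsed X \<phi>" by blast
    obtain S c where sm: "smoothing X v S c" using smoothing_exists[OF \<phi> v] .
    then have c: "c \<in> U_minus X S" "graphical_map X S c" "verts S = verts X - {v}"
      using U_minus_graphical by (auto simp: smoothing_def)
    obtain \<phi>' where \<phi>': "graphical_map S Y \<phi>'" "gmap_comp X S Y \<phi>' c = \<phi>" "collapsed S \<phi>' = collapsed X \<phi> - {v}"
      using smoothing_factor[OF sm \<phi> v] by metis
    obtain Z h g where Z: "graph Z" "connected Z" "h \<in> U_minus S Z" "g \<in> U_plus Z Y" "\<phi>' = gmap_comp S Z Y g h"
      using less.hyps[OF _ \<phi>'(1)] card_collapsed_less[OF X(1) v] \<phi>'(3) by metis
    have "\<phi> = gmap_comp X Z Y g (gmap_comp X S Z h c)"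
      using gmap_comp_assoc[OF c(2) U_minus_graphical[OF Z(3)] U_plus_graphical[OF Z(4)]] \<phi>'(2) Z(5) by simp
    then show ?thesis using Z U_minus_comp[OF c(1) Z(3)] by blast
  qed
qed

text \<open>Smoothings can be cancelled, and once nothing is collapsed \<open>f\<close> is an
  isomorphism. Applied to an automorphism and the identity, this gives the rigidity condition for
  \<open>U_minus\<close>.\<close>

lemma U_minus_epi:
  fixes X Y Z :: "('a :: infinite, 'v) graph"
  assumes "f \<in> U_minus X Y" "graphical_map Y Z \<psi>1" "graphical_map Y Z \<psi>2"
    "gmap_comp X Y Z \<psi>1 f = gmap_comp X Y Z \<psi>2 f"
  shows "\<psi>1 = \<psi>2"
  using assms(1,4)
proof (induction "card (collapsed X f)" arbitrary: X f rule: less_induct)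
  case less
  note f = U_minus_graphical[OF less.prems(1)]
  note X = graphical_map_graphs(1,2)[OF f]
  show ?case
  proof (cases "collapsed X f = {}")
    case True
    then have "f \<in> isos graphical_category X Y"
      using U_plus_minus_iso[OF not_collapsed_U_plus[OF f] less.prems(1)] by blast
    then obtain g where g: "graphical_map Y X g" "gmap_comp Y X Y f g = gm_id Y" by (auto simp: isos_iff)
    have "gmap_comp Y X Z (gmap_comp X Y Z \<psi> f) g = \<psi>" if \<psi>: "graphical_map Y Z \<psi>" for \<psi>
      unfolding gmap_comp_assoc[OF g(1) f \<psi>] g(2) by (rule gmap_comp_id(1)[OF \<psi>])
    from this[OF assms(2)] this[OF assms(3)] show ?thesis unfolding less.prems(2) by (rule subst)
  next
    case False
    then obtain v where v: "v \<in> collapsed X f" by blast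
    obtain S c where sm: "smoothing X v S c" using smoothing_exists[OF f v] .
    then have c: "c \<in> U_minus X S" "graphical_map X S c" "verts S = verts X - {v}"
      using U_minus_graphical by (auto simp: smoothing_def)
    obtain f' where f': "graphical_map S Y f'" "gmap_comp X S Y f' c = f" "collapsed S f' = collapsed X f - {v}"
      "f' \<in> U_minus S Y" using smoothing_factor[OF sm f v] less.prems(1) by metis
    have "gmap_comp S Y Z \<psi>1 f' = gmap_comp S Y Z \<psi>2 f'"
    proof (rule smoothing_epi[OF sm gmap_comp(1)[OF f'(1) assms(2)] gmap_comp(1)[OF f'(1) assms(3)]])
      show "gmap_comp X S Z (gmap_comp S Y Z \<psi>1 f') c = gmap_comp X S Z (gmap_comp S Y Z \<psi>2 f') c"
        using gmap_comp_assoc[OF c(2) f'(1) assms(2)] gmap_comp_assoc[OF c(2) f'(1) assms(3)] f'(2) less.prems(2) by simp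
    qed
    then show ?thesis using less.hyps[OF _ f'(4)] card_collapsed_less[OF X(1) v] f'(3) by metis
  qed
qed

text \<open>A smoothing removes a vertex and adds no internal edge. Strictness is phrased through
  \<open>collapsed\<close> because an element of \<open>U_minus\<close> that collapses nothing is an
  isomorphism.\<close>

lemma U_minus_deg:
  fixes X Y :: "('a :: infinite, 'v) graph"
  assumes "f \<in> U_minus X Y"
  shows "deg Y \<le> deg X \<and> (collapsed X f \<noteq> {} \<longrightarrow> deg Y < deg X)"
  using assms
proof (induction "card (collapsed X f)" arbitrary: X f rule: less_induct)
  case less
  note f = U_minus_graphical[OF less.prems(1)]
  note X = graphical_map_graphs(1,2)[OF f]
  show ?case
  proof (cases "collapsed X f = {}")
    case True
    then have iso: "f \<in> isos graphical_category X Y"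
      using U_plus_minus_iso[OF not_collapsed_U_plus[OF f] less.prems(1)] by blast
    obtain g where "g \<in> isos graphical_category Y X" using isos_inverse[OF iso] by blast
    then show ?thesis using U_plus_deg(1)[OF iso_U_plus] True by blast
  next
    case False
    then obtain v where v: "v \<in> collapsed X f" by blast
    obtain S c where sm: "smoothing X v S c" using smoothing_exists[OF f v] .
    then have c: "c \<in> U_minus X S" "graphical_map X S c" "verts S = verts X - {v}"
      using U_minus_graphical by (auto simp: smoothing_def)
    obtain f' where f': "graphical_map S Y f'" "collapsed S f' = collapsed X f - {v}" "f' \<in> U_minus S Y"
      using smoothing_factor[OF sm f v] less.prems(1) by metis
    have "deg Y \<le> deg S" using less.hyps[OF _ f'(3)] card_collapsed_less[OF X(1) v] f'(2) by simp
    moreover have "card (internal_edges S) \<le> card (internal_edges X)"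
    proof (rule surj_card_le)
      interpret c: graphical X S c by unfold_locales (rule c(2))
      show "finite (internal_edges X)" by (rule c.finite_internal_edges)
      show "internal_edges S \<subseteq> image (gm0 c) ` internal_edges X"
      proof
        fix e' assume "e' \<in> internal_edges S"
        then obtain a' where a': "e' = {a', dag S a'}" "a' \<in> darcs S" "dag S a' \<in> darcs S" "a' \<in> arcs S"
          by (rule internal_edgesE[OF c.gm_graphs(3)])
        have bd: "gm0 c a \<in> boundary S" if "a \<in> boundary X" for a
          using c(1) that by (auto simp: U_minus_def active_def bij_betw_def)
        obtain a where a: "a \<in> arcs X" "a' = gm0 c a" using c(1) a'(4) unfolding U_minus_def by blast
        \<comment> \<open>A boundary arc of \<open>X\<close> would go to a boundary arc of
          \<open>S\<close>; hence both ends of the preimage edge are attached, and every internal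
          edge of \<open>S\<close> comes from one of \<open>X\<close>.\<close>
        have "a \<in> darcs X" "dag X a \<in> darcs X"
          using a a' bd[of a] bd[of "dag X a"] c.gm0_simps(2)[OF a(1)] graph_simps(1)[OF X(1) a(1)]
          by (auto simp: boundary_def)
        then have "{a, dag X a} \<in> internal_edges X" by (auto simp: internal_edges_def)
        moreover have "e' = gm0 c ` {a, dag X a}" using a' a c.gm0_simps(2)[OF a(1)] by simp
        ultimately show "e' \<in> image (gm0 c) ` internal_edges X" by blast
      qed
    qed
    moreover have "card (verts S) < card (verts X)"
      unfolding c(3) using card_Diff1_less[of "verts X" v] v graph_diagram[OF X(1)] by (simp only: diagram_def collapsed_def mem_Collect_eq)
    ultimately show ?thesis by (simp add: deg_def)
  qed
qed

text \<open>The second factor collapses nothing, so the composite remembers what the first one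
  collapses. Two factorizations of the same map thus collapse the same vertices, and the same
  smoothing can be split off from both.\<close>

lemma collapsed_comp_U_plus:
  fixes X Y Z :: "('a :: infinite, 'v) graph"
  assumes "graphical_map X Y h" "g \<in> U_plus Y Z"
  shows "collapsed X (gmap_comp X Y Z g h) = collapsed X h"
proof -
  have "gm_verts (gmap_comp X Y Z g h) v = {} \<longleftrightarrow> gm_verts h v = {}" if v: "v \<in> verts X" for v
    using gm_verts_subset[OF assms(1) v] assms(2)
    unfolding gmap_comp(3)[OF assms(1) U_plus_graphical[OF assms(2)] v] U_plus_iff by blast
  then show ?thesis by (auto simp: collapsed_def)
qed

text \<open>Without collapsed vertices \<open>h\<close> and \<open>h'\<close> are isomorphisms, and
  \<open>\<theta>\<close> is \<open>h'\<close> after the inverse of \<open>h\<close>. Otherwise a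
  smoothing common to both is split off, and the remaining composites agree because it can be
  cancelled.\<close>

lemma factor_unique:
  fixes X Y Z Z' :: "('a :: infinite, 'v) graph"
  assumes "h \<in> U_minus X Z" "g \<in> U_plus Z Y" "h' \<in> U_minus X Z'" "g' \<in> U_plus Z' Y"
    "gmap_comp X Z Y g h = gmap_comp X Z' Y g' h'"
  shows "\<exists>\<theta>\<in>isos graphical_category Z Z'. gmap_comp X Z Z' \<theta> h = h' \<and> gmap_comp Z Z' Y g' \<theta> = g"
  using assms(1,3,5)
proof (induction "card (collapsed X h)" arbitrary: X h h' rule: less_induct)
  case less
  note h = U_minus_graphical[OF less.prems(1)] and h' = U_minus_graphical[OF less.prems(2)]
  note X = graphical_map_graphs(1,2)[OF h]
  note g = U_plus_graphical[OF assms(2)] and g' = U_plus_graphical[OF assms(4)]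
  have col: "collapsed X h' = collapsed X h"
    using collapsed_comp_U_plus[OF h assms(2)] collapsed_comp_U_plus[OF h' assms(4)] less.prems(3) by simp
  show ?case
  proof (cases "collapsed X h = {}")
    case True
    have "h \<in> isos graphical_category X Z" "h' \<in> isos graphical_category X Z'"
      using U_plus_minus_iso[OF not_collapsed_U_plus[OF h] less.prems(1)]
        U_plus_minus_iso[OF not_collapsed_U_plus[OF h'] less.prems(2)] True col by auto
    moreover from this obtain k where k: "k \<in> isos graphical_category Z X" "gmap_comp X Z X k h = gm_id X"
      "gmap_comp Z X Z h k = gm_id Z" using isos_inverse by metis
    ultimately have \<theta>: "gmap_comp Z X Z' h' k \<in> isos graphical_category Z Z'" using isos_comp by blast
    have kg: "graphical_map Z X k" using k by (simp add: isos_iff)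
    have "gmap_comp X Z Z' (gmap_comp Z X Z' h' k) h = h'"
      using gmap_comp_assoc[OF h kg h'] k(2) gmap_comp_id(1)[OF h'] by simp
    moreover have "gmap_comp Z Z' Y g' (gmap_comp Z X Z' h' k) = g"
      using gmap_comp_assoc[OF kg h' g'] gmap_comp_assoc[OF kg h g] less.prems(3) k(3) gmap_comp_id(1)[OF g] by simp
    ultimately show ?thesis using \<theta> by blast
  next
    case False
    then obtain v where v: "v \<in> collapsed X h" by blast
    obtain S c where sm: "smoothing X v S c" using smoothing_exists[OF h v] .
    then have c: "c \<in> U_minus X S" "graphical_map X S c" "verts S = verts X - {v}"
      using U_minus_graphical by (auto simp: smoothing_def)
    obtain h1 where h1: "graphical_map S Z h1" "gmap_comp X S Z h1 c = h" "collapsed S h1 = collapsed X h - {v}"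
      "h1 \<in> U_minus S Z" using smoothing_factor[OF sm h v] less.prems(1) by metis
    obtain h2 where h2: "graphical_map S Z' h2" "gmap_comp X S Z' h2 c = h'" "h2 \<in> U_minus S Z'"
      using smoothing_factor[OF sm h'] v col less.prems(2) by metis
    have "gmap_comp S Z Y g h1 = gmap_comp S Z' Y g' h2"
    proof (rule smoothing_epi[OF sm gmap_comp(1)[OF h1(1) g] gmap_comp(1)[OF h2(1) g']])
      show "gmap_comp X S Y (gmap_comp S Z Y g h1) c = gmap_comp X S Y (gmap_comp S Z' Y g' h2) c"
        using gmap_comp_assoc[OF c(2) h1(1) g] gmap_comp_assoc[OF c(2) h2(1) g'] h1(2) h2(2) less.prems(3) by simp
    qed
    then obtain \<theta> where \<theta>: "\<theta> \<in> isos graphical_category Z Z'" "gmap_comp S Z Z' \<theta> h1 = h2" "gmap_comp Z Z' Y g' \<theta> = g"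
      using less.hyps[OF _ h1(4) h2(3)] card_collapsed_less[OF X(1) v] h1(3) by metis
    have "graphical_map Z Z' \<theta>" using \<theta>(1) by (simp add: isos_iff)
    then have "gmap_comp X Z Z' \<theta> h = h'" using gmap_comp_assoc[OF c(2) h1(1)] h1(2) h2(2) \<theta>(2) by metis
    then show ?thesis using \<theta> by blast
  qed
qed

text \<open>Since \<open>f\<close> is injective on attached arcs, \<open>\<theta>\<close> fixes
  these and their involutes. On the exceptional edge it cannot flip, as \<open>f\<close> sends an
  arc and its involute to different arcs. On vertices the sets \<open>gm_verts f\<close> are
  nonempty and disjoint, which leaves only the identity.\<close>

lemma U_plus_faithful_iso:
  fixes X Y :: "('a :: infinite, 'v) graph"
  assumes up: "f \<in> U_plus X Y" and iso: "\<theta> \<in> isos graphical_category X X" and eq: "gmap_comp X X Y f \<theta> = f"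
  shows "\<theta> = gm_id X"
proof -
  have f: "graphical_map X Y f" by (rule U_plus_graphical[OF up])
  have \<theta>: "graphical_map X X \<theta>" using iso by (simp add: isos_iff)
  interpret f: graphical X Y f by unfold_locales (rule f)
  interpret t: graphical X X \<theta> by unfold_locales (rule \<theta>)
  have ndf: "\<forall>v\<in>verts X. gm_verts f v \<noteq> {}" using up by (simp add: U_plus_iff)
  have ndt: "\<forall>v\<in>verts X. gm_verts \<theta> v \<noteq> {}" using iso_U_plus[OF iso] by (simp add: U_plus_iff)
  note X = f.gm_graphs(1,2)
  note Xs = graph_simps[OF X(1)] and Ys = graph_simps[OF f.gm_graphs(3)]
  note injf = f.noncollapsed_inj_darcs[OF ndf] and co = gmap_comp[OF \<theta> f]
  have eqA: "gm0 f (gm0 \<theta> a) = gm0 f a" if "a \<in> arcs X" for a using co(2)[OF that] eq by simp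
  have tD: "gm0 \<theta> a = a" if "a \<in> darcs X" for a
    using inj_onD[OF injf(1) eqA[OF Xs(2)[OF that]]] t.noncollapsed_inj_darcs(2)[OF ndt that] that by blast
  have tA: "gm0 \<theta> a = a" if a: "a \<in> arcs X" for a
  proof (cases "a \<in> darcs X \<or> dag X a \<in> darcs X")
    case True
    then show ?thesis
    proof
      assume d: "dag X a \<in> darcs X"
      then have "dag X (gm0 \<theta> a) = dag X a" using tD[OF d] t.gm0_simps(2)[OF a] by simp
      then show ?thesis using Xs(5) a t.gm0_simps(1) by metis
    qed (rule tD)
  next
    case False
    then have "a \<in> pre_boundary X" "dag X a \<in> pre_boundary X"
      using a Xs(1) graph_pre_boundary[OF X(1)] by (auto simp: boundary_def)
    then have "arcs X = {a, dag X a}" using connected_boundary_pair(1)[OF X(2) graph_pregraph[OF X(1)]] by blast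
    then have "gm0 \<theta> a = a \<or> gm0 \<theta> a = dag X a" using t.gm0_simps(1)[OF a] by auto
    moreover have "gm0 \<theta> a \<noteq> dag X a"
      using eqA[OF a] f.gm0_simps[OF a] Ys(4) by metis
    ultimately show ?thesis by blast
  qed
  have tV: "gm_verts \<theta> v = {v}" if v: "v \<in> verts X" for v
  proof -
    have "w = v" if w: "w \<in> gm_verts \<theta> v" for w
    proof -
      have wX: "w \<in> verts X" using gm_verts_subset[OF \<theta> v] w by blast
      then obtain x where x: "x \<in> gm_verts f w" using ndf by blast
      then have "x \<in> gm_verts f v" using co(3)[OF v] w eq by auto
      then show ?thesis using f.gm_disjoint[OF wX v x] by blast
    qed
    then show ?thesis using ndt v by blast
  qed
  show ?thesis
    by (rule gmap_eqI[OF \<theta> gm_id(1)[OF X]]) (simp_all add: tA tV gm_id[OF X])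
qed

theorem theorem2p22:
  shows "dualizable_generalized_Reedy
           (graphical_category :: (('a :: infinite, 'v :: infinite) graph, ('a, 'v) gmap) category)
           U_plus U_minus deg"
proof -
  let ?U = "graphical_category :: (('a, 'v) graph, ('a, 'v) gmap) category"
  have sel: "Ob ?U = {G. graph G \<and> connected G}" "Hom ?U X Y = {\<phi>. graphical_map X Y \<phi>}"
    "Id ?U X = gm_id X" "Comp ?U = gmap_comp" for X Y
    by (simp_all add: graphical_category_def)
  have id: "gm_id X \<in> isos ?U X X" if "graph X" "connected X" for X :: "('a, 'v) graph"
    using gm_id(1)[OF that] gmap_comp_id(1) unfolding isos_iff by blast
  have wp: "wide_subcategory ?U U_plus"
    unfolding wide_subcategory_def sel using U_plus_graphical iso_U_plus[OF id] U_plus_comp by blast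
  have wm: "wide_subcategory ?U U_minus"
    unfolding wide_subcategory_def sel using U_minus_graphical iso_U_minus[OF id] U_minus_comp by blast
  \<comment> \<open>A map in \<open>U_plus\<close> that does not raise the degree lies in
    \<open>U_minus\<close> too, so it is an isomorphism.\<close>
  have dp: "deg X < deg Y" if "f \<in> U_plus X Y" "f \<notin> isos ?U X Y" for X Y :: "('a, 'v) graph" and f
    using U_plus_deg(2)[OF that(1)] U_plus_minus_iso[OF that(1)] that(2) by force
  have dm: "deg Y < deg X" if "f \<in> U_minus X Y" "f \<notin> isos ?U X Y" for X Y :: "('a, 'v) graph" and f
    using U_minus_deg[OF that(1)] U_plus_minus_iso[OF not_collapsed_U_plus[OF U_minus_graphical[OF that(1)]] that(1)]
      that(2) by blast
  have di: "deg X = deg Y" if f: "f \<in> isos ?U X Y" for X Y :: "('a, 'v) graph" and f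
    using U_plus_deg(1)[OF iso_U_plus[OF f]] U_minus_deg[OF iso_U_minus[OF f]] by simp
  have int: "U_plus X Y \<inter> U_minus X Y = isos ?U X Y" for X Y :: "('a, 'v) graph"
    using iso_U_plus iso_U_minus U_plus_minus_iso by blast
  have rm: "\<theta> = gm_id Y" if "f \<in> U_minus X Y" "\<theta> \<in> isos ?U Y Y" "gmap_comp X Y Y \<theta> f = f"
    for X Y :: "('a, 'v) graph" and f \<theta>
  proof (rule U_minus_epi[OF that(1)])
    note f = U_minus_graphical[OF that(1)]
    show "graphical_map Y Y \<theta>" using that(2) by (simp add: isos_iff)
    show "graphical_map Y Y (gm_id Y)" using gm_id(1) graphical_map_graphs[OF f] by blast
    show "gmap_comp X Y Y \<theta> f = gmap_comp X Y Y (gm_id Y) f" using that(3) gmap_comp_id(2)[OF f] by simp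
  qed
  have fe: "\<exists>Z. (graph Z \<and> connected Z) \<and> (\<exists>h\<in>U_minus X Z. \<exists>g\<in>U_plus Z Y. f = gmap_comp X Z Y g h)"
    if "graphical_map X Y f" for X Y :: "('a, 'v) graph" and f
    using factor_exists[OF that] by blast
  show ?thesis
    unfolding dualizable_generalized_Reedy_def sel
    apply (intro conjI ballI allI impI is_category_graphical wp wm)
    subgoal using dp by blast
    subgoal using dm by blast
    subgoal using di by blast
    subgoal using int by blast
    subgoal using fe by blast
    subgoal using factor_unique by blast
    subgoal using rm by blast
    subgoal using U_plus_faithful_iso by blast
    done
qed


end
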